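(* Fix an integer $p\ge 3$, let $\lambda=\lambda_p=2\cos(\pi/p)$, and let $k$ be an odd positive integer. Let $L\ge 0$, let $\mathcal{A}_1,\dots,\mathcal{A}_L$ be hyperbolic $G_p$-equivalence classes of $\lambda$-BQFs with $\mathcal{A}_\ell=-\mathcal{A}_\ell$ for each $\ell$, let $D_\ell$ be the (common) discriminant of the forms in $\mathcal{A}_\ell$, and let $d_1,\dots,d_L,c_0,\nu,\eta$ be complex constants. Put $$q^*(z)=\sum_{\ell=1}^{L} d_\ell\sum_{\alpha\in\mathcal{Z}_{\mathcal{A}_\ell}} Q_\alpha(z)^{-k},\qquad q_0(z)=\begin{cases}\nu(1-z^{-2k}),& 2k\neq 2,\\ \nu(1-z^{-2})+\eta z^{-1},& 2k=2,\end{cases}$$ and $q=q^*+c_0q_0$, and suppose $q$ is a (Hecke-symmetric) rational period function. Suppose $F$ is an entire automorphic integral of weight $2k$ on $G_p$ with rational period function $q$, with Fourier expansion $F(z)=\sum_{n=1}^\infty a_n e^{2\pi i n z/\lambda}$ (zero constant term), and that $\Phi(s)=\int_0^\infty F(iy)y^{s}\,\frac{dy}{y}$ for $\operatorname{Re}(s)>\beta$, for some positive $\beta$. Then for $\operatorname{Re}(s)>\beta+1$ we also have $\Phi(s)=(2\pi/\lambda)^{-s}\Gamma(s)\phi(s)$ with $\phi(s)=\sum_{n=1}^\infty a_n n^{-s}$, and: (a) $\Phi(s)$ has a meromorphic continuation to the $s$-plane with, at worst, simple poles at integer points $m\le 2k$; for $\operatorname{Re}(s)>\beta$ we have $\Phi(s)=D(s)+E^0(s)+E^*(s)$,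 where $D(s)=\int_1^\infty F(iy)\left[y^{s}-y^{2k-s}\right]\frac{dy}{y}$ is entire, and $E^0(s)=-\int_1^\infty c_0q_0(iy)y^{2k-s}\frac{dy}{y}$ and $E^*(s)=-\int_1^\infty q^*(iy)y^{2k-s}\frac{dy}{y}$ (given by these integrals where they converge) have meromorphic continuations to the $s$-plane; (b) $\Phi(s)$ is bounded in every lacunary vertical strip $S(\sigma_1,\sigma_2;t_0)=\{s=\sigma+it:\sigma_1\le\sigma\le\sigma_2,\ |t|\ge t_0>0\}$; (c) $\Phi(s)$ satisfies the functional equation $\Phi(2k-s)+\Phi(s)=R(s)$, where $$R(s)=-\sum_{\ell=1}^{L} d_\ell D_\ell^{-k/2}\, i^{s}\sum_{\alpha\in\mathcal{Z}_{\mathcal{A}_\ell}}\Big\{\alpha^{s-k}B(2k-s,s-k)\,{}_2F_1\!\left[k,1-k;k-s+1;\tfrac{\alpha'}{\alpha'-\alpha}\right]+(\alpha')^{s-k}B(s,k-s)\,{}_2F_1\!\left[k,1-k;s-k+1;\tfrac{\alpha'}{\alpha'-\alpha}\right]\Big\}.$$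
   Context: $S=\begin{pmatrix}1&\lambda\\0&1\end{pmatrix}$, $T=\begin{pmatrix}0&-1\\1&0\end{pmatrix}$, and the Hecke group is $G_p=\langle S,T\rangle/\{\pm I\}\subseteq \mathrm{PSL}(2,\mathbb{R})$, acting by $Mz=\frac{az+b}{cz+d}$. For $M=\begin{pmatrix}*&*\\c&d\end{pmatrix}$ the weight $2k$ slash operator is $(F|M)(z)=(cz+d)^{-2k}F(Mz)$. An entire automorphic integral of weight $2k$ on $G_p$ with rational period function (RPF) $q$ is a function $F$ holomorphic on the upper half-plane $\mathcal H$ with expansion $F(z)=\sum_{n\ge0}a_ne^{2\pi i n z/\lambda}$ such that $z^{-2k}F(-1/z)=F(z)+q(z)$ for $z\in\mathcal H$, with $q$ rational. An element of $G_p$ with trace $a+d$ is hyperbolic if $|a+d|>2$; it is primitive if it is not $N^n$ for some $N\in G_p$, $n\ge2$. A hyperbolic fixed point is a real number fixed by a hyperbolic element of $G_p$; its Hecke conjugate $\alpha'$ is the other point fixed by its (cyclic) stabilizer. A $\lambda$-BQF is $Q=[A,B,C]$, $Q(x,y)=Ax^2+Bxy+Cy^2$, with $A,B,C\in\mathbb{Z}[\lambda]$, discriminant $B^2-4AC$; $G_p$ acts by $(Q\circ M)(x,y)=Q(ax+by,cx+dy)$, giving $G_p$-equivalence classes. For a hyperbolic fixed point $\alpha$, let $M_\alpha=\begin{pmatrix}a&b\\c&d\end{pmatrix}$ (sign chosen so $a+d>0$) be the unique primitive hyperbolic element of $G_p$ with positive trace such that $\alpha=\frac{a-d+\sqrt{(a+d)^2-4}}{2c}$,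 and set $Q_\alpha=[c,d-a,-b]$ and $Q_\alpha(z)=Q_\alpha(z,1)$. The forms $Q_\alpha$ are called hyperbolic; a $G_p$-class is hyperbolic if it contains (equivalently, consists of) hyperbolic forms. For a hyperbolic form $Q=[A,B,C]$ of discriminant $D$ put $\alpha_Q=\frac{-B+\sqrt D}{2A}$; $Q$ is simple if $A>0>C$. For a class $\mathcal A$, $-\mathcal A=\{[-A,-B,-C]:[A,B,C]\in\mathcal A\}$ and $\mathcal{Z}_{\mathcal A}=\{\alpha_Q: Q\in\mathcal A \text{ simple}\}$. Powers $z^{a}=e^{a\log z}$ use the principal branch with $-\pi\le\arg z<\pi$. $B(a,b)=\Gamma(a)\Gamma(b)/\Gamma(a+b)$ and ${}_2F_1$ is the Gauss hypergeometric function.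
   Formalization: The Dirichlet series formula for Φ(s) is claimed for Re(s)>β+1 only if also Re(s)>k+1 or a_n=O(n^β); as printed it fails, e.g. for the weight 18 cusp form (p=3, q=0) with β=0.1. The functional equation is stated for non-integer s, where R(s) is defined. *)

theory Defs
  imports "HOL-Complex_Analysis.Complex_Analysis" "HOL-Library.Landau_Symbols"
begin

section \<open>Hecke groups\<close>

definition hecke_lambda :: "nat \<Rightarrow> real" where
  "hecke_lambda p = 2 * cos (pi / real p)"

definition hecke_S :: "nat \<Rightarrow> real^2^2" where
  "hecke_S p = vector [vector [1, hecke_lambda p], vector [0, 1]]"

definition hecke_T :: "real^2^2" where
  "hecke_T = vector [vector [0, -1], vector [1, 0]]"

text \<open>
  The matrix group generated by $S$ and $T$. It contains $-I = T^2$; an element of $G_p$ is a pair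
  $\{M, -M\}$ of elements of this group, and \<open>primitive_elt\<close> below is stated modulo $\pm I$
  accordingly.
\<close>
inductive_set hecke_group :: "nat \<Rightarrow> (real^2^2) set" for p :: nat where
  gen_S: "hecke_S p \<in> hecke_group p"
| gen_T: "hecke_T \<in> hecke_group p"
| mult: "M \<in> hecke_group p \<Longrightarrow> N \<in> hecke_group p \<Longrightarrow> M ** N \<in> hecke_group p"
| inv: "M \<in> hecke_group p \<Longrightarrow> matrix_inv M \<in> hecke_group p"

text \<open>The power \<open>M ^ n\<close> of the library is the componentwise one on \<open>real^2^2\<close>.\<close>
definition mat_power :: "real^2^2 \<Rightarrow> nat \<Rightarrow> real^2^2" where
  "mat_power M n = (((**) M) ^^ n) (mat 1)"

definition hyperbolic_elt :: "nat \<Rightarrow> real^2^2 \<Rightarrow> bool" where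
  "hyperbolic_elt p M \<longleftrightarrow> M \<in> hecke_group p \<and> \<bar>trace M\<bar> > 2"

definition primitive_elt :: "nat \<Rightarrow> real^2^2 \<Rightarrow> bool" where
  "primitive_elt p M \<longleftrightarrow> M \<in> hecke_group p \<and>
     \<not> (\<exists>N\<in>hecke_group p. \<exists>n\<ge>2. M = mat_power N n \<or> M = - mat_power N n)"

text \<open>The nonvanishing of the denominator excludes $Mx = \infty$.\<close>
definition fixes_point :: "real^2^2 \<Rightarrow> real \<Rightarrow> bool" where
  "fixes_point M x \<longleftrightarrow>
     M$2$1 * x + M$2$2 \<noteq> 0 \<and> (M$1$1 * x + M$1$2) / (M$2$1 * x + M$2$2) = x"

definition hyperbolic_fixed_point :: "nat \<Rightarrow> real \<Rightarrow> bool" where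
  "hyperbolic_fixed_point p \<alpha> \<longleftrightarrow> (\<exists>M. hyperbolic_elt p M \<and> fixes_point M \<alpha>)"

definition hecke_stabilizer :: "nat \<Rightarrow> real \<Rightarrow> (real^2^2) set" where
  "hecke_stabilizer p \<alpha> = {M \<in> hecke_group p. fixes_point M \<alpha>}"

definition hecke_conj :: "nat \<Rightarrow> real \<Rightarrow> real" where
  "hecke_conj p \<alpha> = (THE \<beta>. \<beta> \<noteq> \<alpha> \<and> (\<forall>M\<in>hecke_stabilizer p \<alpha>. fixes_point M \<beta>))"


section \<open>Binary quadratic forms over $Z[\lambda]$\<close>

text \<open>The triple \<open>(A, B, C)\<close> stands for the form $A x^2 + B x y + C y^2$.\<close>
type_synonym bqf = "real \<times> real \<times> real"

definition bqf_eval :: "bqf \<Rightarrow> 'a::real_field \<Rightarrow> 'a \<Rightarrow> 'a" where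
  "bqf_eval = (\<lambda>(A, B, C) x y. of_real A * x\<^sup>2 + of_real B * x * y + of_real C * y\<^sup>2)"

definition bqf_disc :: "bqf \<Rightarrow> real" where
  "bqf_disc = (\<lambda>(A, B, C). B\<^sup>2 - 4 * A * C)"

definition bqf_neg :: "bqf \<Rightarrow> bqf" where
  "bqf_neg = (\<lambda>(A, B, C). (- A, - B, - C))"

definition Z_lambda :: "nat \<Rightarrow> real set" where
  "Z_lambda p = range (\<lambda>f :: int poly. poly (map_poly of_int f) (hecke_lambda p))"

definition lambda_bqf :: "nat \<Rightarrow> bqf \<Rightarrow> bool" where
  "lambda_bqf p = (\<lambda>(A, B, C). A \<in> Z_lambda p \<and> B \<in> Z_lambda p \<and> C \<in> Z_lambda p)"

definition bqf_act :: "bqf \<Rightarrow> real^2^2 \<Rightarrow> bqf" where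
  "bqf_act = (\<lambda>(A, B, C) M.
     let a = M$1$1; b = M$1$2; c = M$2$1; d = M$2$2
     in (A * a\<^sup>2 + B * a * c + C * c\<^sup>2,
         2 * A * a * b + B * (a * d + b * c) + 2 * C * c * d,
         A * b\<^sup>2 + B * b * d + C * d\<^sup>2))"

lemma bqf_eval_act:
  fixes x y :: real
  shows "bqf_eval (bqf_act Q M) x y =
    bqf_eval Q (M$1$1 * x + M$1$2 * y) (M$2$1 * x + M$2$2 * y)"
  by (cases Q) (simp add: bqf_eval_def bqf_act_def Let_def power2_eq_square algebra_simps)

definition bqf_class :: "nat \<Rightarrow> bqf set \<Rightarrow> bool" where
  "bqf_class p \<A> \<longleftrightarrow> (\<exists>Q. lambda_bqf p Q \<and> \<A> = bqf_act Q ` hecke_group p)"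

definition hyp_matrix :: "nat \<Rightarrow> real \<Rightarrow> real^2^2" where
  "hyp_matrix p \<alpha> = (THE M. hyperbolic_elt p M \<and> primitive_elt p M \<and> trace M > 0 \<and> M$2$1 \<noteq> 0 \<and>
     \<alpha> = (M$1$1 - M$2$2 + sqrt ((M$1$1 + M$2$2)\<^sup>2 - 4)) / (2 * M$2$1))"

definition hyp_form :: "nat \<Rightarrow> real \<Rightarrow> bqf" where
  "hyp_form p \<alpha> = (let M = hyp_matrix p \<alpha> in (M$2$1, M$2$2 - M$1$1, - (M$1$2)))"

definition hyperbolic_bqf :: "nat \<Rightarrow> bqf \<Rightarrow> bool" where
  "hyperbolic_bqf p Q \<longleftrightarrow> (\<exists>\<alpha>. hyperbolic_fixed_point p \<alpha> \<and> Q = hyp_form p \<alpha>)"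

definition hyperbolic_class :: "nat \<Rightarrow> bqf set \<Rightarrow> bool" where
  "hyperbolic_class p \<A> \<longleftrightarrow> bqf_class p \<A> \<and> (\<exists>Q\<in>\<A>. hyperbolic_bqf p Q)"

definition bqf_root :: "bqf \<Rightarrow> real" where
  "bqf_root = (\<lambda>(A, B, C). (- B + sqrt (bqf_disc (A, B, C))) / (2 * A))"

definition simple_bqf :: "bqf \<Rightarrow> bool" where
  "simple_bqf = (\<lambda>(A, B, C). A > 0 \<and> 0 > C)"

definition Z_class :: "bqf set \<Rightarrow> real set" where
  "Z_class \<A> = bqf_root ` {Q \<in> \<A>. simple_bqf Q}"


section \<open>Automorphic integrals and rational period functions\<close>

definition upper_half_plane :: "complex set" where
  "upper_half_plane = {z. Im z > 0}"

definition rational_function :: "(complex \<Rightarrow> complex) \<Rightarrow> bool" where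
  "rational_function q \<longleftrightarrow>
     (\<exists>f g :: complex poly. g \<noteq> 0 \<and> (\<forall>z. poly g z \<noteq> 0 \<longrightarrow> q z = poly f z / poly g z))"

definition entire_automorphic_integral ::
  "nat \<Rightarrow> nat \<Rightarrow> (complex \<Rightarrow> complex) \<Rightarrow> (complex \<Rightarrow> complex) \<Rightarrow> bool" where
  "entire_automorphic_integral p k q F \<longleftrightarrow>
     rational_function q \<and>
     F holomorphic_on upper_half_plane \<and>
     (\<exists>a. \<forall>z\<in>upper_half_plane.
        (\<lambda>n. a n * exp (2 * of_real pi * \<i> * of_nat n * z / of_real (hecke_lambda p))) sums F z) \<and>
     (\<forall>z\<in>upper_half_plane. F (- 1 / z) / z ^ (2 * k) = F z + q z)"

definition rational_period_function :: "nat \<Rightarrow> nat \<Rightarrow> (complex \<Rightarrow> complex) \<Rightarrow> bool" where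
  "rational_period_function p k q \<longleftrightarrow> (\<exists>F. entire_automorphic_integral p k q F)"

text \<open>The set of nonzero poles is invariant under Hecke conjugation.\<close>
definition hecke_symmetric :: "nat \<Rightarrow> (complex \<Rightarrow> complex) \<Rightarrow> bool" where
  "hecke_symmetric p q \<longleftrightarrow>
     (let P = {\<alpha> :: real. \<alpha> \<noteq> 0 \<and> is_pole q (of_real \<alpha>)} in hecke_conj p ` P = P)"

definition q_star ::
  "nat \<Rightarrow> nat \<Rightarrow> nat \<Rightarrow> (nat \<Rightarrow> bqf set) \<Rightarrow> (nat \<Rightarrow> complex) \<Rightarrow> complex \<Rightarrow> complex" where
  "q_star p k L \<A> d z =
     (\<Sum>l=1..L. d l * (\<Sum>\<alpha>\<in>Z_class (\<A> l). 1 / bqf_eval (hyp_form p \<alpha>) z 1 ^ k))"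

definition q_zero :: "nat \<Rightarrow> complex \<Rightarrow> complex \<Rightarrow> complex \<Rightarrow> complex" where
  "q_zero k \<nu> \<eta> z =
     (if 2 * k \<noteq> 2 then \<nu> * (1 - 1 / z ^ (2 * k)) else \<nu> * (1 - 1 / z\<^sup>2) + \<eta> / z)"


section \<open>Mellin transforms and the functional equation\<close>

definition mellin_integrand :: "(complex \<Rightarrow> complex) \<Rightarrow> complex \<Rightarrow> real \<Rightarrow> complex" where
  "mellin_integrand g s y = g (\<i> * of_real y) * of_real y powr s / of_real y"

definition D_integrand :: "nat \<Rightarrow> (complex \<Rightarrow> complex) \<Rightarrow> complex \<Rightarrow> real \<Rightarrow> complex" where
  "D_integrand k F s y =
     F (\<i> * of_real y) * (of_real y powr s - of_real y powr (2 * of_nat k - s)) / of_real y"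

definition D_int :: "nat \<Rightarrow> (complex \<Rightarrow> complex) \<Rightarrow> complex \<Rightarrow> complex" where
  "D_int k F s = (LINT y:{1..}|lborel. D_integrand k F s y)"

text \<open>
  $E^0$ and $E^*$ are the instances \<open>g = c\<^sub>0 q\<^sub>0\<close> and \<open>g = q\<^sup>*\<close>; \<open>E_domain\<close> is the set of all $s$ for
  which the integral converges.
\<close>
definition E_int :: "nat \<Rightarrow> (complex \<Rightarrow> complex) \<Rightarrow> complex \<Rightarrow> complex" where
  "E_int k g s = - (LINT y:{1..}|lborel. mellin_integrand g (2 * of_nat k - s) y)"

definition E_domain :: "nat \<Rightarrow> (complex \<Rightarrow> complex) \<Rightarrow> complex set" where
  "E_domain k g = {s. set_integrable lborel {1..} (mellin_integrand g (2 * of_nat k - s))}"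

definition meromorphic_continuation ::
  "(complex \<Rightarrow> complex) \<Rightarrow> complex set \<Rightarrow> (complex \<Rightarrow> complex) \<Rightarrow> bool" where
  "meromorphic_continuation f A g \<longleftrightarrow> g nicely_meromorphic_on UNIV \<and> (\<forall>s\<in>A. g s = f s)"

definition lacunary_strip :: "real \<Rightarrow> real \<Rightarrow> real \<Rightarrow> complex set" where
  "lacunary_strip \<sigma>1 \<sigma>2 t0 = {s. \<sigma>1 \<le> Re s \<and> Re s \<le> \<sigma>2 \<and> \<bar>Im s\<bar> \<ge> t0}"

text \<open>
  Complex powers for the branch $-\pi \le \arg z < \pi$. It differs from \<open>powr\<close>, whose argument
  ranges over $(-\pi, \pi]$, on the negative real axis.
\<close>
definition cpow :: "complex \<Rightarrow> complex \<Rightarrow> complex" where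
  "cpow z a = (if z = 0 then 0
     else exp (a * (if Arg z = pi then Ln z - 2 * of_real pi * \<i> else Ln z)))"

text \<open>The Gauss series; it is only used with an argument in $(0, 1)$.\<close>
definition hyp_2F1 :: "complex \<Rightarrow> complex \<Rightarrow> complex \<Rightarrow> complex \<Rightarrow> complex" where
  "hyp_2F1 a b c z = eval_fps (fps_hypergeo [a, b] [c] 1) z"

definition R_fun ::
  "nat \<Rightarrow> nat \<Rightarrow> nat \<Rightarrow> (nat \<Rightarrow> bqf set) \<Rightarrow> (nat \<Rightarrow> real) \<Rightarrow> (nat \<Rightarrow> complex) \<Rightarrow> complex \<Rightarrow> complex" where
  "R_fun p k L \<A> D d s =
     - (\<Sum>l=1..L. d l * of_real (D l powr (- real k / 2)) * cpow \<i> s *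
         (\<Sum>\<alpha>\<in>Z_class (\<A> l).
            let \<alpha>' = hecke_conj p \<alpha>;
                x = of_real (\<alpha>' / (\<alpha>' - \<alpha>));
                \<kappa> = of_nat k
            in cpow (of_real \<alpha>) (s - \<kappa>) * Beta (2 * \<kappa> - s) (s - \<kappa>) *
                 hyp_2F1 \<kappa> (1 - \<kappa>) (\<kappa> - s + 1) x
             + cpow (of_real \<alpha>') (s - \<kappa>) * Beta s (\<kappa> - s) *
                 hyp_2F1 \<kappa> (1 - \<kappa>) (s - \<kappa> + 1) x))"

end

theory Submission
  imports Defs
begin

text \<open>
  Splitting the Mellin integral at \<open>y = 1\<close> and inverting its lower half turns the transformation law of \<open>F\<close>
  into \<open>\<Phi> = D + E\<^sup>0 + E\<^sup>*\<close>. A function with an asymptotic expansion \<open>\<Sum> c\<^sub>n y\<^sup>-\<^sup>n\<close> at infinity has a Mellin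
  integral over \<open>[1, \<infinity>)\<close> that continues meromorphically: subtracting \<open>N\<close> terms of the expansion leaves an
  integral that is holomorphic and bounded in a larger half plane, and the subtracted terms contribute
  \<open>c\<^sub>n / (n - w)\<close>. This gives the continuation, the simple poles and the boundedness in lacunary strips at once.

  For the functional equation, \<open>\<A> = -\<A>\<close> gives \<open>q\<^sup>*(i/y) = y\<^sup>2\<^sup>k q\<^sup>*(iy)\<close>, so that \<open>E\<^sup>*(s) + E\<^sup>*(2k - s)\<close> is the
  integral of \<open>-q\<^sup>*(iy) y\<^sup>s\<^sup>-\<^sup>1\<close> over \<open>(0, \<infinity>)\<close>. Partial fractions reduce it to Beta integrals, whose sum is a
  terminating hypergeometric series; one of the two series needs the reflection \<open>x \<mapsto> 1 - x\<close>. The identity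
  is established in \<open>0 < Re s < 1\<close> and extends to all nonintegral \<open>s\<close> by the identity theorem.

  That \<open>Q\<^sub>\<alpha>\<close> recovers the form \<open>Q\<close> with root \<open>\<alpha>\<close>, and that Hecke conjugation is the other root, rests on the
  discreteness of \<open>G\<^sub>p\<close>: up to sign and up to factors \<open>T\<close> on both sides, every element is a product of
  nonnegative matrices whose entries vanish or are at least 1, so the same holds in absolute value for all
  elements of the group.

  The coefficients \<open>a\<^sub>n\<close> grow polynomially because \<open>|Q(z)| \<ge> \<surd>D Im z\<close> bounds \<open>q\<^sup>*\<close>, and \<open>z \<mapsto> -1/z\<close> moves low points
  of the fundamental strip up by a fixed factor.
\<close>

section \<open>Mellin integrals over a half line\<close>

text \<open>Three obstacles shape the proof. Convergence of the Mellin integral controls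
  \<open>F\<close> on the imaginary axis alone and says nothing about single coefficients; their
  size has to come from a bound on \<open>F\<close> in the whole half plane. For that bound the part
  \<nu>(1 - z^(-2k)) of the period function is too large near the real axis, and it is absorbed by
  adding a constant to \<open>F\<close>. \<open>hyp_matrix\<close> and \<open>hecke_conj\<close> are
  definite descriptions, so nothing is known about them until the stabilizer of a hyperbolic fixed
  point has been analysed. The lower bound 1 for nonzero entries serves twice there: it excludes
  parabolic elements, and it keeps the multipliers greater than 1 away from 1, so that a least one
  exists. The strip 0 < Re s < 1 is where all partial fraction terms can be integrated one by one:
  y^s at 0 needs Re s > 0, and a simple linear factor at infinity needs Re s < 1. Oddness of k
  enters as i^(2k) = -1. It makes D(s) change sign under s \<mapsto> 2k - s and makes the q0 part
  cancel, so that only the contribution of the quadratic forms survives in R(s).\<close>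

lemma holomorphic_on_lebesgue_integral:
  fixes f :: "complex \<Rightarrow> 'a \<Rightarrow> complex"
  assumes U: "open U"
    and hol: "\<And>x. x \<in> space M \<Longrightarrow> (\<lambda>s. f s x) holomorphic_on U"
    and meas: "\<And>s. s \<in> U \<Longrightarrow> f s \<in> borel_measurable M"
    and dom: "\<And>s\<^sub>0. s\<^sub>0 \<in> U \<Longrightarrow> \<exists>r>0. \<exists>g. integrable M g \<and>
                (\<forall>s\<in>ball s\<^sub>0 r \<inter> U. \<forall>x\<in>space M. norm (f s x) \<le> g x)"
  shows "(\<lambda>s. LINT x|M. f s x) holomorphic_on U"
proof (rule holomorphic_onI)
  fix s\<^sub>0 assume s0: "s\<^sub>0 \<in> U"
  obtain r1 g where r1: "r1 > 0" and g: "integrable M g"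
    and bd1: "\<And>s x. s \<in> ball s\<^sub>0 r1 \<inter> U \<Longrightarrow> x \<in> space M \<Longrightarrow> norm (f s x) \<le> g x"
    using dom[OF s0] by blast
  obtain r2 where r2: "r2 > 0" "ball s\<^sub>0 r2 \<subseteq> U"
    using U s0 open_contains_ball by blast
  define r where "r = min r1 r2"
  have r: "r > 0" "ball s\<^sub>0 r \<subseteq> U" "ball s\<^sub>0 r \<subseteq> ball s\<^sub>0 r1"
    using r1 r2 by (auto simp: r_def)
  have bd: "norm (f s x) \<le> g x" if "s \<in> ball s\<^sub>0 r" "x \<in> space M" for s x
    using that r by (intro bd1) auto
  \<comment> \<open>Discs of radius r/4 about points of \<open>B\<close> stay in the ball where
    \<open>g\<close> dominates. Cauchy's inequality therefore carries the domination over to the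
    derivative and, along segments of the convex \<open>B\<close>, to the difference
    quotients.\<close>
  define B where "B = ball s\<^sub>0 (r/2)"
  have B: "open B" "s\<^sub>0 \<in> B" "B \<subseteq> U" "convex B"
    using r by (auto simp: B_def)
  have int_f: "integrable M (f s)" if "s \<in> B" for s
    by (rule Bochner_Integration.integrable_bound[OF g meas])
       (use that B bd[of s] r in \<open>auto simp: B_def intro!: AE_I2 intro: order_trans[OF _ abs_ge_self]\<close>)
  have deriv_bd: "norm (deriv (\<lambda>s. f s x) w) \<le> g x / (r/4)" if w: "w \<in> B" and x: "x \<in> space M" for w x
  proof -
    have sub: "cball w (r/4) \<subseteq> ball s\<^sub>0 r"
    proof
      fix z assume "z \<in> cball w (r/4)"
      then show "z \<in> ball s\<^sub>0 r"
        using w r dist_triangle[of s\<^sub>0 z w] by (auto simp: B_def)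
    qed
    have h: "(\<lambda>s. f s x) holomorphic_on cball w (r/4)"
      using hol[OF x] sub r by (meson holomorphic_on_subset subset_trans)
    have "norm ((deriv ^^ 1) (\<lambda>s. f s x) w) \<le> fact 1 * g x / (r/4)^1"
    proof (rule Cauchy_inequality)
      show "norm (f z x) \<le> g x" if "norm (w - z) = r/4" for z
        using bd[of z x] x sub that by (auto simp: dist_norm)
    qed (use h r in \<open>auto intro: holomorphic_on_subset holomorphic_on_imp_continuous_on\<close>)
    then show ?thesis by simp
  qed
  have lip: "norm (f s x - f s\<^sub>0 x) \<le> g x / (r/4) * norm (s - s\<^sub>0)" if s: "s \<in> B" and x: "x \<in> space M" for s x
  proof (rule field_differentiable_bound[OF B(4)])
    show "((\<lambda>s. f s x) has_field_derivative deriv (\<lambda>s. f s x) z) (at z within B)" if "z \<in> B" for z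
      using hol[OF x] U B that by (meson holomorphic_derivI has_field_derivative_at_within subsetD)
  qed (use deriv_bd x s B in auto)
  define f' where "f' x = deriv (\<lambda>s. f s x) s\<^sub>0" for x
  have "((\<lambda>s. (LINT x|M. f s x)) has_field_derivative (LINT x|M. f' x)) (at s\<^sub>0 within B)"
    unfolding has_field_derivative_iff tendsto_at_iff_sequentially
  proof (intro allI impI)
    fix X assume X: "\<forall>i. X i \<in> B - {s\<^sub>0}" "X \<longlonglongrightarrow> s\<^sub>0"
    define Y where "Y i x = (f (X i) x - f s\<^sub>0 x) / (X i - s\<^sub>0)" for i x
    have Y_lim: "(\<lambda>i. Y i x) \<longlonglongrightarrow> f' x" if x: "x \<in> space M" for x
    proof -
      have "((\<lambda>s. f s x) has_field_derivative f' x) (at s\<^sub>0 within B)"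
        unfolding f'_def using hol[OF x] U s0
        by (meson holomorphic_derivI has_field_derivative_at_within)
      then show ?thesis
        unfolding has_field_derivative_iff tendsto_at_iff_sequentially
        using X by (auto simp: Y_def o_def)
    qed
    have Y_meas: "Y i \<in> borel_measurable M" for i
      unfolding Y_def using X B s0 by (intro borel_measurable_divide borel_measurable_diff meas) auto
    have f'_meas: "f' \<in> borel_measurable M"
      by (rule borel_measurable_LIMSEQ_metric[OF Y_meas Y_lim])
    have "(\<lambda>i. LINT x|M. Y i x) \<longlonglongrightarrow> (LINT x|M. f' x)"
    proof (rule integral_dominated_convergence[where w = "\<lambda>x. g x / (r/4)"])
      show "AE x in M. norm (Y i x) \<le> g x / (r/4)" for i
      proof (rule AE_I2)
        fix x assume x: "x \<in> space M"
        have "norm (X i - s\<^sub>0) > 0" using X by auto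
        then show "norm (Y i x) \<le> g x / (r/4)"
          using lip[of "X i" x] x X by (simp add: Y_def norm_divide pos_divide_le_eq)
      qed
    qed (use f'_meas Y_meas g Y_lim in auto)
    moreover have "(LINT x|M. Y i x) = ((LINT x|M. f (X i) x) - (LINT x|M. f s\<^sub>0 x)) / (X i - s\<^sub>0)" for i
      unfolding Y_def using X B by (simp add: int_f Bochner_Integration.integral_diff)
    ultimately show "((\<lambda>y. ((LINT x|M. f y x) - (LINT x|M. f s\<^sub>0 x)) / (y - s\<^sub>0)) \<circ> X) \<longlonglongrightarrow> (LINT x|M. f' x)"
      by (simp add: o_def)
  qed
  then show "(\<lambda>s. LINT x|M. f s x) field_differentiable (at s\<^sub>0 within U)"
    using B(1,2) U s0 by (metis at_within_open field_differentiable_def)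
qed

section \<open>Integrals of powers over a half line\<close>

lemma norm_of_real_powr_complex:
  "y > 0 \<Longrightarrow> norm (complex_of_real y powr w) = y powr Re w"
  by (simp add: norm_powr_real_powr)

lemma set_borel_measurable_lborel_continuous:
  fixes f :: "real \<Rightarrow> 'a::real_normed_vector"
  assumes "A \<in> sets borel" "continuous_on A f"
  shows "set_borel_measurable lborel A f"
  using borel_measurable_continuous_on_indicator[OF assms]
  by (simp add: set_borel_measurable_def)

lemma set_integrable_powr_tail:
  fixes \<sigma> :: real
  assumes "\<sigma> < 0"
  shows "set_integrable lborel {1..} (\<lambda>y. y powr \<sigma> / y)"
proof -
  have hi: "((\<lambda>x. x powr (\<sigma> - 1)) has_integral - (1 powr (\<sigma> - 1 + 1)) / (\<sigma> - 1 + 1)) {1..}"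
    using assms by (intro has_integral_powr_to_inf) auto
  have "(\<lambda>x. x powr (\<sigma> - 1)) absolutely_integrable_on {1..}"
    by (rule nonnegative_absolutely_integrable_1) (use hi in auto)
  then have "set_integrable lborel {1..} (\<lambda>y. y powr (\<sigma> - 1))"
    by (simp add: set_integrable_def integrable_completion)
  then show ?thesis
    by (rule set_integrable_cong[THEN iffD1, rotated -1]) (auto simp: powr_diff)
qed

text \<open>Used by contraposition: where a Mellin integral converges, a nonzero leading coefficient
  of the expansion would leave an integrand of size at least a constant times 1/y.\<close>

lemma not_set_integrable_inverse_tail:
  fixes Y :: real assumes "Y > 0"
  shows "\<not> set_integrable lborel {Y..} (\<lambda>y. 1 / y)"
proof
  assume I: "set_integrable lborel {Y..} (\<lambda>y::real. 1 / y)"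
  define K where "K = (LINT y:{Y..}|lborel. 1 / y)"
  have bd: "ln b - ln Y \<le> K" if b: "b \<ge> Y" for b
  proof -
    have "((\<lambda>y. 1 / y) has_integral (ln b - ln Y)) {Y..b}"
      by (rule fundamental_theorem_of_calculus)
         (use assms b in \<open>auto intro!: derivative_eq_intros simp: has_real_derivative_iff_has_vector_derivative[symmetric] divide_inverse\<close>)
    then have e: "integral {Y..b} (\<lambda>y. 1 / y) = ln b - ln Y" by blast
    have I2: "set_integrable lborel {Y..b} (\<lambda>y. 1 / y)"
      by (rule set_integrable_subset[OF I]) auto
    have "(LINT y:{Y..b}|lborel. 1 / y) \<le> K"
      unfolding K_def set_lebesgue_integral_def
      by (rule integral_mono) (use I I2 assms in \<open>auto simp: set_integrable_def indicator_def\<close>)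
    then show ?thesis
      using set_borel_integral_eq_integral(2)[OF I2] e by simp
  qed
  \<comment> \<open>Up to this endpoint the integral is |K| + 1, more than \<open>K\<close>.\<close>
  have "Y * exp (\<bar>K\<bar> + 1) \<ge> Y" using assms by simp
  from bd[OF this] show False
    using assms by (simp add: ln_mult)
qed

section \<open>Mellin integrals over the half line from 1 and their continuation\<close>

definition tail_mellin :: "(real \<Rightarrow> complex) \<Rightarrow> complex \<Rightarrow> complex" where
  "tail_mellin g w = (LINT y:{1..}|lborel. g y * of_real y powr w / of_real y)"

lemma tail_mellin_const:
  assumes "Re w < 0"
  shows "set_integrable lborel {1..} (\<lambda>y. complex_of_real y powr w / of_real y)"
    and "(LINT y:{1..}|lborel. complex_of_real y powr w / of_real y) = - 1 / w"
proof -
  have w0: "w \<noteq> 0" using assms by auto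
  show I: "set_integrable lborel {1..} (\<lambda>y. complex_of_real y powr w / of_real y)"
  proof (rule set_integrable_bound[OF set_integrable_powr_tail[OF assms]])
    show "set_borel_measurable lborel {1..} (\<lambda>y. complex_of_real y powr w / complex_of_real y)"
      by (intro set_borel_measurable_lborel_continuous continuous_intros) auto
  qed (auto simp: norm_divide norm_of_real_powr_complex)
  have I': "set_integrable lborel (einterval 1 \<infinity>) (\<lambda>y. complex_of_real y powr w / of_real y)"
    by (rule set_integrable_subset[OF I]) (auto simp: einterval_def one_ereal_def)
  have d: "((\<lambda>y. complex_of_real y powr w / w) has_vector_derivative
           (complex_of_real y powr w / complex_of_real y)) (at y)" if "y > 0" for y
  proof -
    have "((\<lambda>z. z powr w / w) has_field_derivative (complex_of_real y powr w / of_real y)) (at (complex_of_real y))"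
      using that w0 by (auto intro!: derivative_eq_intros simp: complex_nonpos_Reals_iff powr_diff)
    from has_vector_derivative_real_field[OF this] show ?thesis .
  qed
  have lim: "((\<lambda>y. complex_of_real y powr w / w) \<longlongrightarrow> 0) at_top"
  proof (rule tendsto_norm_zero_cancel)
    have "((\<lambda>y. y powr Re w / norm w) \<longlongrightarrow> 0 / norm w) at_top"
      using assms by (intro tendsto_intros tendsto_neg_powr filterlim_ident) (use w0 in auto)
    then have "((\<lambda>y. y powr Re w / norm w) \<longlongrightarrow> 0) at_top" by simp
    then show "((\<lambda>y. norm (complex_of_real y powr w / w)) \<longlongrightarrow> 0) at_top"
      by (rule Lim_transform_eventually)
         (auto intro!: eventually_mono[OF eventually_gt_at_top[of 0]] simp: norm_divide norm_of_real_powr_complex)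
  qed
  have "(LBINT y=1..\<infinity>. complex_of_real y powr w / of_real y) = 0 - 1 / w"
  proof (rule interval_integral_FTC_integrable)
    show "((\<lambda>y. complex_of_real y powr w / w) has_vector_derivative
           (complex_of_real y powr w / complex_of_real y)) (at y)" if "1 < ereal y" for y
      using d[of y] that by (auto simp: one_ereal_def)
    show "isCont (\<lambda>y. complex_of_real y powr w / complex_of_real y) y" if "1 < ereal y" for y
    proof -
      have "continuous_on {1<..} (\<lambda>y. complex_of_real y powr w / complex_of_real y)"
        by (intro continuous_intros) auto
      then show ?thesis
        using that by (auto simp: one_ereal_def continuous_on_eq_continuous_at)
    qed
    have "isCont (\<lambda>y. complex_of_real y powr w / w) 1"
      using d[of 1] by (auto intro: has_vector_derivative_continuous)
    then have "((\<lambda>y. complex_of_real y powr w / w) \<longlongrightarrow> 1 / w) (at_right 1)"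
      by (auto simp: isCont_def intro: filterlim_at_split[THEN iffD1, THEN conjunct2])
    then show "(((\<lambda>y. complex_of_real y powr w / w) \<circ> real_of_ereal) \<longlongrightarrow> 1 / w) (at_right 1)"
      by (simp add: one_ereal_def ereal_tendsto_simps)
    show "(((\<lambda>y. complex_of_real y powr w / w) \<circ> real_of_ereal) \<longlongrightarrow> 0) (at_left \<infinity>)"
      using lim by (simp add: ereal_tendsto_simps)
  qed (use I' in auto)
  moreover have "(LBINT y=1..\<infinity>. complex_of_real y powr w / of_real y)
      = (LINT y:{1<..}|lborel. complex_of_real y powr w / of_real y)"
    by (simp add: interval_lebesgue_integral_def one_ereal_def)
  moreover have "(LINT y:{1<..}|lborel. complex_of_real y powr w / of_real y)
     = (LINT y:{1..}|lborel. complex_of_real y powr w / of_real y)"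
    unfolding set_lebesgue_integral_def
    by (rule integral_cong_AE)
       (use AE_lborel_singleton[of 1] in \<open>auto simp: indicator_def elim!: eventually_mono\<close>)
  ultimately show "(LINT y:{1..}|lborel. complex_of_real y powr w / of_real y) = - 1 / w"
    by simp
qed

text \<open>The error bound is asked for on all of [1, \<infinity>), not only for large y, so that
  each remainder can be integrated over the whole half line. The series itself may diverge, and the
  constant depends on \<open>N\<close>.\<close>

definition asymptotic_expansion :: "(real \<Rightarrow> complex) \<Rightarrow> (nat \<Rightarrow> complex) \<Rightarrow> bool" where
  "asymptotic_expansion g c \<longleftrightarrow> continuous_on {1..} g \<and>
     (\<forall>N. \<exists>C. \<forall>y\<ge>1. norm (g y - (\<Sum>n<N. c n / of_real y ^ n)) \<le> C / y ^ N)"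

definition expansion_rem :: "(real \<Rightarrow> complex) \<Rightarrow> (nat \<Rightarrow> complex) \<Rightarrow> nat \<Rightarrow> real \<Rightarrow> complex" where
  "expansion_rem g c N y = g y - (\<Sum>n<N. c n / of_real y ^ n)"

text \<open>\<open>N\<close> is the least natural number above Re w, so the formula changes from
  strip to strip and its consistency has to be proved. At w = n the term with index n is a division
  by zero with value 0; values at poles thus carry no meaning and are repaired later by
  \<open>remove_sings\<close>.\<close>

definition mellin_cont :: "(real \<Rightarrow> complex) \<Rightarrow> (nat \<Rightarrow> complex) \<Rightarrow> complex \<Rightarrow> complex" where
  "mellin_cont g c w = (let N = nat (\<lfloor>Re w\<rfloor> + 1) in
     (\<Sum>n<N. c n / (of_nat n - w)) + tail_mellin (expansion_rem g c N) w)"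

lemma set_integrable_tail_bound:
  assumes cont: "continuous_on {1..} h" and bd: "\<And>y. y \<ge> 1 \<Longrightarrow> norm (h y) \<le> C * y powr \<tau>"
    and w: "Re w + \<tau> < 0"
  shows "set_integrable lborel {1..} (\<lambda>y. h y * complex_of_real y powr w / of_real y)"
proof (rule set_integrable_bound)
  show "set_integrable lborel {1..} (\<lambda>y. C * (y powr (Re w + \<tau>) / y))"
    using set_integrable_powr_tail[OF w] by (rule set_integrable_mult_right)
  show "set_borel_measurable lborel {1..} (\<lambda>y. h y * complex_of_real y powr w / complex_of_real y)"
    by (intro set_borel_measurable_lborel_continuous continuous_intros cont) auto
  show "AE y in lborel. y \<in> {1..} \<longrightarrow>
      norm (h y * complex_of_real y powr w / complex_of_real y) \<le> norm (C * (y powr (Re w + \<tau>) / y))"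
  proof (intro AE_I2 impI)
    fix y :: real assume y: "y \<in> {1..}"
    have "norm (h y * complex_of_real y powr w / complex_of_real y) = norm (h y) * y powr Re w / y"
      using y by (simp add: norm_mult norm_divide norm_of_real_powr_complex)
    also have "\<dots> \<le> (C * y powr \<tau>) * y powr Re w / y"
      using y by (intro divide_right_mono mult_right_mono bd) auto
    also have "\<dots> = C * (y powr (Re w + \<tau>) / y)"
      by (simp add: powr_add)
    finally show "norm (h y * complex_of_real y powr w / complex_of_real y) \<le> norm (C * (y powr (Re w + \<tau>) / y))"
      by (rule order_trans) (simp only: real_norm_def abs_ge_self)
  qed
qed

lemma tail_mellin_holomorphic:
  assumes cont: "continuous_on {1..} h" and bd: "\<And>y. y \<ge> 1 \<Longrightarrow> norm (h y) \<le> C * y powr \<tau>"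
  shows "tail_mellin h holomorphic_on {w. Re w + \<tau> < 0}"
  unfolding tail_mellin_def[abs_def] set_lebesgue_integral_def
proof (rule holomorphic_on_lebesgue_integral)
  show "open {w. Re w + \<tau> < 0}"
    by (intro open_Collect_less continuous_intros)
  show "(\<lambda>w. indicat_real {1..} y *\<^sub>R (h y * complex_of_real y powr w / complex_of_real y))
      holomorphic_on {w. Re w + \<tau> < 0}" for y
    by (cases "y \<ge> 1") (auto intro!: holomorphic_intros simp: scaleR_conv_of_real)
  show "(\<lambda>y. indicat_real {1..} y *\<^sub>R (h y * complex_of_real y powr w / complex_of_real y)) \<in> borel_measurable lborel" for w
    unfolding set_borel_measurable_def[symmetric]
    by (intro set_borel_measurable_lborel_continuous continuous_intros cont) auto
  fix w0 assume w0: "w0 \<in> {w. Re w + \<tau> < 0}"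
  \<comment> \<open>Half the distance to the boundary line, so the exponent Re w0 + r + \<tau> of
    the dominating function is still negative.\<close>
  define r where "r = - (Re w0 + \<tau>) / 2"
  have r: "r > 0" using w0 by (auto simp: r_def)
  define g where "g y = indicat_real {1..} y *\<^sub>R (C * (y powr (Re w0 + r + \<tau>) / y))" for y
  have g: "integrable lborel g"
  proof -
    have "set_integrable lborel {1..} (\<lambda>y. y powr (Re w0 + r + \<tau>) / y)"
      using r by (intro set_integrable_powr_tail) (simp add: r_def field_simps)
    then have "set_integrable lborel {1..} (\<lambda>y. C * (y powr (Re w0 + r + \<tau>) / y))"
      by (rule set_integrable_mult_right)
    then show ?thesis by (simp add: set_integrable_def g_def[abs_def])
  qed
  have C: "C \<ge> 0" using bd[of 1] norm_ge_zero[of "h 1"] by (metis mult.right_neutral order.refl order_trans powr_one_eq_one)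
  have "norm (indicat_real {1..} y *\<^sub>R (h y * complex_of_real y powr w / complex_of_real y)) \<le> g y"
    if w: "w \<in> ball w0 r" for w y
  proof (cases "y \<ge> 1")
    case True
    have "Re (w - w0) \<le> norm (w - w0)" by (rule complex_Re_le_cmod)
    also have "\<dots> < r" using w by (auto simp: dist_norm norm_minus_commute)
    finally have "Re w \<le> Re w0 + r" by simp
    then have p: "y powr Re w \<le> y powr (Re w0 + r)" using True by (intro powr_mono) auto
    have "norm (h y * complex_of_real y powr w / complex_of_real y) = norm (h y) * y powr Re w / y"
      using True by (simp add: norm_mult norm_divide norm_of_real_powr_complex)
    also have "\<dots> \<le> (C * y powr \<tau>) * y powr (Re w0 + r) / y"
      using True p C by (intro divide_right_mono mult_mono bd) auto
    also have "\<dots> = C * (y powr (Re w0 + r + \<tau>) / y)"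
      by (simp add: powr_add)
    finally show ?thesis using True by (simp add: g_def)
  qed (auto simp: g_def)
  then show "\<exists>r>0. \<exists>g. integrable lborel g \<and> (\<forall>w\<in>ball w0 r \<inter> {w. Re w + \<tau> < 0}. \<forall>y\<in>space lborel.
       norm (indicat_real {1..} y *\<^sub>R (h y * complex_of_real y powr w / complex_of_real y)) \<le> g y)"
    using r g by blast
qed

text \<open>|y^w| depends on Re w alone, so the bound is uniform in Im w. The estimates in vertical
  strips rest on this.\<close>

lemma tail_mellin_norm_le:
  assumes bd: "\<And>y. y \<ge> 1 \<Longrightarrow> norm (h y) \<le> C * y powr \<tau>" and w: "Re w \<le> \<sigma>" "\<sigma> + \<tau> < 0"
  shows "norm (tail_mellin h w) \<le> (LINT y:{1..}|lborel. C * (y powr (\<sigma> + \<tau>) / y))"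
  unfolding tail_mellin_def set_lebesgue_integral_def
proof (rule order_trans[OF integral_norm_bound], rule integral_mono')
  have C: "C \<ge> 0" using bd[of 1] norm_ge_zero[of "h 1"] by (metis mult.right_neutral order.refl order_trans powr_one_eq_one)
  have "set_integrable lborel {1..} (\<lambda>y. C * (y powr (\<sigma> + \<tau>) / y))"
    using set_integrable_powr_tail[OF w(2)] by (rule set_integrable_mult_right)
  then show "integrable lborel (\<lambda>y. indicat_real {1..} y *\<^sub>R (C * (y powr (\<sigma> + \<tau>) / y)))"
    by (simp add: set_integrable_def)
  show "norm (indicat_real {1..} y *\<^sub>R (h y * complex_of_real y powr w / complex_of_real y))
        \<le> indicat_real {1..} y *\<^sub>R (C * (y powr (\<sigma> + \<tau>) / y))" for y
  proof (cases "y \<ge> 1")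
    case True
    have p: "y powr Re w \<le> y powr \<sigma>" using True w by (intro powr_mono) auto
    have "norm (h y * complex_of_real y powr w / complex_of_real y) = norm (h y) * y powr Re w / y"
      using True by (simp add: norm_mult norm_divide norm_of_real_powr_complex)
    also have "\<dots> \<le> (C * y powr \<tau>) * y powr \<sigma> / y"
      using True p C by (intro divide_right_mono mult_mono bd) auto
    also have "\<dots> = C * (y powr (\<sigma> + \<tau>) / y)"
      by (simp add: powr_add)
    finally show ?thesis using True by simp
  qed auto
  show "0 \<le> indicat_real {1..} y *\<^sub>R (C * (y powr (\<sigma> + \<tau>) / y))" for y
    using C by (cases "y \<ge> 1") auto
qed

context
  fixes g :: "real \<Rightarrow> complex" and c :: "nat \<Rightarrow> complex"
  assumes exp: "asymptotic_expansion g c"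
begin

lemma expansion_cont: "continuous_on {1..} g"
  using exp by (auto simp: asymptotic_expansion_def)

lemma expansion_rem_cont: "continuous_on {1..} (expansion_rem g c N)"
  unfolding expansion_rem_def[abs_def] by (intro continuous_intros expansion_cont) auto

lemma expansion_rem_bound:
  obtains C where "\<And>y. y \<ge> 1 \<Longrightarrow> norm (expansion_rem g c N y) \<le> C * y powr (- real N)"
proof -
  obtain C where C: "\<And>y. y \<ge> 1 \<Longrightarrow> norm (g y - (\<Sum>n<N. c n / of_real y ^ n)) \<le> C / y ^ N"
    using exp unfolding asymptotic_expansion_def by blast
  have "norm (expansion_rem g c N y) \<le> C * y powr (- real N)" if "y \<ge> 1" for y
    using C[OF that] that by (simp add: expansion_rem_def powr_minus powr_realpow field_simps)
  then show ?thesis by (rule that)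
qed

lemma expansion_rem_integrable:
  assumes "Re w < real N"
  shows "set_integrable lborel {1..} (\<lambda>y. expansion_rem g c N y * complex_of_real y powr w / of_real y)"
  by (rule expansion_rem_bound[of N], rule set_integrable_tail_bound[OF expansion_rem_cont])
     (use assms in auto)

text \<open>Taking one more term out of the remainder splits off the integral of c N y^(w-N-1),
  which converges to c N / (N - w) for Re w < N.\<close>

lemma tail_mellin_rem_Suc:
  assumes "Re w < real N"
  shows "tail_mellin (expansion_rem g c N) w
       = c N / (of_nat N - w) + tail_mellin (expansion_rem g c (Suc N)) w"
proof -
  have w: "Re (w - of_nat N) < 0" using assms by simp
  have N: "Re w < real (Suc N)" using assms by simp
  let ?p = "\<lambda>y. c N * (complex_of_real y powr (w - of_nat N) / of_real y)"
  have I: "set_integrable lborel {1..} ?p"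
    using tail_mellin_const(1)[OF w] by (rule set_integrable_mult_right)
  have "tail_mellin (expansion_rem g c N) w =
    (LINT y:{1..}|lborel. ?p y + expansion_rem g c (Suc N) y * complex_of_real y powr w / of_real y)"
    unfolding tail_mellin_def
  proof (rule set_lebesgue_integral_cong)
    show "\<forall>y. y \<in> {1..} \<longrightarrow> expansion_rem g c N y * complex_of_real y powr w / complex_of_real y =
       ?p y + expansion_rem g c (Suc N) y * complex_of_real y powr w / complex_of_real y"
      by (auto simp: expansion_rem_def powr_diff powr_nat' field_simps)
  qed auto
  also have "\<dots> = (LINT y:{1..}|lborel. ?p y) + tail_mellin (expansion_rem g c (Suc N)) w"
    unfolding tail_mellin_def by (rule set_integral_add(2)[OF I expansion_rem_integrable[OF N]])
  also have "(LINT y:{1..}|lborel. ?p y) = c N * (- 1 / (w - of_nat N))"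
    unfolding set_integral_mult_right tail_mellin_const(2)[OF w] ..
  also have "\<dots> = c N / (of_nat N - w)"
    by (metis (no_types) minus_diff_eq minus_divide_divide mult.right_neutral times_divide_eq_right)
  finally show ?thesis .
qed

text \<open>Raising \<open>N\<close> by one only moves a term between sum and integral. A fixed
  \<open>N\<close> then serves the whole half plane Re w < N, and analyticity, poles and bounds are
  read off from that single formula.\<close>

lemma mellin_cont_eq:
  assumes "Re w < real N"
  shows "mellin_cont g c w = (\<Sum>n<N. c n / (of_nat n - w)) + tail_mellin (expansion_rem g c N) w"
proof -
  define N0 where "N0 = nat (\<lfloor>Re w\<rfloor> + 1)"
  have N0: "Re w < real N0" unfolding N0_def by linarith
  have le: "N0 \<le> N" unfolding N0_def using assms by linarith
  have "(\<Sum>n<N. c n / (of_nat n - w)) + tail_mellin (expansion_rem g c N) w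
      = (\<Sum>n<N0. c n / (of_nat n - w)) + tail_mellin (expansion_rem g c N0) w"
    using le
  proof (induction N rule: dec_induct)
    case (step N)
    have "Re w < real N" using N0 step by linarith
    then show ?case using step tail_mellin_rem_Suc[of w N] by (simp add: add.assoc)
  qed simp
  then show ?thesis by (simp add: mellin_cont_def N0_def Let_def)
qed

lemma tail_mellin_rem_holomorphic:
  "tail_mellin (expansion_rem g c N) holomorphic_on {w. Re w < real N}"
proof -
  obtain C where "\<And>y. y \<ge> 1 \<Longrightarrow> norm (expansion_rem g c N y) \<le> C * y powr (- real N)"
    using expansion_rem_bound[of N] by blast
  from tail_mellin_holomorphic[OF expansion_rem_cont this] show ?thesis by simp
qed

lemma tail_mellin_rem_analytic:
  assumes "Re w < real N"
  shows "tail_mellin (expansion_rem g c N) analytic_on {w}"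
proof -
  have "open {w. Re w < real N}" by (intro open_Collect_less continuous_intros)
  then show ?thesis
    using tail_mellin_rem_holomorphic[of N] assms analytic_at by blast
qed

lemma mellin_cont_eventually_eq:
  assumes "Re w0 < real N"
  shows "\<forall>\<^sub>F w in nhds w0. mellin_cont g c w
        = (\<Sum>n<N. c n / (of_nat n - w)) + tail_mellin (expansion_rem g c N) w"
proof -
  have "open {w. Re w < real N}" by (intro open_Collect_less continuous_intros)
  then have "\<forall>\<^sub>F w in nhds w0. w \<in> {w. Re w < real N}"
    using assms by (intro eventually_nhds_in_open) auto
  then show ?thesis by (rule eventually_mono) (auto intro: mellin_cont_eq)
qed

lemma mellin_cont_analytic:
  assumes "\<And>n. w = of_nat n \<Longrightarrow> c n = 0"
  shows "mellin_cont g c analytic_on {w}"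
proof -
  define N where "N = nat (\<lfloor>Re w\<rfloor> + 1)"
  have N: "Re w < real N" unfolding N_def by linarith
  have "(\<lambda>w. (\<Sum>n<N. c n / (of_nat n - w)) + tail_mellin (expansion_rem g c N) w) analytic_on {w}"
  proof (intro analytic_on_add analytic_on_sum tail_mellin_rem_analytic N)
    fix n
    show "(\<lambda>w. c n / (of_nat n - w)) analytic_on {w}"
    proof (cases "w = of_nat n")
      case True then show ?thesis using assms[OF True] by simp
    next
      case False then show ?thesis by (intro analytic_intros) auto
    qed
  qed
  then show ?thesis
    using analytic_at_cong[OF mellin_cont_eventually_eq[OF N] refl] by simp
qed

lemma mellin_cont_meromorphic: "mellin_cont g c meromorphic_on UNIV"
proof -
  have "mellin_cont g c meromorphic_on {w}" for w
  proof -
    define N where "N = nat (\<lfloor>Re w\<rfloor> + 1)"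
    have N: "Re w < real N" unfolding N_def by linarith
    have "(\<lambda>w. (\<Sum>n<N. c n / (of_nat n - w)) + tail_mellin (expansion_rem g c N) w) meromorphic_on {w}"
      by (intro meromorphic_intros analytic_on_imp_meromorphic_on[OF tail_mellin_rem_analytic[OF N]])
    moreover have "\<forall>\<^sub>F z in at w. mellin_cont g c z
        = (\<Sum>n<N. c n / (of_nat n - z)) + tail_mellin (expansion_rem g c N) z"
      using mellin_cont_eventually_eq[OF N] eventually_nhds_conv_at by blast
    ultimately show ?thesis
      by (subst meromorphic_on_cong[where B = "{w}"]) auto
  qed
  then show ?thesis using meromorphic_on_def by blast
qed

text \<open>The numerator takes the value - c n at n, so the singularity is a simple pole or
  removable. With N = n + 1 the term of index n is the only one that is singular near n.\<close>

lemma mellin_cont_simple: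
  "\<exists>h. h analytic_on {of_nat n} \<and> (\<forall>\<^sub>F w in at (of_nat n). mellin_cont g c w = h w / (w - of_nat n))"
proof -
  define N where "N = Suc n"
  have N: "Re (of_nat n) < real N" unfolding N_def by simp
  define h where "h w = - c n + (w - of_nat n) * ((\<Sum>m<n. c m / (of_nat m - w)) + tail_mellin (expansion_rem g c N) w)" for w
  have "h analytic_on {of_nat n}"
    unfolding h_def by (intro analytic_intros tail_mellin_rem_analytic N) auto
  moreover have "\<forall>\<^sub>F w in at (of_nat n). mellin_cont g c w = h w / (w - of_nat n)"
  proof -
    have "\<forall>\<^sub>F w in at (of_nat n). mellin_cont g c w
        = (\<Sum>m<N. c m / (of_nat m - w)) + tail_mellin (expansion_rem g c N) w"
      using mellin_cont_eventually_eq[OF N] eventually_nhds_conv_at by blast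
    moreover have "\<forall>\<^sub>F w in at (of_nat n :: complex). w \<noteq> of_nat n"
      by (rule eventually_neq_at_within)
    ultimately show ?thesis
    proof eventually_elim
      case (elim w)
      have "c n / (of_nat n - w) = - c n / (w - of_nat n)"
        by (metis minus_diff_eq minus_divide_divide add.inverse_inverse)
      then show ?case using elim
        by (simp add: h_def N_def diff_divide_distrib)
    qed
  qed
  ultimately show ?thesis by blast
qed

text \<open>The possible poles are real, hence at distance at least t0 from every point of the
  strip; this bounds the finite sum, and the remainder integral is bounded uniformly in Im
  w.\<close>

lemma mellin_cont_bounded:
  assumes "t0 > 0"
  shows "bounded (mellin_cont g c ` lacunary_strip \<sigma>1 \<sigma>2 t0)"
proof -
  define N where "N = nat (\<lfloor>\<sigma>2\<rfloor> + 1)"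
  have N: "\<sigma>2 < real N" unfolding N_def by linarith
  obtain C where C: "\<And>y. y \<ge> 1 \<Longrightarrow> norm (expansion_rem g c N y) \<le> C * y powr (- real N)"
    using expansion_rem_bound[of N] by blast
  have "norm (mellin_cont g c w) \<le> (\<Sum>n<N. norm (c n) / t0) + (LINT y:{1..}|lborel. C * (y powr (\<sigma>2 + - real N) / y))"
    if w: "w \<in> lacunary_strip \<sigma>1 \<sigma>2 t0" for w
  proof -
    have w': "Re w \<le> \<sigma>2" "\<bar>Im w\<bar> \<ge> t0" using w by (auto simp: lacunary_strip_def)
    have "mellin_cont g c w = (\<Sum>n<N. c n / (of_nat n - w)) + tail_mellin (expansion_rem g c N) w"
      using w' N by (intro mellin_cont_eq) auto
    also have "norm \<dots> \<le> (\<Sum>n<N. norm (c n) / t0) + (LINT y:{1..}|lborel. C * (y powr (\<sigma>2 + - real N) / y))"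
    proof (rule norm_triangle_mono)
      show "norm (\<Sum>n<N. c n / (of_nat n - w)) \<le> (\<Sum>n<N. norm (c n) / t0)"
      proof (rule sum_norm_le)
        fix n
        have "t0 \<le> norm (of_nat n - w)"
          using abs_Im_le_cmod[of "of_nat n - w"] w' by simp
        then show "norm (c n / (of_nat n - w)) \<le> norm (c n) / t0"
          using assms by (simp add: norm_divide frac_le)
      qed
    qed (rule tail_mellin_norm_le[OF C], use w' N in auto)
    finally show ?thesis .
  qed
  then show ?thesis unfolding bounded_iff by blast
qed

text \<open>Once the lower coefficients vanish, c n \<noteq> 0 would force |g y| \<ge> |c n| / (2
  y^n) for large y, and since n \<le> Re w the integrand would dominate a multiple of 1/y.\<close>

lemma expansion_coeff_eq_0:
  assumes I: "set_integrable lborel {1..} (\<lambda>y. g y * complex_of_real y powr w / of_real y)"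
    and n: "real n \<le> Re w"
  shows "c n = 0"
  using n
proof (induction n rule: less_induct)
  case (less n)
  have z: "c m = 0" if "m < n" for m using less that by simp
  show ?case
  proof (rule ccontr)
    assume nz: "c n \<noteq> 0"
    obtain C where C: "\<And>y. y \<ge> 1 \<Longrightarrow> norm (g y - (\<Sum>m<Suc n. c m / of_real y ^ m)) \<le> C / y ^ Suc n"
      using exp unfolding asymptotic_expansion_def by blast
    \<comment> \<open>Beyond this point the error C / y^(n+1) is at most half of the leading term |c
      n| / y^n.\<close>
    define Y where "Y = max 1 (2 * C / norm (c n))"
    have Y1: "Y \<ge> 1" by (simp add: Y_def)
    have lower: "norm (c n) / 2 * (1 / y) \<le> norm (g y * complex_of_real y powr w / of_real y)" if y: "y \<ge> Y" for y
    proof -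
      have y1: "y \<ge> 1" using y Y1 by simp
      have "2 * C / norm (c n) \<le> y" using y by (simp add: Y_def)
      then have Cy: "C / y \<le> norm (c n) / 2"
        using nz y1 by (simp add: field_simps)
      have s: "(\<Sum>m<Suc n. c m / of_real y ^ m) = c n / of_real y ^ n"
        using z by simp
      have "norm (c n / of_real y ^ n) - norm (g y) \<le> norm (g y - c n / of_real y ^ n)"
        by (metis norm_minus_commute norm_triangle_ineq2)
      also have "\<dots> \<le> C / y ^ Suc n" using C[OF y1] s by simp
      finally have "norm (c n) / y ^ n - C / y ^ Suc n \<le> norm (g y)"
        using y1 by (simp add: norm_divide norm_power)
      moreover have "norm (c n) / y ^ n - C / y ^ Suc n = (norm (c n) - C / y) / y ^ n"
        using y1 by (simp add: field_simps)
      moreover have "(norm (c n) - C / y) / y ^ n \<ge> (norm (c n) / 2) / y ^ n"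
        using Cy y1 by (intro divide_right_mono) auto
      ultimately have "norm (c n) / 2 / y ^ n \<le> norm (g y)" by linarith
      moreover have "y ^ n \<le> y powr Re w"
        using less.prems y1 by (subst powr_realpow[symmetric]) (auto intro: powr_mono)
      ultimately have "(norm (c n) / 2 / y ^ n) * y ^ n / y \<le> norm (g y) * y powr Re w / y"
        using y1 by (intro divide_right_mono mult_mono) auto
      then show ?thesis
        using y1 by (simp add: norm_mult norm_divide norm_of_real_powr_complex)
    qed
    have "set_integrable lborel {Y..} (\<lambda>y. norm (c n) / 2 * (1 / y))"
    proof (rule set_integrable_bound)
      show "set_integrable lborel {Y..} (\<lambda>y. g y * complex_of_real y powr w / of_real y)"
        by (rule set_integrable_subset[OF I]) (use Y1 in auto)
      show "set_borel_measurable lborel {Y..} (\<lambda>y. norm (c n) / 2 * (1 / y))"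
        by (intro set_borel_measurable_lborel_continuous continuous_intros) (use Y1 in auto)
    qed (use lower Y1 in \<open>auto intro!: AE_I2\<close>)
    then have "set_integrable lborel {Y..} (\<lambda>y. (2 / norm (c n)) * (norm (c n) / 2 * (1 / y)))"
      by (rule set_integrable_mult_right)
    then have "set_integrable lborel {Y..} (\<lambda>y. 1 / y)"
      using nz by simp
    then show False using not_set_integrable_inverse_tail[of Y] Y1 by simp
  qed
qed

text \<open>Convergence at the single point w already kills all coefficients c n with n \<le> Re w,
  so there is no pole at w and every subtracted term is 0. The continuation thus agrees with the
  integral wherever the latter converges, not merely where a decay estimate guarantees
  convergence.\<close>

lemma mellin_cont_eq_tail_mellin:
  assumes I: "set_integrable lborel {1..} (\<lambda>y. g y * complex_of_real y powr w / of_real y)"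
  shows "mellin_cont g c w = tail_mellin g w" and "mellin_cont g c analytic_on {w}"
proof -
  note z = expansion_coeff_eq_0[OF I]
  show "mellin_cont g c analytic_on {w}"
    by (rule mellin_cont_analytic) (auto intro: z)
  define N where "N = nat (\<lfloor>Re w\<rfloor> + 1)"
  have N: "Re w < real N" unfolding N_def by linarith
  have zN: "c n = 0" if "n < N" for n
    using that unfolding N_def by (intro z) linarith
  show "mellin_cont g c w = tail_mellin g w"
    using mellin_cont_eq[OF N] zN by (simp add: tail_mellin_def expansion_rem_def)
qed

end

section \<open>Linearity of expansions and of the continuation\<close>

lemma asymptotic_expansion_add:
  assumes "asymptotic_expansion g c" "asymptotic_expansion h e"
  shows "asymptotic_expansion (\<lambda>y. g y + h y) (\<lambda>n. c n + e n)"
  unfolding asymptotic_expansion_def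
proof (intro conjI allI)
  show "continuous_on {1..} (\<lambda>y. g y + h y)"
    using assms by (auto simp: asymptotic_expansion_def intro!: continuous_intros)
  fix N
  obtain C E where C: "\<And>y. y \<ge> 1 \<Longrightarrow> norm (g y - (\<Sum>n<N. c n / of_real y ^ n)) \<le> C / y ^ N"
    and E: "\<And>y. y \<ge> 1 \<Longrightarrow> norm (h y - (\<Sum>n<N. e n / of_real y ^ n)) \<le> E / y ^ N"
    using assms unfolding asymptotic_expansion_def by meson
  have "norm (g y + h y - (\<Sum>n<N. (c n + e n) / of_real y ^ n)) \<le> (C + E) / y ^ N" if "y \<ge> 1" for y
    using norm_triangle_mono[OF C[OF that] E[OF that]]
    by (simp add: add_divide_distrib sum.distrib algebra_simps)
  then show "\<exists>C. \<forall>y\<ge>1. norm (g y + h y - (\<Sum>n<N. (c n + e n) / of_real y ^ n)) \<le> C / y ^ N"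
    by blast
qed

lemma asymptotic_expansion_cmult:
  assumes "asymptotic_expansion g c"
  shows "asymptotic_expansion (\<lambda>y. a * g y) (\<lambda>n. a * c n)"
  unfolding asymptotic_expansion_def
proof (intro conjI allI)
  show "continuous_on {1..} (\<lambda>y. a * g y)"
    using assms by (auto simp: asymptotic_expansion_def intro!: continuous_intros)
  fix N
  obtain C where C: "\<And>y. y \<ge> 1 \<Longrightarrow> norm (g y - (\<Sum>n<N. c n / of_real y ^ n)) \<le> C / y ^ N"
    using assms unfolding asymptotic_expansion_def by meson
  have "norm (a * g y - (\<Sum>n<N. (a * c n) / of_real y ^ n)) \<le> (norm a * C) / y ^ N" if "y \<ge> 1" for y
  proof -
    have "a * g y - (\<Sum>n<N. (a * c n) / of_real y ^ n) = a * (g y - (\<Sum>n<N. c n / of_real y ^ n))"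
      by (simp add: right_diff_distrib sum_distrib_left)
    then show ?thesis using mult_left_mono[OF C[OF that], of "norm a"] by (simp add: norm_mult)
  qed
  then show "\<exists>C. \<forall>y\<ge>1. norm (a * g y - (\<Sum>n<N. (a * c n) / of_real y ^ n)) \<le> C / y ^ N"
    by blast
qed

lemma asymptotic_expansion_zero: "asymptotic_expansion (\<lambda>y. 0) (\<lambda>n. 0)"
  unfolding asymptotic_expansion_def by (auto intro!: exI[of _ 0])

lemma mellin_cont_add:
  assumes g: "asymptotic_expansion g c" and h: "asymptotic_expansion h e"
  shows "mellin_cont (\<lambda>y. g y + h y) (\<lambda>n. c n + e n) w = mellin_cont g c w + mellin_cont h e w"
proof -
  define N where "N = nat (\<lfloor>Re w\<rfloor> + 1)"
  have N: "Re w < real N" unfolding N_def by linarith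
  have e: "expansion_rem (\<lambda>y. g y + h y) (\<lambda>n. c n + e n) N y = expansion_rem g c N y + expansion_rem h e N y" for y
    by (simp add: expansion_rem_def add_divide_distrib sum.distrib)
  have "tail_mellin (expansion_rem (\<lambda>y. g y + h y) (\<lambda>n. c n + e n) N) w
     = tail_mellin (expansion_rem g c N) w + tail_mellin (expansion_rem h e N) w"
    unfolding tail_mellin_def e using set_integral_add(2)[OF expansion_rem_integrable[OF g N] expansion_rem_integrable[OF h N]]
    by (simp add: distrib_right add_divide_distrib)
  then show ?thesis
    unfolding mellin_cont_eq[OF g N] mellin_cont_eq[OF h N] mellin_cont_eq[OF asymptotic_expansion_add[OF g h] N]
    by (simp add: add_divide_distrib sum.distrib)
qed

section \<open>Beta integrals\<close>

text \<open>The bridge from Lebesgue integrals to absolute gauge integrability, in terms of which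
  the change of variables is stated.\<close>

lemma set_integrable_lborel_iff_absolutely:
  fixes f :: "real \<Rightarrow> complex"
  assumes "A \<in> sets borel" "continuous_on A f"
  shows "set_integrable lborel A f \<longleftrightarrow> f absolutely_integrable_on A"
  using set_borel_measurable_lborel_continuous[OF assms]
  by (simp add: set_integrable_def set_borel_measurable_def integrable_completion)

lemma lborel_change_of_variables:
  fixes f :: "real \<Rightarrow> complex"
  assumes A: "A \<in> sets borel" "g ` A \<in> sets borel"
    and der: "\<And>x. x \<in> A \<Longrightarrow> (g has_field_derivative h x) (at x within A)" and inj: "inj_on g A"
    and cont: "continuous_on (g ` A) f" "continuous_on A (\<lambda>x. \<bar>h x\<bar> *\<^sub>R f (g x))"
  shows "set_integrable lborel A (\<lambda>x. \<bar>h x\<bar> *\<^sub>R f (g x)) \<longleftrightarrow> set_integrable lborel (g ` A) f"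
    and "(LINT x:A|lborel. \<bar>h x\<bar> *\<^sub>R f (g x)) = (LINT x:g ` A|lborel. f x)"
proof -
  have Al: "A \<in> sets lebesgue" using A by simp
  note cv = has_absolute_integral_change_of_variables_real[OF Al der inj, of f]
  show iff: "set_integrable lborel A (\<lambda>x. \<bar>h x\<bar> *\<^sub>R f (g x)) \<longleftrightarrow> set_integrable lborel (g ` A) f"
    using set_integrable_lborel_iff_absolutely[OF A(2) cont(1)] set_integrable_lborel_iff_absolutely[OF A(1) cont(2)] cv
    by blast
  show "(LINT x:A|lborel. \<bar>h x\<bar> *\<^sub>R f (g x)) = (LINT x:g ` A|lborel. f x)"
  proof (cases "set_integrable lborel (g ` A) f")
    case True
    then have T2: "set_integrable lborel A (\<lambda>x. \<bar>h x\<bar> *\<^sub>R f (g x))" using iff by simp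
    have "f absolutely_integrable_on g ` A"
      using True set_integrable_lborel_iff_absolutely[OF A(2) cont(1)] by simp
    then have "integral A (\<lambda>x. \<bar>h x\<bar> *\<^sub>R f (g x)) = integral (g ` A) f" using cv by blast
    then show ?thesis
      using set_borel_integral_eq_integral(2)[OF True] set_borel_integral_eq_integral(2)[OF T2] by simp
  next
    \<comment> \<open>Both integrals have the default value 0 here.\<close>
    case False
    then have "\<not> set_integrable lborel A (\<lambda>x. \<bar>h x\<bar> *\<^sub>R f (g x))" using iff by simp
    with False show ?thesis
      by (simp add: set_integrable_def set_lebesgue_integral_def not_integrable_integral_eq)
  qed
qed

text \<open>Folds the piece (0, 1] of a Mellin integral onto the half line on which expansions at
  infinity apply.\<close>

lemma lborel_inversion:
  fixes f :: "real \<Rightarrow> complex"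
  assumes cont: "continuous_on {0<..1} f"
  shows "set_integrable lborel {1..} (\<lambda>y. f (1 / y) / of_real y ^ 2) \<longleftrightarrow> set_integrable lborel {0<..1} f"
    and "(LINT y:{1..}|lborel. f (1 / y) / of_real y ^ 2) = (LINT y:{0<..1}|lborel. f y)"
proof -
  have im: "(\<lambda>y::real. 1 / y) ` {1..} = {0<..1}"
  proof (intro set_eqI iffI)
    fix x :: real assume x: "x \<in> {0<..1}"
    then have "x = 1 / (1 / x)" "1 / x \<in> {1..}" by auto
    then show "x \<in> (\<lambda>y. 1 / y) ` {1..}" by blast
  qed auto
  have inj: "inj_on (\<lambda>y::real. 1 / y) {1..}" by (auto simp: inj_on_def)
  have d: "((\<lambda>y. 1 / y) has_field_derivative - (1 / y\<^sup>2)) (at y within {1..})" if "y \<in> {1..}" for y :: real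
    using that by (auto intro!: derivative_eq_intros simp: power2_eq_square)
  have e: "\<bar>- (1 / y\<^sup>2)\<bar> *\<^sub>R f (1 / y) = f (1 / y) / of_real y ^ 2" if "y \<in> {1..}" for y
    using that by (simp add: scaleR_conv_of_real divide_simps)
  have "continuous_on {1..} (\<lambda>y::real. 1 / y)" by (intro continuous_intros) auto
  then have "continuous_on {1..} (\<lambda>y. f (1 / y))"
    using continuous_on_compose2[OF cont, of "{1..}" "\<lambda>y. 1 / y"] im by auto
  then have c2: "continuous_on {1..} (\<lambda>y. \<bar>- (1 / y\<^sup>2)\<bar> *\<^sub>R f (1 / y))"
    by (intro continuous_intros) auto
  note cv = lborel_change_of_variables[of "{1..}" "\<lambda>y::real. 1 / y", unfolded im, OF _ _ d inj cont c2]
  show "set_integrable lborel {1..} (\<lambda>y. f (1 / y) / of_real y ^ 2) \<longleftrightarrow> set_integrable lborel {0<..1} f"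
    using cv(1) by (subst set_integrable_cong[OF refl refl e[symmetric]]) auto
  show "(LINT y:{1..}|lborel. f (1 / y) / of_real y ^ 2) = (LINT y:{0<..1}|lborel. f y)"
    using cv(2) set_lebesgue_integral_cong[of "{1..}" lborel "\<lambda>y. \<bar>- (1 / y\<^sup>2)\<bar> *\<^sub>R f (1 / y)" "\<lambda>y. f (1 / y) / of_real y ^ 2"] e by simp
qed

text \<open>The substitution t = y / (1 + y) turns this into Euler's Beta integral over (0, 1). It
  is done for real exponents; the identity theorem takes the formula to complex s.\<close>

lemma beta_prime_real:
  assumes "0 < \<sigma>" "\<sigma> < real j"
  shows "set_integrable lborel {0<..} (\<lambda>y. complex_of_real y powr of_real \<sigma> / of_real y / (of_real y + 1) ^ j)"
    and "(LINT y:{0<..}|lborel. complex_of_real y powr of_real \<sigma> / of_real y / (of_real y + 1) ^ j)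
      = Beta (of_real \<sigma>) (of_nat j - of_real \<sigma>)"
proof -
  define f where "f t = complex_of_real (t powr (\<sigma> - 1) * (1 - t) powr (real j - \<sigma> - 1))" for t
  define g where "g y = y / (1 + y)" for y :: real
  have im: "g ` {0<..} = {0<..<1}"
  proof (intro set_eqI iffI)
    fix x assume x: "x \<in> {0<..<1::real}"
    then have "x = g (x / (1 - x))" "x / (1 - x) \<in> {0<..}" by (auto simp: g_def field_simps)
    then show "x \<in> g ` {0<..}" by blast
  qed (auto simp: g_def)
  have inj: "inj_on g {0<..}" by (auto simp: inj_on_def g_def divide_simps algebra_simps)
  have d: "(g has_field_derivative 1 / (1 + y)\<^sup>2) (at y within {0<..})" if "y \<in> {0<..}" for y
    unfolding g_def using that by (auto intro!: derivative_eq_intros simp: field_simps power2_eq_square)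
  have contf: "continuous_on (g ` {0<..}) f" unfolding im f_def
    by (intro continuous_intros) auto
  have contg: "continuous_on {0<..} g" unfolding g_def by (intro continuous_intros) auto
  have c2: "continuous_on {0<..} (\<lambda>y. \<bar>1 / (1 + y)\<^sup>2\<bar> *\<^sub>R f (g y))"
    by (intro continuous_intros continuous_on_compose2[OF contf contg]) auto
  have e: "\<bar>1 / (1 + y)\<^sup>2\<bar> *\<^sub>R f (g y) = complex_of_real y powr of_real \<sigma> / of_real y / (of_real y + 1) ^ j"
    if y: "y \<in> {0<..}" for y
  proof -
    have ne: "1 + complex_of_real y \<noteq> 0"
      using y by (metis add_pos_pos greaterThan_iff less_numeral_extra(1) of_real_1 of_real_add of_real_eq_0_iff order_less_irrefl)
    have 1: "1 - g y = 1 / (1 + y)" using y by (simp add: g_def field_simps)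
    have "g y powr (\<sigma> - 1) * (1 - g y) powr (real j - \<sigma> - 1) = y powr (\<sigma> - 1) / ((1 + y) powr (\<sigma> - 1) * (1 + y) powr (real j - \<sigma> - 1))"
      unfolding 1 using y by (simp add: g_def powr_divide)
    also have "(1 + y) powr (\<sigma> - 1) * (1 + y) powr (real j - \<sigma> - 1) = (1 + y) powr (real j - 2)"
      by (simp add: powr_add[symmetric])
    also have "\<dots> = (1 + y) ^ j / (1 + y)\<^sup>2" using y by (simp add: powr_diff powr_realpow)
    finally have "f (g y) = of_real (y powr \<sigma> / y / ((1 + y) ^ j / (1 + y)\<^sup>2))"
      using y by (simp add: f_def powr_diff)
    then have "\<bar>1 / (1 + y)\<^sup>2\<bar> *\<^sub>R f (g y) = of_real (y powr \<sigma> / y / (1 + y) ^ j)"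
      using y ne by (simp add: scaleR_conv_of_real)
    then show ?thesis using y by (simp add: powr_of_real add.commute)
  qed
  note cv = lborel_change_of_variables[of "{0<..}" g, OF _ _ d inj contf c2, unfolded im]
  have fI: "((\<lambda>t. t powr (\<sigma> - 1) * (1 - t) powr (real j - \<sigma> - 1)) has_integral Beta \<sigma> (real j - \<sigma>)) {0..1}"
    using has_integral_Beta_real[of \<sigma> "real j - \<sigma>"] assms by simp
  have I1: "set_integrable lborel {0<..<1} (\<lambda>t. t powr (\<sigma> - 1) * (1 - t) powr (real j - \<sigma> - 1))"
    by (rule set_integrable_subset[OF integrable_Beta[of \<sigma> "real j - \<sigma>"]]) (use assms in auto)
  then have If: "set_integrable lborel {0<..<1} f"
    unfolding f_def by (simp add: set_integrable_def scaleR_conv_of_real) (metis (no_types, lifting) Bochner_Integration.integrable_cong integrable_of_real of_real_mult)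
  have "(LINT t:{0<..<1}|lborel. f t) = of_real (LINT t:{0<..<1}|lborel. t powr (\<sigma> - 1) * (1 - t) powr (real j - \<sigma> - 1))"
    unfolding f_def by (rule set_integral_complex_of_real)
  also have "(LINT t:{0<..<1}|lborel. t powr (\<sigma> - 1) * (1 - t) powr (real j - \<sigma> - 1)) = Beta \<sigma> (real j - \<sigma>)"
    using set_borel_integral_eq_integral(2)[OF I1] fI
    by (metis (no_types, lifting) has_integral_Icc_iff_Ioo integral_unique)
  finally have val: "(LINT t:{0<..<1}|lborel. f t) = Beta (of_real \<sigma>) (of_nat j - of_real \<sigma>)"
    by (simp add: Beta_complex_of_real[symmetric])
  show "set_integrable lborel {0<..} (\<lambda>y. complex_of_real y powr of_real \<sigma> / of_real y / (of_real y + 1) ^ j)"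
    using cv(1) If by (subst set_integrable_cong[OF refl refl e[symmetric]]) auto
  show "(LINT y:{0<..}|lborel. complex_of_real y powr of_real \<sigma> / of_real y / (of_real y + 1) ^ j)
      = Beta (of_real \<sigma>) (of_nat j - of_real \<sigma>)"
    using cv(2) val set_lebesgue_integral_cong[of "{0<..}" lborel "\<lambda>y. \<bar>1 / (1 + y)\<^sup>2\<bar> *\<^sub>R f (g y)" "\<lambda>y. complex_of_real y powr of_real \<sigma> / of_real y / (of_real y + 1) ^ j"] e by simp
qed

lemma beta_prime_dominant:
  assumes "0 < \<sigma>" "\<sigma> < real j"
  shows "set_integrable lborel {0<..} (\<lambda>y. y powr \<sigma> / y / (1 + y) ^ j)"
proof -
  have "set_integrable lborel {0<..} (\<lambda>y. norm (complex_of_real y powr of_real \<sigma> / of_real y / (of_real y + 1) ^ j))"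
    using beta_prime_real(1)[OF assms] by (rule set_integrable_norm)
  then show ?thesis
  proof (rule set_integrable_cong[THEN iffD1, rotated -1])
    show "norm (complex_of_real y powr of_real \<sigma> / of_real y / (of_real y + 1) ^ j) = y powr \<sigma> / y / (1 + y) ^ j"
      if "y \<in> {0<..}" for y
    proof -
      have "norm (complex_of_real y + 1) = 1 + y" using that
        by (metis add.commute greaterThan_iff norm_of_real of_real_1 of_real_add abs_of_pos add_pos_pos zero_less_one)
      then show ?thesis using that by (simp add: norm_divide norm_mult norm_power norm_of_real_powr_complex add.commute)
    qed
  qed auto
qed

text \<open>Two regimes are glued. A ball of radius e about \<open>a\<^sub>0\<close> misses the cut,
  so |y + a| \<ge> e/2 for a near \<open>a\<^sub>0\<close>; for large y the bound |y + a| \<ge> y -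
  R grows linearly. Uniformity in a is what dominated convergence in that parameter
  requires.\<close>

lemma slit_plane_lower_bound:
  fixes a\<^sub>0 :: complex
  assumes "a\<^sub>0 \<notin> \<real>\<^sub>\<le>\<^sub>0"
  obtains r \<delta> where "r > 0" "\<delta> > 0" "\<And>a y. a \<in> ball a\<^sub>0 r \<Longrightarrow> y \<ge> 0 \<Longrightarrow> \<delta> * (1 + y) \<le> norm (of_real y + a)"
proof -
  have op: "open (- (\<real>\<^sub>\<le>\<^sub>0 :: complex set))" by (simp add: open_Compl)
  obtain e where e: "e > 0" "ball a\<^sub>0 e \<subseteq> - \<real>\<^sub>\<le>\<^sub>0"
    by (rule openE[OF op, of a\<^sub>0]) (use assms in auto)
  have e_le: "e \<le> norm (of_real y + a\<^sub>0)" if "y \<ge> 0" for y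
  proof (rule ccontr)
    assume "\<not> e \<le> norm (of_real y + a\<^sub>0)"
    then have "- complex_of_real y \<in> ball a\<^sub>0 e" by (simp add: dist_norm add.commute)
    then have "- complex_of_real y \<notin> \<real>\<^sub>\<le>\<^sub>0" using e by blast
    then show False using that by (simp add: complex_nonpos_Reals_iff)
  qed
  define R where "R = norm a\<^sub>0 + e / 2"
  have R: "R > 0" using e by (simp add: R_def add_nonneg_pos)
  \<comment> \<open>The second entry makes \<delta>(1 + y) \<le> e/2 up to y = 2R + 1, the first
    makes \<delta>(1 + y) \<le> y - R from there on.\<close>
  define \<delta> where "\<delta> = min (1 / 2) (e / (4 * R + 4))"
  have \<delta>: "\<delta> > 0" using e R by (simp add: \<delta>_def)
  have "\<delta> * (1 + y) \<le> norm (of_real y + a)" if a: "a \<in> ball a\<^sub>0 (e / 2)" and y: "y \<ge> 0" for a y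
  proof -
    have da: "norm (a - a\<^sub>0) < e / 2" using a by (simp add: dist_norm norm_minus_commute)
    have "norm (of_real y + a\<^sub>0) \<le> norm (of_real y + a) + norm (a - a\<^sub>0)"
      using norm_triangle_ineq4[of "of_real y + a" "a - a\<^sub>0"] by simp
    then have 1: "e / 2 \<le> norm (of_real y + a)" using e_le[OF y] da by linarith
    have "norm a \<le> R" using norm_triangle_ineq[of a\<^sub>0 "a - a\<^sub>0"] da by (simp add: R_def)
    then have 2: "y - R \<le> norm (of_real y + a)"
      using norm_diff_ineq[of "of_real y" a] y by simp
    show ?thesis
    proof (cases "y \<le> 2 * R + 1")
      case True
      have "\<delta> * (1 + y) \<le> e / (4 * R + 4) * (2 * R + 2)"
        using True y \<delta> R e by (intro mult_mono) (auto simp: \<delta>_def)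
      also have "\<dots> = e / 2" using R by (simp add: field_simps)
      finally show ?thesis using 1 by linarith
    next
      case False
      have "\<delta> \<le> 1 / 2" unfolding \<delta>_def by (rule min.cobounded1)
      then have "\<delta> * (1 + y) \<le> 1 / 2 * (1 + y)" using y by (intro mult_right_mono) auto
      also have "\<dots> \<le> y - R" using False by (simp add: field_simps)
      finally show ?thesis using 2 by (rule order_trans)
    qed
  qed
  then show ?thesis using that[of "e / 2" \<delta>] e \<delta> by simp
qed

lemma beta_kernel_bound:
  assumes "\<delta> > 0" "\<delta> * (1 + y) \<le> norm (of_real y + a)" "y > 0"
  shows "norm (complex_of_real y powr s / of_real y / (of_real y + a) ^ j) \<le> (1 / \<delta>) ^ j * (y powr Re s / y / (1 + y) ^ j)"
proof -
  have "(\<delta> * (1 + y)) ^ j \<le> norm (of_real y + a) ^ j" using assms by (intro power_mono) auto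
  moreover have "(\<delta> * (1 + y)) ^ j > 0" using assms by (intro zero_less_power mult_pos_pos) auto
  moreover have pos: "norm (of_real y + a) ^ j > 0"
    by (intro zero_less_power less_le_trans[OF _ assms(2)] mult_pos_pos) (use assms in auto)
  ultimately have "y powr Re s / y / norm (of_real y + a) ^ j \<le> y powr Re s / y / (\<delta> * (1 + y)) ^ j"
    using assms pos by (intro divide_left_mono mult_pos_pos) auto
  moreover have "norm (complex_of_real y powr s / of_real y / (of_real y + a) ^ j) = y powr Re s / y / norm (of_real y + a) ^ j"
    using assms by (simp add: norm_divide norm_mult norm_power norm_of_real_powr_complex)
  moreover have "y powr Re s / y / (\<delta> * (1 + y)) ^ j = (1 / \<delta>) ^ j * (y powr Re s / y / (1 + y) ^ j)"
    by (simp add: power_mult_distrib power_one_over)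
  ultimately show ?thesis by simp
qed

lemma beta_kernel_cont:
  assumes "a \<notin> \<real>\<^sub>\<le>\<^sub>0"
  shows "continuous_on {0<..} (\<lambda>y. complex_of_real y powr s / of_real y / (of_real y + a) ^ j)"
proof -
  have "complex_of_real y + a \<noteq> 0" if "y > 0" for y
  proof
    assume "complex_of_real y + a = 0"
    then have "a = complex_of_real (- y)" by (simp add: eq_neg_iff_add_eq_0 add.commute)
    then show False using assms that by (simp add: complex_nonpos_Reals_iff)
  qed
  then show ?thesis by (intro continuous_intros) auto
qed

lemma beta_kernel_integrable:
  assumes "a \<notin> \<real>\<^sub>\<le>\<^sub>0" "0 < Re s" "Re s < real j"
  shows "set_integrable lborel {0<..} (\<lambda>y. complex_of_real y powr s / of_real y / (of_real y + a) ^ j)"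
proof -
  obtain r \<delta> where r: "r > 0" "\<delta> > 0" "\<And>b y. b \<in> ball a r \<Longrightarrow> y \<ge> 0 \<Longrightarrow> \<delta> * (1 + y) \<le> norm (of_real y + b)"
    using slit_plane_lower_bound[OF assms(1)] by blast
  show ?thesis
  proof (rule set_integrable_bound)
    show "set_integrable lborel {0<..} (\<lambda>y. (1 / \<delta>) ^ j * (y powr Re s / y / (1 + y) ^ j))"
      by (rule set_integrable_mult_right, rule beta_prime_dominant) (use assms in auto)
    show "set_borel_measurable lborel {0<..} (\<lambda>y. complex_of_real y powr s / of_real y / (of_real y + a) ^ j)"
      by (intro set_borel_measurable_lborel_continuous beta_kernel_cont assms) auto
    show "AE y in lborel. y \<in> {0<..} \<longrightarrow> norm (complex_of_real y powr s / of_real y / (of_real y + a) ^ j)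
       \<le> norm ((1 / \<delta>) ^ j * (y powr Re s / y / (1 + y) ^ j))"
    proof (intro AE_I2 impI)
      fix y :: real assume y: "y \<in> {0<..}"
      have "norm (complex_of_real y powr s / of_real y / (of_real y + a) ^ j) \<le> (1 / \<delta>) ^ j * (y powr Re s / y / (1 + y) ^ j)"
        using y r by (intro beta_kernel_bound) auto
      then show "norm (complex_of_real y powr s / of_real y / (of_real y + a) ^ j)
       \<le> norm ((1 / \<delta>) ^ j * (y powr Re s / y / (1 + y) ^ j))"
        by (rule order_trans) (simp only: real_norm_def abs_ge_self)
    qed
  qed
qed

section \<open>The Beta kernel with a complex shift\<close>

definition beta_int :: "nat \<Rightarrow> complex \<Rightarrow> complex \<Rightarrow> complex" where
  "beta_int j s a = (LINT y:{0<..}|lborel. complex_of_real y powr s / of_real y / (of_real y + a) ^ j)"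

lemma beta_int_holomorphic_a:
  assumes "0 < Re s" "Re s < real j"
  shows "beta_int j s holomorphic_on - \<real>\<^sub>\<le>\<^sub>0"
  unfolding beta_int_def[abs_def] set_lebesgue_integral_def
proof (rule holomorphic_on_lebesgue_integral)
  show "open (- (\<real>\<^sub>\<le>\<^sub>0 :: complex set))" by (simp add: open_Compl)
  show "(\<lambda>a. indicat_real {0<..} y *\<^sub>R (complex_of_real y powr s / of_real y / (of_real y + a) ^ j)) holomorphic_on - \<real>\<^sub>\<le>\<^sub>0" for y
  proof (cases "y > 0")
    case True
    have "complex_of_real y + a \<noteq> 0" if "a \<notin> \<real>\<^sub>\<le>\<^sub>0" for a
    proof
      assume "complex_of_real y + a = 0"
      then have "a = complex_of_real (- y)" by (simp add: eq_neg_iff_add_eq_0 add.commute)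
      then show False using True that by (simp add: complex_nonpos_Reals_iff)
    qed
    then show ?thesis using True by (auto intro!: holomorphic_intros simp: scaleR_conv_of_real)
  qed auto
  show "(\<lambda>y. indicat_real {0<..} y *\<^sub>R (complex_of_real y powr s / of_real y / (of_real y + a) ^ j)) \<in> borel_measurable lborel"
    if "a \<in> - \<real>\<^sub>\<le>\<^sub>0" for a
    unfolding set_borel_measurable_def[symmetric]
    using that by (intro set_borel_measurable_lborel_continuous beta_kernel_cont) auto
  fix a\<^sub>0 :: complex assume "a\<^sub>0 \<in> - \<real>\<^sub>\<le>\<^sub>0"
  then obtain r \<delta> where r: "r > 0" "\<delta> > 0" "\<And>b y. b \<in> ball a\<^sub>0 r \<Longrightarrow> y \<ge> 0 \<Longrightarrow> \<delta> * (1 + y) \<le> norm (of_real y + b)"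
    using slit_plane_lower_bound[of a\<^sub>0] by auto
  define g where "g y = indicat_real {0<..} y *\<^sub>R ((1 / \<delta>) ^ j * (y powr Re s / y / (1 + y) ^ j))" for y
  have "set_integrable lborel {0<..} (\<lambda>y. (1 / \<delta>) ^ j * (y powr Re s / y / (1 + y) ^ j))"
    by (rule set_integrable_mult_right, rule beta_prime_dominant) (use assms in auto)
  then have "integrable lborel g" by (simp add: set_integrable_def g_def[abs_def])
  moreover have "norm (indicat_real {0<..} y *\<^sub>R (complex_of_real y powr s / of_real y / (of_real y + a) ^ j)) \<le> g y"
    if "a \<in> ball a\<^sub>0 r" for a y
  proof (cases "y > 0")
    case True
    then show ?thesis using beta_kernel_bound[OF r(2) r(3)[OF that] True] by (simp add: g_def)
  qed (auto simp: g_def)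
  ultimately show "\<exists>r>0. \<exists>g. integrable lborel g \<and> (\<forall>a\<in>ball a\<^sub>0 r \<inter> - \<real>\<^sub>\<le>\<^sub>0. \<forall>y\<in>space lborel.
      norm (indicat_real {0<..} y *\<^sub>R (complex_of_real y powr s / of_real y / (of_real y + a) ^ j)) \<le> g y)"
    using r(1) by blast
qed

lemma beta_int_holomorphic_s:
  "(\<lambda>s. beta_int j s 1) holomorphic_on {s. 0 < Re s \<and> Re s < real j}"
  unfolding beta_int_def[abs_def] set_lebesgue_integral_def
proof (rule holomorphic_on_lebesgue_integral)
  have one: "(1::complex) \<notin> \<real>\<^sub>\<le>\<^sub>0" by (simp add: complex_nonpos_Reals_iff)
  show "open {s. 0 < Re s \<and> Re s < real j}"
    by (intro open_Collect_conj open_Collect_less continuous_intros)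
  show "(\<lambda>s. indicat_real {0<..} y *\<^sub>R (complex_of_real y powr s / of_real y / (of_real y + 1) ^ j)) holomorphic_on {s. 0 < Re s \<and> Re s < real j}" for y
  proof (cases "y > 0")
    case True
    then have "complex_of_real y + 1 \<noteq> 0" by (metis add_pos_pos less_numeral_extra(1) of_real_1 of_real_add of_real_eq_0_iff order_less_irrefl)
    then show ?thesis using True by (auto intro!: holomorphic_intros simp: scaleR_conv_of_real)
  qed auto
  show "(\<lambda>y. indicat_real {0<..} y *\<^sub>R (complex_of_real y powr s / of_real y / (of_real y + 1) ^ j)) \<in> borel_measurable lborel" for s
    unfolding set_borel_measurable_def[symmetric]
    using one by (intro set_borel_measurable_lborel_continuous beta_kernel_cont) auto
  fix s\<^sub>0 assume s0: "s\<^sub>0 \<in> {s. 0 < Re s \<and> Re s < real j}"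
  define r where "r = min (Re s\<^sub>0) (real j - Re s\<^sub>0) / 2"
  have r: "r > 0" "0 < Re s\<^sub>0 - r" "Re s\<^sub>0 + r < real j"
  proof -
    have "r \<le> Re s\<^sub>0 / 2" "r \<le> (real j - Re s\<^sub>0) / 2" by (auto simp: r_def)
    then show "0 < Re s\<^sub>0 - r" "Re s\<^sub>0 + r < real j" using s0 by auto
    show "r > 0" using s0 by (auto simp: r_def)
  qed
  have lb: "1 * (1 + y) \<le> norm (complex_of_real y + 1)" if "y \<ge> 0" for y
    using complex_Re_le_cmod[of "complex_of_real y + 1"] by simp
  \<comment> \<open>The smaller exponent dominates for y < 1, the larger for y \<ge> 1; the sum
    serves both.\<close>
  define g where "g y = indicat_real {0<..} y *\<^sub>R (y powr (Re s\<^sub>0 - r) / y / (1 + y) ^ j + y powr (Re s\<^sub>0 + r) / y / (1 + y) ^ j)" for y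
  have "set_integrable lborel {0<..} (\<lambda>y. y powr (Re s\<^sub>0 - r) / y / (1 + y) ^ j + y powr (Re s\<^sub>0 + r) / y / (1 + y) ^ j)"
    by (rule set_integral_add(1); rule beta_prime_dominant) (use r in auto)
  then have "integrable lborel g" by (simp add: set_integrable_def g_def[abs_def])
  moreover have "norm (indicat_real {0<..} y *\<^sub>R (complex_of_real y powr s / of_real y / (of_real y + 1) ^ j)) \<le> g y"
    if s: "s \<in> ball s\<^sub>0 r" for s y
  proof (cases "y > 0")
    case True
    have "\<bar>Re (s - s\<^sub>0)\<bar> \<le> norm (s - s\<^sub>0)" by (rule abs_Re_le_cmod)
    also have "\<dots> < r" using s by (auto simp: dist_norm norm_minus_commute)
    finally have rs: "Re s \<le> Re s\<^sub>0 + r" "Re s\<^sub>0 - r \<le> Re s" by auto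
    have "y powr Re s \<le> y powr (Re s\<^sub>0 - r) + y powr (Re s\<^sub>0 + r)"
    proof (cases "y \<ge> 1")
      case True
      then have "y powr Re s \<le> y powr (Re s\<^sub>0 + r)" using rs by (intro powr_mono) auto
      then show ?thesis by (simp add: add_increasing)
    next
      case False
      then have "y powr Re s \<le> y powr (Re s\<^sub>0 - r)" using rs \<open>y > 0\<close> by (intro powr_mono') auto
      then show ?thesis by (simp add: add_increasing2)
    qed
    then have "y powr Re s / y / (1 + y) ^ j \<le> (y powr (Re s\<^sub>0 - r) + y powr (Re s\<^sub>0 + r)) / y / (1 + y) ^ j"
      using True by (intro divide_right_mono) auto
    then show ?thesis using beta_kernel_bound[OF _ lb, of y s j] True by (simp add: g_def add_divide_distrib)
  qed (auto simp: g_def)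
  ultimately show "\<exists>r>0. \<exists>g. integrable lborel g \<and> (\<forall>s\<in>ball s\<^sub>0 r \<inter> {s. 0 < Re s \<and> Re s < real j}. \<forall>y\<in>space lborel.
      norm (indicat_real {0<..} y *\<^sub>R (complex_of_real y powr s / of_real y / (of_real y + 1) ^ j)) \<le> g y)"
    using r(1) by blast
qed

lemma islimpt_of_real_image:
  "x islimpt A \<Longrightarrow> complex_of_real x islimpt complex_of_real ` A"
  unfolding islimpt_approachable by (auto simp: dist_of_real)

text \<open>Both sides are holomorphic in the strip 0 < Re s < j and agree on its real
  segment.\<close>

lemma beta_int_one:
  assumes "0 < Re s" "Re s < real j"
  shows "beta_int j s 1 = Beta s (of_nat j - s)"
proof -
  define S where "S = {s. 0 < Re s \<and> Re s < real j}"
  have S: "open S" "connected S"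
  proof -
    show "open S" unfolding S_def by (intro open_Collect_conj open_Collect_less continuous_intros)
    have "S = {s. 0 < Re s} \<inter> {s. Re s < real j}" by (auto simp: S_def)
    then show "connected S" by (auto intro!: convex_connected convex_Int convex_halfspace_Re_gt convex_halfspace_Re_lt)
  qed
  define U where "U = complex_of_real ` {0<..<real j}"
  define \<xi> where "\<xi> = complex_of_real (real j / 2)"
  have j: "real j > 0" using assms by linarith
  have "real j / 2 islimpt {0<..<real j}"
    by (rule interior_limit_point) (use j in \<open>auto simp: interior_open\<close>)
  then have lim: "\<xi> islimpt U"
    unfolding \<xi>_def U_def by (rule islimpt_of_real_image)
  have hB: "(\<lambda>s. Beta s (of_nat j - s)) holomorphic_on S"
    by (intro holomorphic_intros) (auto simp: S_def elim!: nonpos_Ints_cases dest: arg_cong[of _ _ Re])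
  have "(\<lambda>s. beta_int j s 1 - Beta s (of_nat j - s)) s = 0"
  proof (rule analytic_continuation[where S = S and U = U and \<xi> = \<xi> and f = "\<lambda>s. beta_int j s 1 - Beta s (of_nat j - s)"])
    show "(\<lambda>s. beta_int j s 1 - Beta s (of_nat j - s)) holomorphic_on S"
      using beta_int_holomorphic_s[of j] hB unfolding S_def by (intro holomorphic_on_diff)
    show "beta_int j z 1 - Beta z (of_nat j - z) = 0" if "z \<in> U" for z
      using that beta_prime_real(2)[of _ j] by (auto simp: U_def beta_int_def)
  qed (use S lim j assms in \<open>auto simp: U_def \<xi>_def S_def\<close>)
  then show ?thesis by simp
qed

lemma beta_int_pos:
  assumes "c > 0"
  shows "beta_int j s (of_real c) = of_real c powr (s - of_nat j) * beta_int j s 1"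
proof -
  define h where "h y = indicat_real {0<..} y *\<^sub>R (complex_of_real y powr s / of_real y / (of_real y + of_real c) ^ j)" for y
  define h1 where "h1 y = indicat_real {0<..} y *\<^sub>R (complex_of_real y powr s / of_real y / (of_real y + 1) ^ j)" for y
  have e: "c *\<^sub>R h (0 + c * y) = of_real c powr (s - of_nat j) * h1 y" for y
  proof (cases "y > 0")
    case True
    have "complex_of_real (c * y) powr s = of_real c powr s * of_real y powr s"
      using assms True by (simp add: powr_times_real)
    moreover have "complex_of_real (c * y) + of_real c = of_real c * (of_real y + 1)"
      by (simp add: algebra_simps)
    ultimately have "c *\<^sub>R h (0 + c * y) = of_real c * (of_real c powr s * of_real y powr s / (of_real c * of_real y) / (of_real c * (of_real y + 1)) ^ j)"
      using assms True by (simp add: h_def scaleR_conv_of_real)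
    also have "\<dots> = (of_real c powr s / of_real c ^ j) * (of_real y powr s / of_real y / (of_real y + 1) ^ j)"
      using assms by (simp add: power_mult_distrib)
    also have "of_real c powr s / of_real c ^ j = complex_of_real c powr (s - of_nat j)"
      using assms by (simp add: powr_diff powr_nat')
    finally show ?thesis using True by (simp add: h1_def)
  next
    case False
    then have "\<not> c * y > 0" using assms by (simp add: zero_less_mult_iff)
    then show ?thesis using False by (simp add: h_def h1_def)
  qed
  have "beta_int j s (of_real c) = (\<integral>y. h y \<partial>lborel)"
    by (simp add: beta_int_def h_def[abs_def] set_lebesgue_integral_def)
  also have "\<dots> = \<bar>c\<bar> *\<^sub>R (\<integral>y. h (0 + c * y) \<partial>lborel)"
    using assms by (intro lborel_integral_real_affine) auto
  also have "\<dots> = (\<integral>y. c *\<^sub>R h (0 + c * y) \<partial>lborel)" using assms by simp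
  also have "\<dots> = of_real c powr (s - of_nat j) * (\<integral>y. h1 y \<partial>lborel)" unfolding e by simp
  finally show ?thesis by (simp add: beta_int_def h1_def[abs_def] set_lebesgue_integral_def)
qed

text \<open>Scaling y reduces only positive a to a = 1. Both sides are holomorphic on the slit
  plane, where the principal power lives, so agreement on the positive reals spreads to the
  imaginary values of a for which the formula is used.\<close>

theorem beta_int_eq:
  assumes a: "a \<notin> \<real>\<^sub>\<le>\<^sub>0" and s: "0 < Re s" "Re s < real j"
  shows "beta_int j s a = a powr (s - of_nat j) * Beta s (of_nat j - s)"
proof -
  define U where "U = complex_of_real ` {0<..}"
  have op: "open (- (\<real>\<^sub>\<le>\<^sub>0 :: complex set))" by (simp add: open_Compl)
  have eq: "- (\<real>\<^sub>\<le>\<^sub>0 :: complex set) = - (complex_of_real ` {..0})"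
    by (auto elim!: nonpos_Reals_cases)
  have con: "connected (- (\<real>\<^sub>\<le>\<^sub>0 :: complex set))"
    unfolding eq by (intro starlike_imp_connected starlike_slotted_complex_plane_left)
  have "1 islimpt ({0<..} :: real set)" by (rule interior_limit_point) (auto simp: interior_open)
  then have "complex_of_real 1 islimpt U"
    unfolding U_def by (rule islimpt_of_real_image)
  then have lim: "1 islimpt U" by simp
  have "(\<lambda>a. beta_int j s a - a powr (s - of_nat j) * Beta s (of_nat j - s)) a = 0"
  proof (rule analytic_continuation[where S = "- \<real>\<^sub>\<le>\<^sub>0" and U = U and \<xi> = 1 and f = "\<lambda>a. beta_int j s a - a powr (s - of_nat j) * Beta s (of_nat j - s)"])
    show "(\<lambda>a. beta_int j s a - a powr (s - of_nat j) * Beta s (of_nat j - s)) holomorphic_on - \<real>\<^sub>\<le>\<^sub>0"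
      by (intro holomorphic_intros beta_int_holomorphic_a s) auto
    show "beta_int j s z - z powr (s - of_nat j) * Beta s (of_nat j - s) = 0" if "z \<in> U" for z
      using that beta_int_pos beta_int_one[OF s] by (auto simp: U_def)
  qed (use op con lim a in \<open>auto simp: U_def complex_nonpos_Reals_iff\<close>)
  then show ?thesis by simp
qed

section \<open>Partial fractions and terminating hypergeometric series\<close>

text \<open>Supplies the induction step in b of \<open>binomial_partition_of_unity\<close>: by
  Pascal's rule, multiplication by 1 - X lowers b by one, up to a boundary term.\<close>

lemma negative_binomial_telescope:
  fixes X :: "'a::comm_ring_1"
  shows "(1 - X) * (\<Sum>m\<le>a. of_nat (Suc b + m choose m) * X ^ m)
     = (\<Sum>m\<le>a. of_nat (b + m choose m) * X ^ m) - of_nat (Suc (a + b) choose Suc b) * X ^ Suc a"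
proof (induction a)
  case (Suc a)
  have 1: "Suc b + Suc a choose Suc a = Suc (Suc a + b) choose Suc b"
    using binomial_symmetric[of "Suc a" "Suc b + Suc a"] by (simp add: add.commute)
  have 2: "Suc b + Suc a choose Suc a = (b + Suc a choose Suc a) + (Suc (a + b) choose Suc b)"
    using binomial_symmetric[of a "Suc (a + b)"] by (simp add: add.commute)
  have "(1 - X) * (\<Sum>m\<le>Suc a. of_nat (Suc b + m choose m) * X ^ m)
      = (1 - X) * (\<Sum>m\<le>a. of_nat (Suc b + m choose m) * X ^ m)
        + of_nat (Suc b + Suc a choose Suc a) * X ^ Suc a - of_nat (Suc b + Suc a choose Suc a) * X ^ Suc (Suc a)"
    by (simp add: algebra_simps del: binomial_Suc_Suc)
  also have "of_nat (Suc b + Suc a choose Suc a) * X ^ Suc (Suc a) = of_nat (Suc (Suc a + b) choose Suc b) * X ^ Suc (Suc a)"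
    unfolding 1 ..
  finally show ?case unfolding Suc.IH 2
    by (simp add: algebra_simps del: binomial_Suc_Suc)
qed simp

text \<open>For probabilities X and Y this is the dichotomy of a race: the first summand is the
  chance that a + 1 successes come before b + 1 failures, the second is the chance of the
  opposite.\<close>

lemma binomial_partition_of_unity:
  fixes X Y :: "'a::comm_ring_1"
  assumes "X + Y = 1"
  shows "X ^ Suc a * (\<Sum>m\<le>b. of_nat (a + m choose m) * Y ^ m)
       + Y ^ Suc b * (\<Sum>m\<le>a. of_nat (b + m choose m) * X ^ m) = 1"
proof (induction b)
  case 0
  have Y: "Y = 1 - X" using assms by (simp add: algebra_simps)
  have "(1 - X) * (\<Sum>m\<le>a. X ^ m) = 1 - X ^ Suc a"
    by (rule sum_gp_basic)
  then show ?case by (simp add: Y)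
next
  case (Suc b)
  have Y: "Y = 1 - X" using assms by (simp add: algebra_simps)
  have sym: "a + Suc b choose Suc b = Suc (a + b) choose Suc b" by simp
  have "Y ^ Suc (Suc b) * (\<Sum>m\<le>a. of_nat (Suc b + m choose m) * X ^ m)
     = Y ^ Suc b * ((1 - X) * (\<Sum>m\<le>a. of_nat (Suc b + m choose m) * X ^ m))"
    by (simp add: Y mult_ac del: binomial_Suc_Suc)
  also have "\<dots> = Y ^ Suc b * (\<Sum>m\<le>a. of_nat (b + m choose m) * X ^ m) - of_nat (Suc (a + b) choose Suc b) * X ^ Suc a * Y ^ Suc b"
    unfolding negative_binomial_telescope by (simp add: algebra_simps del: binomial_Suc_Suc)
  finally have e: "Y ^ Suc (Suc b) * (\<Sum>m\<le>a. of_nat (Suc b + m choose m) * X ^ m)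
    = Y ^ Suc b * (\<Sum>m\<le>a. of_nat (b + m choose m) * X ^ m) - of_nat (Suc (a + b) choose Suc b) * X ^ Suc a * Y ^ Suc b" .
  have "X ^ Suc a * (\<Sum>m\<le>Suc b. of_nat (a + m choose m) * Y ^ m)
     = X ^ Suc a * (\<Sum>m\<le>b. of_nat (a + m choose m) * Y ^ m) + of_nat (Suc (a + b) choose Suc b) * X ^ Suc a * Y ^ Suc b"
    by (simp add: algebra_simps del: binomial_Suc_Suc)
  then show ?case unfolding e using Suc.IH by (simp add: algebra_simps del: binomial_Suc_Suc)
qed

text \<open>X = -u/\<delta> and Y = v/\<delta> have sum 1; dividing the preceding identity with a =
  b = n by (u v)^(n+1) gives the decomposition. For u = y + a and v = y + b the difference \<delta>
  does not depend on y, so the coefficients are constants.\<close>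

lemma partial_fractions_power:
  fixes u v :: complex
  assumes "u \<noteq> 0" "v \<noteq> 0" "v \<noteq> u"
  defines "\<delta> \<equiv> v - u"
  shows "1 / (u ^ Suc n * v ^ Suc n) =
    (\<Sum>m\<le>n. of_nat (n + m choose m) * ((- 1 / \<delta>) ^ Suc n * (1 / \<delta>) ^ m * (1 / v ^ (Suc n - m))
                                   + (1 / \<delta>) ^ Suc n * (- 1 / \<delta>) ^ m * (1 / u ^ (Suc n - m))))"
proof -
  have \<delta>: "\<delta> \<noteq> 0" using assms by simp
  define X where "X = - u / \<delta>"
  define Y where "Y = v / \<delta>"
  have "Y + X = (v - u) / \<delta>" by (simp only: X_def Y_def diff_divide_distrib) simp
  then have XY: "X + Y = 1" using \<delta> by (simp add: \<delta>_def add.commute)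
  have t: "of_nat (n + m choose m) * ((- 1 / \<delta>) ^ Suc n * (1 / \<delta>) ^ m * (1 / v ^ (Suc n - m))
                                   + (1 / \<delta>) ^ Suc n * (- 1 / \<delta>) ^ m * (1 / u ^ (Suc n - m)))
     = (X ^ Suc n * (of_nat (n + m choose m) * Y ^ m) + Y ^ Suc n * (of_nat (n + m choose m) * X ^ m)) / (u ^ Suc n * v ^ Suc n)"
    if m: "m \<le> n" for m
  proof -
    have v: "1 / v ^ (Suc n - m) = v ^ m / v ^ Suc n" and u: "1 / u ^ (Suc n - m) = u ^ m / u ^ Suc n"
      using assms m by (simp_all add: power_diff)
    have X1: "(- 1 / \<delta>) ^ i = X ^ i / u ^ i" and Y1: "(1 / \<delta>) ^ i = Y ^ i / v ^ i" for i
      using assms by (simp_all add: X_def Y_def power_divide[symmetric])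
    show ?thesis unfolding v u X1 Y1
      using assms by (simp add: divide_simps) (simp add: algebra_simps)
  qed
  have "(\<Sum>m\<le>n. of_nat (n + m choose m) * ((- 1 / \<delta>) ^ Suc n * (1 / \<delta>) ^ m * (1 / v ^ (Suc n - m))
                                   + (1 / \<delta>) ^ Suc n * (- 1 / \<delta>) ^ m * (1 / u ^ (Suc n - m))))
     = (\<Sum>m\<le>n. (X ^ Suc n * (of_nat (n + m choose m) * Y ^ m) + Y ^ Suc n * (of_nat (n + m choose m) * X ^ m)) / (u ^ Suc n * v ^ Suc n))"
    by (rule sum.cong[OF refl], rule t) simp
  also have "\<dots> = (X ^ Suc n * (\<Sum>m\<le>n. of_nat (n + m choose m) * Y ^ m) + Y ^ Suc n * (\<Sum>m\<le>n. of_nat (n + m choose m) * X ^ m)) / (u ^ Suc n * v ^ Suc n)"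
    unfolding sum_divide_distrib[symmetric] sum.distrib sum_distrib_left ..
  finally show ?thesis unfolding binomial_partition_of_unity[OF XY] by simp
qed

definition hypergeo_poly :: "nat \<Rightarrow> complex \<Rightarrow> complex \<Rightarrow> complex \<Rightarrow> complex" where
  "hypergeo_poly n b c x = (\<Sum>m\<le>n. pochhammer (- of_nat n) m * pochhammer b m / (pochhammer c m * fact m) * x ^ m)"

lemma hyp_2F1_eq_poly:
  "hyp_2F1 b (- of_nat n) c x = hypergeo_poly n b c x"
proof -
  have z: "pochhammer (- of_nat n :: complex) m = 0" if "m > n" for m
    using that by (simp add: pochhammer_of_nat_eq_0_lemma)
  have "hyp_2F1 b (- of_nat n) c x = (\<Sum>m. fps_nth (fps_hypergeo [b, - of_nat n] [c] 1) m * x ^ m)"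
    by (simp add: hyp_2F1_def eval_fps_def)
  also have "\<dots> = (\<Sum>m\<le>n. fps_nth (fps_hypergeo [b, - of_nat n] [c] 1) m * x ^ m)"
    by (rule suminf_finite) (auto simp: z)
  also have "\<dots> = hypergeo_poly n b c x"
    by (simp add: hypergeo_poly_def mult_ac)
  finally show ?thesis .
qed

lemma pochhammer_nz:
  fixes c :: complex
  assumes "c \<notin> \<int>"
  shows "pochhammer c m \<noteq> 0"
  using assms by (auto simp: pochhammer_eq_0_iff)

text \<open>Expanding (1 - x)^m and exchanging the sums leaves an inner sum that the Chu-Vandermonde
  identity evaluates. Nonintegral lower parameters keep all Pochhammer symbols in denominators
  nonzero.\<close>

lemma hypergeo_poly_reflect:
  fixes b c x :: complex
  assumes c: "c \<notin> \<int>" and c': "b - c - of_nat n + 1 \<notin> \<int>"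
  shows "hypergeo_poly n b c x = pochhammer (c - b) n / pochhammer c n * hypergeo_poly n b (b - c - of_nat n + 1) (1 - x)"
proof -
  define c' where "c' = b - c - of_nat n + 1"
  define N where "N = (- of_nat n :: complex)"
  note c'nz = pochhammer_nz[OF assms(2), folded c'_def] and cnz = pochhammer_nz[OF c]
  define t where "t m = pochhammer N m * pochhammer b m / (pochhammer c' m * fact m)" for m
  have inner: "(\<Sum>m=j..n. t m * of_nat (m choose j)) = t j * (pochhammer (c' - b) (n - j) / pochhammer (c' + of_nat j) (n - j))"
    if j: "j \<le> n" for j
  proof -
    have nz: "pochhammer (c' + of_nat j) i \<noteq> 0" for i
      using c'nz[of "j + i"] by (simp add: pochhammer_product')
    have tt: "t (j + i) * of_nat (j + i choose j) = t j * (pochhammer (b + of_nat j) i * pochhammer (- of_nat (n - j)) i / (of_nat (fact i) * pochhammer (c' + of_nat j) i))" for i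
    proof -
      have "of_nat (j + i choose j) = (fact (j + i) / (fact j * fact i) :: complex)"
        using binomial_fact[of j "j + i"] by simp
      moreover have "N + of_nat j = - of_nat (n - j)" using j by (simp add: N_def of_nat_diff)
      ultimately show ?thesis
        unfolding t_def pochhammer_product' by (simp add: mult_ac)
    qed
    have "(\<Sum>m=j..n. t m * of_nat (m choose j)) = (\<Sum>i=0..n-j. t (j + i) * of_nat (j + i choose j))"
      using j sum.shift_bounds_cl_nat_ivl[of "\<lambda>m. t m * of_nat (m choose j)" 0 j "n - j"] by (simp add: add.commute)
    also have "\<dots> = t j * (\<Sum>i=0..n-j. pochhammer (b + of_nat j) i * pochhammer (- of_nat (n - j)) i / (of_nat (fact i) * pochhammer (c' + of_nat j) i))"
      unfolding tt sum_distrib_left ..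
    also have "(\<Sum>i=0..n-j. pochhammer (b + of_nat j) i * pochhammer (- of_nat (n - j)) i / (of_nat (fact i) * pochhammer (c' + of_nat j) i))
       = pochhammer (c' + of_nat j - (b + of_nat j)) (n - j) / pochhammer (c' + of_nat j) (n - j)"
    proof (rule Vandermonde_pochhammer)
      show "\<forall>i\<in>{0..<n - j}. c' + of_nat j \<noteq> - of_nat i"
      proof (intro ballI notI)
        fix i assume "c' + of_nat j = - of_nat i"
        then have "c' = - of_nat i - of_nat j" by (simp add: algebra_simps)
        then have "c' \<in> \<int>" by simp
        then show False using assms(2) by (simp add: c'_def)
      qed
    qed
    finally show ?thesis by simp
  qed
  \<comment> \<open>Reversing the factors of Pochhammer symbols produces the signs (-1)^n and
    (-1)^(n-j); with (-1)^j from (-x)^j they cancel.\<close>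
  have coef: "pochhammer (c - b) n / pochhammer c n * ((- 1) ^ j * (t j * (pochhammer (c' - b) (n - j) / pochhammer (c' + of_nat j) (n - j))))
     = pochhammer N j * pochhammer b j / (pochhammer c j * fact j)" if j: "j \<le> n" for j
  proof -
    have 1: "pochhammer c' n = (- 1) ^ n * pochhammer (c - b) n"
      using pochhammer_minus[of "c - b + of_nat n - 1" n] by (simp add: c'_def algebra_simps)
    have 2: "pochhammer (c' - b) (n - j) = (- 1) ^ (n - j) * pochhammer (c + of_nat j) (n - j)"
      using pochhammer_minus[of "c + of_nat n - 1" "n - j"] j by (simp add: c'_def of_nat_diff algebra_simps)
    have 3: "pochhammer c n = pochhammer c j * pochhammer (c + of_nat j) (n - j)"
            "pochhammer c' n = pochhammer c' j * pochhammer (c' + of_nat j) (n - j)"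
      using j by (simp_all add: pochhammer_product)
    have nz: "pochhammer c' j \<noteq> 0" "pochhammer (c' + of_nat j) (n - j) \<noteq> 0" "pochhammer c j \<noteq> 0" "pochhammer (c + of_nat j) (n - j) \<noteq> 0"
      using c'nz[of n] cnz[of n] unfolding 3 by auto
    have sg: "(- 1) ^ n = ((- 1) ^ j * (- 1) ^ (n - j) :: complex)" using j by (simp add: power_add[symmetric])
    have cb: "pochhammer (c - b) n = (- 1) ^ n * (pochhammer c' j * pochhammer (c' + of_nat j) (n - j))"
      using 1 3(2) by (metis minus_one_mult_self mult.assoc mult.left_neutral)
    have "pochhammer (c - b) n / pochhammer c n * ((- 1) ^ j * (t j * (pochhammer (c' - b) (n - j) / pochhammer (c' + of_nat j) (n - j))))
      = ((- 1) ^ n * (- 1) ^ j * (- 1) ^ (n - j)) * (pochhammer N j * pochhammer b j / (pochhammer c j * fact j))"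
      unfolding cb 2 3(1) t_def using nz by simp
    also have "(- 1) ^ n * (- 1) ^ j * (- 1) ^ (n - j) = (1 :: complex)"
      unfolding mult.assoc sg[symmetric] by (simp flip: power_add)
    finally show ?thesis by simp
  qed
  have "hypergeo_poly n b c' (1 - x) = (\<Sum>m\<le>n. t m * (\<Sum>j\<le>m. of_nat (m choose j) * (- x) ^ j))"
    unfolding hypergeo_poly_def t_def N_def
    by (rule sum.cong[OF refl]) (use binomial_ring[of "- x" 1] in \<open>simp add: add.commute\<close>)
  also have "\<dots> = (\<Sum>m\<le>n. \<Sum>j\<le>m. t m * of_nat (m choose j) * (- x) ^ j)"
    by (simp add: sum_distrib_left mult.assoc)
  also have "\<dots> = (\<Sum>j\<le>n. \<Sum>m=j..n. t m * of_nat (m choose j) * (- x) ^ j)"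
    by (subst sum.Sigma, simp, simp, subst sum.Sigma, simp, simp)
       (rule sum.reindex_bij_witness[of _ "\<lambda>(a, b). (b, a)" "\<lambda>(a, b). (b, a)"], auto)
  also have "\<dots> = (\<Sum>j\<le>n. (t j * (pochhammer (c' - b) (n - j) / pochhammer (c' + of_nat j) (n - j))) * (- x) ^ j)"
    unfolding sum_distrib_right[symmetric] using inner by simp
  finally have e: "hypergeo_poly n b c' (1 - x) = \<dots>" .
  have "pochhammer (c - b) n / pochhammer c n * hypergeo_poly n b c' (1 - x)
    = (\<Sum>j\<le>n. pochhammer (c - b) n / pochhammer c n * ((- 1) ^ j * (t j * (pochhammer (c' - b) (n - j) / pochhammer (c' + of_nat j) (n - j)))) * x ^ j)"
    unfolding e sum_distrib_left by (rule sum.cong[OF refl]) (simp add: power_minus[of x] mult_ac)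
  also have "\<dots> = hypergeo_poly n b c x"
    unfolding hypergeo_poly_def N_def[symmetric] by (rule sum.cong[OF refl]) (simp only: coef atMost_iff)
  finally show ?thesis by (simp add: c'_def)
qed

text \<open>Partial fractions give Beta integrals whose second argument drops with m. Their ratio to
  the one with m = 0 is a quotient of Pochhammer symbols, and this is the part of the hypergeometric
  coefficient that the binomials do not provide.\<close>

lemma Beta_shift:
  fixes s :: complex
  assumes s: "s \<notin> \<int>" and m: "m \<le> n"
  shows "Beta s (of_nat (Suc n - m) - s) = Beta s (of_nat (Suc n) - s) *
     (pochhammer (- of_nat n) m / pochhammer (s - of_nat n) m)"
proof -
  define z where "z = of_nat (Suc n - m) - s"
  have zZ: "z \<notin> \<int>"
  proof
    assume "z \<in> \<int>"
    then have "of_nat (Suc n - m) - z \<in> \<int>" by (intro Ints_diff) auto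
    then show False using s by (simp add: z_def)
  qed
  have zn: "z \<notin> \<int>\<^sub>\<le>\<^sub>0" using zZ nonpos_Ints_subset_Ints by blast
  have e: "of_nat (Suc n) - s = z + of_nat m" using m by (simp add: z_def of_nat_diff)
  have kn: "of_nat (Suc n - m) \<notin> (\<int>\<^sub>\<le>\<^sub>0 :: complex set)"
    by (subst of_nat_in_nonpos_Ints_iff) (use m in auto)
  have ek: "(of_nat (Suc n) :: complex) = of_nat (Suc n - m) + of_nat m" using m by (simp add: of_nat_diff)
  have sn: "s - of_nat n \<notin> \<int>" using s by (metis Ints_add Ints_of_nat diff_add_cancel)
  have p1: "pochhammer z m = Gamma (z + of_nat m) / Gamma z" by (rule pochhammer_Gamma[OF zn])
  have p2: "pochhammer (of_nat (Suc n - m)) m = Gamma (of_nat (Suc n)) / (Gamma (of_nat (Suc n - m)) :: complex)"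
    unfolding ek by (rule pochhammer_Gamma[OF kn])
  have q1: "pochhammer (s - of_nat n) m = (- 1) ^ m * pochhammer z m"
    using pochhammer_minus[of "of_nat n - s" m] m by (simp add: z_def of_nat_diff algebra_simps)
  have q2: "pochhammer (- of_nat n) m = (- 1) ^ m * (pochhammer (of_nat (Suc n - m)) m :: complex)"
    using pochhammer_minus[of "of_nat n :: complex" m] m by (simp add: of_nat_diff algebra_simps)
  have "z + of_nat m \<notin> \<int>" using zZ by (metis Ints_diff Ints_of_nat add_diff_cancel_right')
  then have zm: "z + of_nat m \<notin> \<int>\<^sub>\<le>\<^sub>0" using nonpos_Ints_subset_Ints by blast
  have g: "Gamma z \<noteq> 0" "Gamma (z + of_nat m) \<noteq> 0" "Gamma (of_nat (Suc n) :: complex) \<noteq> 0" "Gamma (of_nat (Suc n - m) :: complex) \<noteq> 0"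
    unfolding Gamma_eq_zero_iff of_nat_in_nonpos_Ints_iff using zn zm m by auto
  have sz: "s + z = of_nat (Suc n - m)" "s + (z + of_nat m) = of_nat (Suc n)"
    unfolding e[symmetric] by (simp_all add: z_def)
  have "pochhammer (- of_nat n) m / pochhammer (s - of_nat n) m
     = (Gamma (of_nat (Suc n)) / Gamma (of_nat (Suc n - m))) / (Gamma (z + of_nat m) / Gamma z)"
    unfolding q1 q2 p1 p2 by simp
  then have "Beta s (z + of_nat m) * (pochhammer (- of_nat n) m / pochhammer (s - of_nat n) m) = Beta s z"
    unfolding Beta_def sz using g by simp
  then show ?thesis unfolding e z_def[symmetric] by (rule sym)
qed

text \<open>The Pochhammer quotient is the factor left over by \<open>hypergeo_poly_reflect\<close>.
  In Gamma values the claim comes down to the reflection formula at s and at s - k with k = n + 1;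
  the sign is that of sin(\<pi>(s - k)) = (-1)^k sin(\<pi>s).\<close>

lemma Beta_reflect:
  fixes s :: complex
  assumes s: "s \<notin> \<int>"
  shows "Beta s (of_nat (Suc n) - s) = (- 1) ^ Suc n * Beta (2 * of_nat (Suc n) - s) (s - of_nat (Suc n)) *
     (pochhammer (1 - s) n / pochhammer (of_nat (Suc n) - s + 1) n)"
proof -
  define k where "k = (of_nat (Suc n) :: complex)"
  have kZ: "k \<in> \<int>" by (simp add: k_def)
  have nZ: "z \<notin> \<int>\<^sub>\<le>\<^sub>0" if "z + s \<in> \<int> \<or> z - s \<in> \<int>" for z
  proof
    assume "z \<in> \<int>\<^sub>\<le>\<^sub>0"
    then have z: "z \<in> \<int>" using nonpos_Ints_subset_Ints by blast
    from that have "s \<in> \<int>"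
    proof
      assume "z + s \<in> \<int>"
      from Ints_diff[OF this z] show ?thesis by simp
    next
      assume "z - s \<in> \<int>"
      from Ints_diff[OF z this] show ?thesis by simp
    qed
    then show False using s by simp
  qed
  have g1: "pochhammer (1 - s) n = Gamma (k - s) / Gamma (1 - s)"
    using pochhammer_Gamma[of "1 - s" n] nZ[of "1 - s"] by (simp add: k_def algebra_simps)
  have g2: "pochhammer (k - s + 1) n = Gamma (2 * k - s) / Gamma (k - s + 1)"
    using pochhammer_Gamma[of "k - s + 1" n] nZ[of "k - s + 1"] kZ by (simp add: k_def algebra_simps)
  have nz: "Gamma (k - s) \<noteq> 0" "Gamma (1 - s) \<noteq> 0" "Gamma (2 * k - s) \<noteq> 0" "Gamma (k - s + 1) \<noteq> 0" "Gamma s \<noteq> 0"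
    unfolding Gamma_eq_zero_iff using kZ by (auto intro!: nZ)
  have r1: "Gamma (s - k) * Gamma (k - s + 1) = of_real pi / sin (of_real pi * (s - k))"
    using Gamma_reflection_complex[of "s - k"] by (simp add: algebra_simps)
  have r2: "Gamma s * Gamma (1 - s) = of_real pi / sin (of_real pi * s)"
    using Gamma_reflection_complex[of s] by simp
  have sn: "sin (of_real pi * (s - k)) = (- 1) ^ Suc n * sin (of_real pi * s)"
  proof -
    have "sin (of_real pi * s - of_real (real (Suc n) * pi)) = sin (of_real pi * s) * cos (complex_of_real (real (Suc n) * pi)) - cos (of_real pi * s) * sin (complex_of_real (real (Suc n) * pi))"
      by (rule sin_diff)
    also have "cos (complex_of_real (real (Suc n) * pi)) = (- 1) ^ Suc n"
      unfolding cos_of_real cos_npi by simp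
    also have "sin (complex_of_real (real (Suc n) * pi)) = 0"
      unfolding sin_of_real sin_npi by simp
    finally show ?thesis by (simp add: k_def algebra_simps)
  qed
  have "Gamma (s - k) * Gamma (k - s + 1) = (- 1) ^ Suc n * (Gamma s * Gamma (1 - s))"
    unfolding r1 r2 sn by (cases "even n") auto
  then have "(- 1) ^ Suc n * (Gamma (s - k) * Gamma (k - s + 1)) = (- 1) ^ Suc n * ((- 1) ^ Suc n * (Gamma s * Gamma (1 - s)))"
    by simp
  also have "\<dots> = Gamma s * Gamma (1 - s)" by (simp only: minus_one_mult_self mult.assoc[symmetric] mult_1_left)
  finally have key: "(- 1) ^ Suc n * (Gamma (s - k) * Gamma (k - s + 1)) = Gamma s * Gamma (1 - s)" .
  have "(- 1) ^ Suc n * Beta (2 * k - s) (s - k) * (pochhammer (1 - s) n / pochhammer (k - s + 1) n)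
     = ((- 1) ^ Suc n * (Gamma (s - k) * Gamma (k - s + 1))) * Gamma (k - s) / (Gamma (1 - s) * Gamma k)"
    unfolding g1 g2 Beta_def using nz by (simp add: field_simps)
  also have "\<dots> = Beta s (k - s)" unfolding key Beta_def using nz by simp
  finally show ?thesis by (simp only: k_def)
qed

text \<open>Partial fractions attach to the positive root a series in 1 - x with lower parameter s -
  n. Here it takes the shape that occurs in R(s): argument x, lower parameter k - s + 1 and Beta
  value B(2k - s, s - k), where k = n + 1.\<close>

lemma hypergeo_first_term:
  fixes s x :: complex
  assumes s: "s \<notin> \<int>"
  shows "Beta s (of_nat (Suc n) - s) * hypergeo_poly n (of_nat (Suc n)) (s - of_nat n) (1 - x)
     = (- 1) ^ Suc n * Beta (2 * of_nat (Suc n) - s) (s - of_nat (Suc n)) * hypergeo_poly n (of_nat (Suc n)) (of_nat (Suc n) - s + 1) x"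
proof -
  have 1: "of_nat (Suc n) - s + 1 \<notin> \<int>"
  proof
    assume "of_nat (Suc n) - s + 1 \<in> \<int>"
    then have "of_nat (Suc n) + 1 - (of_nat (Suc n) - s + 1) \<in> \<int>" by (intro Ints_diff) auto
    then show False using s by simp
  qed
  have e: "of_nat (Suc n) - (of_nat (Suc n) - s + 1) - of_nat n + 1 = s - of_nat n" by simp
  have 2: "s - of_nat n \<notin> \<int>" using s by (metis Ints_add Ints_of_nat diff_add_cancel)
  have "hypergeo_poly n (of_nat (Suc n)) (of_nat (Suc n) - s + 1) x
    = pochhammer (1 - s) n / pochhammer (of_nat (Suc n) - s + 1) n * hypergeo_poly n (of_nat (Suc n)) (s - of_nat n) (1 - x)"
    using hypergeo_poly_reflect[of "of_nat (Suc n) - s + 1" "of_nat (Suc n)" n x, unfolded e, OF 1 2] by (simp add: algebra_simps)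
  then show ?thesis unfolding Beta_reflect[OF s, of n] by (simp add: mult_ac)
qed

text \<open>Re s < 1 is the price of the simple poles 1/(y + a) and 1/(y + b) among the partial
  fractions: taken separately they decay only like 1/y, although the product decays like
  y^(-2n-2).\<close>

lemma beta_int_product:
  fixes a b s :: complex
  assumes a: "a \<notin> \<real>\<^sub>\<le>\<^sub>0" and b: "b \<notin> \<real>\<^sub>\<le>\<^sub>0" and ab: "a \<noteq> b" and s: "0 < Re s" "Re s < 1"
  defines "\<delta> \<equiv> b - a"
  shows "set_integrable lborel {0<..} (\<lambda>y. complex_of_real y powr s / of_real y / ((of_real y + a) ^ Suc n * (of_real y + b) ^ Suc n))"
    and "(LINT y:{0<..}|lborel. complex_of_real y powr s / of_real y / ((of_real y + a) ^ Suc n * (of_real y + b) ^ Suc n))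
      = (- 1 / \<delta>) ^ Suc n * b powr (s - of_nat (Suc n)) * (Beta s (of_nat (Suc n) - s) * hypergeo_poly n (of_nat (Suc n)) (s - of_nat n) (b / \<delta>))
      + (1 / \<delta>) ^ Suc n * a powr (s - of_nat (Suc n)) * (Beta s (of_nat (Suc n) - s) * hypergeo_poly n (of_nat (Suc n)) (s - of_nat n) (- a / \<delta>))"
proof -
  have sZ: "s \<notin> \<int>" using s by (auto elim!: Ints_cases)
  have nz: "complex_of_real y + c \<noteq> 0" if "c \<notin> \<real>\<^sub>\<le>\<^sub>0" "y > 0" for c y
  proof
    assume "complex_of_real y + c = 0"
    then have "c = complex_of_real (- y)" by (simp add: eq_neg_iff_add_eq_0 add.commute)
    then show False using that by (simp add: complex_nonpos_Reals_iff)
  qed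
  define f where "f c j y = complex_of_real y powr s / of_real y / (of_real y + c) ^ j" for c j y
  define C where "C m = (of_nat (n + m choose m) :: complex)" for m
  define P where "P m = C m * ((- 1 / \<delta>) ^ Suc n * (1 / \<delta>) ^ m)" for m
  define R where "R m = C m * ((1 / \<delta>) ^ Suc n * (- 1 / \<delta>) ^ m)" for m
  have pf: "complex_of_real y powr s / of_real y / ((of_real y + a) ^ Suc n * (of_real y + b) ^ Suc n)
     = (\<Sum>m\<le>n. P m * f b (Suc n - m) y + R m * f a (Suc n - m) y)" if "y \<in> {0<..}" for y
  proof -
    have "1 / ((of_real y + a) ^ Suc n * (of_real y + b) ^ Suc n) =
      (\<Sum>m\<le>n. of_nat (n + m choose m) * ((- 1 / \<delta>) ^ Suc n * (1 / \<delta>) ^ m * (1 / (of_real y + b) ^ (Suc n - m))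
                                   + (1 / \<delta>) ^ Suc n * (- 1 / \<delta>) ^ m * (1 / (of_real y + a) ^ (Suc n - m))))"
      using partial_fractions_power[of "of_real y + a" "of_real y + b" n] nz[OF a] nz[OF b] that ab
      by (simp add: \<delta>_def)
    then have "complex_of_real y powr s / of_real y * (1 / ((of_real y + a) ^ Suc n * (of_real y + b) ^ Suc n)) =
      (\<Sum>m\<le>n. complex_of_real y powr s / of_real y * (of_nat (n + m choose m) * ((- 1 / \<delta>) ^ Suc n * (1 / \<delta>) ^ m * (1 / (of_real y + b) ^ (Suc n - m))
                                   + (1 / \<delta>) ^ Suc n * (- 1 / \<delta>) ^ m * (1 / (of_real y + a) ^ (Suc n - m)))))"
      by (simp only: sum_distrib_left)
    then show ?thesis
      by (simp add: f_def P_def R_def C_def algebra_simps del: power_Suc)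
  qed
  have int: "set_integrable lborel {0<..} (f c (Suc n - m))" if "c \<notin> \<real>\<^sub>\<le>\<^sub>0" "m \<le> n" for c m
    unfolding f_def using that s by (intro beta_kernel_integrable) auto
  have intP: "set_integrable lborel {0<..} (\<lambda>y. P m * f b (Suc n - m) y + R m * f a (Suc n - m) y)" if "m \<in> {..n}" for m
    using that a b by (intro set_integral_add(1) set_integrable_mult_right int) auto
  have "set_integrable lborel {0<..} (\<lambda>y. \<Sum>m\<le>n. P m * f b (Suc n - m) y + R m * f a (Suc n - m) y)"
    using intP unfolding set_integrable_def scaleR_sum_right
    by (intro Bochner_Integration.integrable_sum) auto
  then show "set_integrable lborel {0<..} (\<lambda>y. complex_of_real y powr s / of_real y / ((of_real y + a) ^ Suc n * (of_real y + b) ^ Suc n))"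
    by (subst set_integrable_cong[OF refl refl pf])
  have val: "(LINT y:{0<..}|lborel. f c (Suc n - m) y) = c powr (s - of_nat (Suc n)) * c ^ m * (Beta s (of_nat (Suc n) - s) *
     (pochhammer (- of_nat n) m / pochhammer (s - of_nat n) m))" if c: "c \<notin> \<real>\<^sub>\<le>\<^sub>0" and m: "m \<le> n" for c m
  proof -
    have c0: "c \<noteq> 0" using c by auto
    have "(LINT y:{0<..}|lborel. f c (Suc n - m) y) = c powr (s - of_nat (Suc n - m)) * Beta s (of_nat (Suc n - m) - s)"
      unfolding f_def beta_int_def[symmetric] using c m s by (intro beta_int_eq) auto
    also have "c powr (s - of_nat (Suc n - m)) = c powr (s - of_nat (Suc n) + of_nat m)"
      using m by (simp add: of_nat_diff algebra_simps)
    also have "\<dots> = c powr (s - of_nat (Suc n)) * c ^ m"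
      using c0 by (simp only: powr_add powr_nat' ) simp
    finally show ?thesis unfolding Beta_shift[OF sZ m] .
  qed
  \<comment> \<open>In this form the binomial coefficient supplies the upper parameter n + 1 of the
    series.\<close>
  have Cm: "C m = pochhammer (of_nat (Suc n)) m / fact m" for m
  proof -
    have "fact (n + m) = fact n * (pochhammer (of_nat (Suc n)) m :: complex)"
      using pochhammer_product'[of "1 :: complex" n m] by (simp add: pochhammer_fact add.commute)
    then show ?thesis unfolding C_def using binomial_fact[of m "n + m", where 'a = complex] by simp
  qed
  have tot: "(\<Sum>m\<le>n. C m * (u ^ m) * (Beta s (of_nat (Suc n) - s) * (pochhammer (- of_nat n) m / pochhammer (s - of_nat n) m)))
      = Beta s (of_nat (Suc n) - s) * hypergeo_poly n (of_nat (Suc n)) (s - of_nat n) u" for u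
    unfolding hypergeo_poly_def sum_distrib_left Cm by (rule sum.cong[OF refl]) (simp add: mult_ac)
  have "(LINT y:{0<..}|lborel. complex_of_real y powr s / of_real y / ((of_real y + a) ^ Suc n * (of_real y + b) ^ Suc n))
     = (LINT y:{0<..}|lborel. \<Sum>m\<le>n. P m * f b (Suc n - m) y + R m * f a (Suc n - m) y)"
    by (rule set_lebesgue_integral_cong) (use pf in auto)
  also have "\<dots> = (\<Sum>m\<le>n. (LINT y:{0<..}|lborel. P m * f b (Suc n - m) y + R m * f a (Suc n - m) y))"
    using intP unfolding set_lebesgue_integral_def set_integrable_def scaleR_sum_right
    by (intro Bochner_Integration.integral_sum) auto
  also have "\<dots> = (\<Sum>m\<le>n. P m * (LINT y:{0<..}|lborel. f b (Suc n - m) y) + R m * (LINT y:{0<..}|lborel. f a (Suc n - m) y))"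
  proof (rule sum.cong[OF refl])
    fix m assume m: "m \<in> {..n}"
    have "(LINT y:{0<..}|lborel. P m * f b (Suc n - m) y + R m * f a (Suc n - m) y)
       = (LINT y:{0<..}|lborel. P m * f b (Suc n - m) y) + (LINT y:{0<..}|lborel. R m * f a (Suc n - m) y)"
      using m a b by (intro set_integral_add(2) set_integrable_mult_right int) auto
    then show "(LINT y:{0<..}|lborel. P m * f b (Suc n - m) y + R m * f a (Suc n - m) y)
       = P m * (LINT y:{0<..}|lborel. f b (Suc n - m) y) + R m * (LINT y:{0<..}|lborel. f a (Suc n - m) y)"
      by (simp only: set_integral_mult_right)
  qed
  also have "\<dots> = (\<Sum>m\<le>n. (- 1 / \<delta>) ^ Suc n * b powr (s - of_nat (Suc n)) * (C m * ((b / \<delta>) ^ m) * (Beta s (of_nat (Suc n) - s) * (pochhammer (- of_nat n) m / pochhammer (s - of_nat n) m)))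
      + (1 / \<delta>) ^ Suc n * a powr (s - of_nat (Suc n)) * (C m * ((- a / \<delta>) ^ m) * (Beta s (of_nat (Suc n) - s) * (pochhammer (- of_nat n) m / pochhammer (s - of_nat n) m))))"
  proof (rule sum.cong[OF refl])
    fix m assume "m \<in> {..n}"
    then have m: "m \<le> n" by simp
    have pw: "(1 / \<delta>) ^ m * b ^ m = (b / \<delta>) ^ m" "(- 1 / \<delta>) ^ m * a ^ m = (- a / \<delta>) ^ m"
      by (simp_all add: power_mult_distrib[symmetric])
    show "P m * (LINT y:{0<..}|lborel. f b (Suc n - m) y) + R m * (LINT y:{0<..}|lborel. f a (Suc n - m) y) =
      (- 1 / \<delta>) ^ Suc n * b powr (s - of_nat (Suc n)) * (C m * ((b / \<delta>) ^ m) * (Beta s (of_nat (Suc n) - s) * (pochhammer (- of_nat n) m / pochhammer (s - of_nat n) m)))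
      + (1 / \<delta>) ^ Suc n * a powr (s - of_nat (Suc n)) * (C m * ((- a / \<delta>) ^ m) * (Beta s (of_nat (Suc n) - s) * (pochhammer (- of_nat n) m / pochhammer (s - of_nat n) m)))"
      unfolding val[OF a m] val[OF b m] P_def R_def pw[symmetric] by (simp only: mult_ac)
  qed
  also have "\<dots> = (- 1 / \<delta>) ^ Suc n * b powr (s - of_nat (Suc n)) * (Beta s (of_nat (Suc n) - s) * hypergeo_poly n (of_nat (Suc n)) (s - of_nat n) (b / \<delta>))
      + (1 / \<delta>) ^ Suc n * a powr (s - of_nat (Suc n)) * (Beta s (of_nat (Suc n) - s) * hypergeo_poly n (of_nat (Suc n)) (s - of_nat n) (- a / \<delta>))"
    unfolding sum.distrib sum_distrib_left[symmetric] tot ..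
  finally show "(LINT y:{0<..}|lborel. complex_of_real y powr s / of_real y / ((of_real y + a) ^ Suc n * (of_real y + b) ^ Suc n)) = \<dots>" .
qed

section \<open>Branches of powers and the integral of a single form\<close>

lemma ii_power_exp: "\<i> ^ k = exp (of_nat k * (\<i> * of_real pi / 2))"
proof -
  have "exp (\<i> * of_real pi / 2) = \<i>" using cis_conv_exp[of "pi / 2"] by (simp add: cis_pi_half)
  then show ?thesis by (simp only: exp_of_nat_mult)
qed

lemma cpow_ii: "cpow \<i> s = exp (s * (\<i> * of_real pi / 2))"
  by (simp add: cpow_def Ln_ii)

lemma cpow_pos: "x > 0 \<Longrightarrow> cpow (of_real x) s = exp (s * of_real (ln x))"
  by (simp add: cpow_def Arg_of_real Ln_of_real)

lemma cpow_neg: "x < 0 \<Longrightarrow> cpow (of_real x) s = exp (s * (of_real (ln (- x)) - \<i> * of_real pi))"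
proof -
  assume x: "x < 0"
  have "Ln (complex_of_real x) = of_real (ln (- x)) + \<i> * of_real pi"
    using Ln_of_real'[of x] x by simp
  then show ?thesis using x by (simp add: cpow_def Arg_of_real algebra_simps)
qed

lemma Ln_ii_pos: "x > 0 \<Longrightarrow> Ln (\<i> * of_real x) = of_real (ln x) + \<i> * of_real pi / 2"
  using Ln_times_of_real[of x \<i>] Ln_of_real[of x] by (simp add: mult.commute)

lemma Ln_ii_neg: "x < 0 \<Longrightarrow> Ln (\<i> * of_real x) = of_real (ln (- x)) - \<i> * of_real pi / 2"
  using Ln_times_of_real[of "- x" "- \<i>"] Ln_of_real[of "- x"] by (simp add: mult.commute)

text \<open>On the imaginary axis Q(iy) = -A(y + a)(y + b) with a = i\<alpha> and b = i\<beta>, and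
  for odd k the sign comes out of the k-th power. The principal arguments of a and b are \<pi>/2 and
  -\<pi>/2 = \<pi>/2 - \<pi>, so once i^s is extracted the negative root carries the argument
  -\<pi>; this is the branch that \<open>cpow\<close> chooses.\<close>

theorem period_integral:
  fixes s :: complex and A \<alpha> \<beta> :: real
  assumes "odd k" and A: "A > 0" and al: "\<alpha> > 0" and be: "\<beta> < 0" and s: "0 < Re s" "Re s < 1"
  defines "Q \<equiv> \<lambda>z :: complex. of_real A * (z - of_real \<alpha>) * (z - of_real \<beta>)"
    and "x \<equiv> complex_of_real (\<beta> / (\<beta> - \<alpha>))" and "\<kappa> \<equiv> (of_nat k :: complex)"
  shows "set_integrable lborel {0<..} (\<lambda>y. 1 / Q (\<i> * of_real y) ^ k * of_real y powr s / of_real y)"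
    and "(LINT y:{0<..}|lborel. 1 / Q (\<i> * of_real y) ^ k * of_real y powr s / of_real y)
     = 1 / of_real (A * (\<alpha> - \<beta>)) ^ k * cpow \<i> s *
        (cpow (of_real \<alpha>) (s - \<kappa>) * Beta (2 * \<kappa> - s) (s - \<kappa>) * hyp_2F1 \<kappa> (1 - \<kappa>) (\<kappa> - s + 1) x
       + cpow (of_real \<beta>) (s - \<kappa>) * Beta s (\<kappa> - s) * hyp_2F1 \<kappa> (1 - \<kappa>) (s - \<kappa> + 1) x)"
proof -
  obtain n where n: "k = Suc n" using assms(1) by (cases k) auto
  have sZ: "s \<notin> \<int>" using s by (auto elim!: Ints_cases)
  define a where "a = \<i> * complex_of_real \<alpha>"
  define b where "b = \<i> * complex_of_real \<beta>"
  have ab: "a \<notin> \<real>\<^sub>\<le>\<^sub>0" "b \<notin> \<real>\<^sub>\<le>\<^sub>0" "a \<noteq> b"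
    using al be by (auto simp: a_def b_def complex_nonpos_Reals_iff)
  define \<delta> where "\<delta> = b - a"
  define r where "r = A * (\<alpha> - \<beta>)"
  have r: "r > 0" using A al be by (simp add: r_def)
  have \<delta>0: "\<delta> \<noteq> 0" using ab by (simp add: \<delta>_def)
  have Ad: "of_real A * \<delta> = - \<i> * of_real r" by (simp add: \<delta>_def a_def b_def r_def algebra_simps)
  have Qe: "1 / Q (\<i> * of_real y) ^ k * of_real y powr s / of_real y
     = - (1 / of_real A ^ k) * (of_real y powr s / of_real y / ((of_real y + a) ^ Suc n * (of_real y + b) ^ Suc n))" for y
  proof -
    have "Q (\<i> * of_real y) = - (of_real A * ((of_real y + a) * (of_real y + b)))"
      unfolding Q_def a_def b_def by (simp add: algebra_simps)
    then have "Q (\<i> * of_real y) ^ k = - (of_real A ^ k * ((of_real y + a) ^ Suc n * (of_real y + b) ^ Suc n))"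
      unfolding n[symmetric] by (simp only: power_minus_odd[OF assms(1)] power_mult_distrib)
    then show ?thesis by simp
  qed
  note bp = beta_int_product[OF ab s, of n]
  show "set_integrable lborel {0<..} (\<lambda>y. 1 / Q (\<i> * of_real y) ^ k * of_real y powr s / of_real y)"
    unfolding Qe by (rule set_integrable_mult_right[OF bp(1)])
  \<comment> \<open>A\<delta> = -ir with r = A(\<alpha> - \<beta>), so the powers of A and \<delta>
    combine to (i/r)^k. For the forms in question r is the square root of the discriminant.\<close>
  have co: "- (1 / of_real A ^ k) * (- 1 / \<delta>) ^ Suc n = (\<i> / of_real r) ^ k"
    and co': "- (1 / of_real A ^ k) * (1 / \<delta>) ^ Suc n = - ((\<i> / of_real r) ^ k)"
  proof -
    have "(- 1 / \<delta>) ^ k = - ((1 / \<delta>) ^ k)" using assms(1) by (simp add: power_divide)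
    moreover have "(1 / of_real A ^ k) * (1 / \<delta>) ^ k = (1 / (of_real A * \<delta>)) ^ k"
      by (simp add: power_divide power_mult_distrib)
    moreover have "1 / (of_real A * \<delta>) = \<i> / of_real r"
      unfolding Ad using r by (simp add: field_simps)
    ultimately show "- (1 / of_real A ^ k) * (- 1 / \<delta>) ^ Suc n = (\<i> / of_real r) ^ k"
      "- (1 / of_real A ^ k) * (1 / \<delta>) ^ Suc n = - ((\<i> / of_real r) ^ k)"
      unfolding n[symmetric] by simp_all
  qed
  have x1: "b / \<delta> = x"
    unfolding b_def \<delta>_def a_def x_def by (simp add: right_diff_distrib[symmetric])
  have x2: "- a / \<delta> = 1 - x"
    using \<delta>0 x1 by (simp add: \<delta>_def field_simps)
  have ka: "s - \<kappa> + 1 = s - of_nat n" "1 - \<kappa> = - of_nat n" by (simp_all add: \<kappa>_def n)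
  have kap: "\<kappa> = of_nat (Suc n)" by (simp add: \<kappa>_def n)
  have pa: "\<i> ^ k * a powr (s - \<kappa>) = cpow \<i> s * cpow (of_real \<alpha>) (s - \<kappa>)"
  proof -
    have a0: "a \<noteq> 0" using al by (simp add: a_def)
    have "\<i> ^ k * a powr (s - \<kappa>) = exp (\<kappa> * (\<i> * of_real pi / 2) + (s - \<kappa>) * (of_real (ln \<alpha>) + \<i> * of_real pi / 2))"
      using a0 unfolding powr_def ii_power_exp exp_add by (simp add: a_def Ln_ii_pos[OF al] \<kappa>_def)
    also have "\<kappa> * (\<i> * of_real pi / 2) + (s - \<kappa>) * (of_real (ln \<alpha>) + \<i> * of_real pi / 2)
      = s * (\<i> * of_real pi / 2) + (s - \<kappa>) * of_real (ln \<alpha>)"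
      by (simp only: left_diff_distrib distrib_left) simp
    finally show ?thesis unfolding exp_add cpow_ii cpow_pos[OF al] .
  qed
  have pb: "\<i> ^ k * b powr (s - \<kappa>) = cpow \<i> s * cpow (of_real \<beta>) (s - \<kappa>)"
  proof -
    have b0: "b \<noteq> 0" using be by (simp add: b_def)
    have "\<i> ^ k * b powr (s - \<kappa>) = exp (\<kappa> * (\<i> * of_real pi / 2) + (s - \<kappa>) * (of_real (ln (- \<beta>)) - \<i> * of_real pi / 2))"
      using b0 unfolding powr_def ii_power_exp exp_add by (simp add: b_def Ln_ii_neg[OF be] \<kappa>_def)
    also have "\<kappa> * (\<i> * of_real pi / 2) + (s - \<kappa>) * (of_real (ln (- \<beta>)) - \<i> * of_real pi / 2)
      = s * (\<i> * of_real pi / 2) + (s - \<kappa>) * (of_real (ln (- \<beta>)) - \<i> * of_real pi)"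
    proof -
      define P where "P = \<i> * complex_of_real pi / 2"
      have "\<i> * complex_of_real pi = 2 * P" by (simp add: P_def)
      then show ?thesis unfolding P_def[symmetric] by (simp only:) (simp add: algebra_simps)
    qed
    finally show ?thesis unfolding exp_add cpow_ii cpow_neg[OF be] .
  qed
  have sg: "(- 1) ^ Suc n = (- 1 :: complex)" using assms(1) n by simp
  define H1 where "H1 = Beta (2 * \<kappa> - s) (s - \<kappa>) * hypergeo_poly n \<kappa> (\<kappa> - s + 1) x"
  define H2 where "H2 = Beta s (\<kappa> - s) * hypergeo_poly n \<kappa> (s - of_nat n) x"
  have H1: "Beta s (\<kappa> - s) * hypergeo_poly n \<kappa> (s - of_nat n) (1 - x) = - H1"
    using hypergeo_first_term[OF sZ, of n x] unfolding sg H1_def kap by simp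
  have "(LINT y:{0<..}|lborel. 1 / Q (\<i> * of_real y) ^ k * of_real y powr s / of_real y)
     = - (1 / of_real A ^ k) * ((- 1 / \<delta>) ^ Suc n * b powr (s - \<kappa>) * H2 + (1 / \<delta>) ^ Suc n * a powr (s - \<kappa>) * (- H1))"
    unfolding Qe set_integral_mult_right bp(2) \<delta>_def[symmetric] x1 x2 kap[symmetric] H1 H2_def ..
  also have "\<dots> = (- (1 / of_real A ^ k) * (- 1 / \<delta>) ^ Suc n) * b powr (s - \<kappa>) * H2
      + (- (1 / of_real A ^ k) * (1 / \<delta>) ^ Suc n) * a powr (s - \<kappa>) * (- H1)"
    by (simp only: distrib_left mult.assoc)
  also have "\<dots> = 1 / of_real r ^ k * ((\<i> ^ k * b powr (s - \<kappa>)) * H2 + (\<i> ^ k * a powr (s - \<kappa>)) * H1)"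
    unfolding co co' by (simp add: power_divide add_divide_distrib)
  also have "\<dots> = 1 / of_real r ^ k * cpow \<i> s * (cpow (of_real \<alpha>) (s - \<kappa>) * H1 + cpow (of_real \<beta>) (s - \<kappa>) * H2)"
    unfolding pa pb by (simp add: algebra_simps)
  finally show "(LINT y:{0<..}|lborel. 1 / Q (\<i> * of_real y) ^ k * of_real y powr s / of_real y)
     = 1 / of_real (A * (\<alpha> - \<beta>)) ^ k * cpow \<i> s *
        (cpow (of_real \<alpha>) (s - \<kappa>) * Beta (2 * \<kappa> - s) (s - \<kappa>) * hyp_2F1 \<kappa> (1 - \<kappa>) (\<kappa> - s + 1) x
       + cpow (of_real \<beta>) (s - \<kappa>) * Beta s (\<kappa> - s) * hyp_2F1 \<kappa> (1 - \<kappa>) (s - \<kappa> + 1) x)"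
    unfolding ka hyp_2F1_eq_poly H1_def H2_def r_def by (simp only: mult.assoc)
qed

section \<open>Discreteness of the Hecke groups\<close>

no_notation fps_nth (infixl \<open>$\<close> 75)

section \<open>Two by two matrices in coordinates\<close>

definition mat2 :: "real \<Rightarrow> real \<Rightarrow> real \<Rightarrow> real \<Rightarrow> real^2^2" where
  "mat2 a b c d = vector [vector [a, b], vector [c, d]]"

lemma mat2_nth [simp]:
  "mat2 a b c d $ 1 $ 1 = a" "mat2 a b c d $ 1 $ 2 = b"
  "mat2 a b c d $ 2 $ 1 = c" "mat2 a b c d $ 2 $ 2 = d"
  by (simp_all add: mat2_def vector_2)

lemma mat2_eq_iff:
  fixes M N :: "real^2^2"
  shows "M = N \<longleftrightarrow> M$1$1 = N$1$1 \<and> M$1$2 = N$1$2 \<and> M$2$1 = N$2$1 \<and> M$2$2 = N$2$2"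
  by (auto simp: vec_eq_iff forall_2)

lemma mult2_nth:
  fixes M N :: "real^2^2"
  shows "(M ** N) $ i $ j = M$i$1 * N$1$j + M$i$2 * N$2$j"
  by (simp add: matrix_matrix_mult_def sum_2)

lemma one2_nth [simp]:
  "(mat 1 :: real^2^2) $ 1 $ 1 = 1" "(mat 1 :: real^2^2) $ 1 $ 2 = 0"
  "(mat 1 :: real^2^2) $ 2 $ 1 = 0" "(mat 1 :: real^2^2) $ 2 $ 2 = 1"
  by (simp_all add: mat_def)

lemma trace2: "trace (M :: real^2^2) = M$1$1 + M$2$2"
  by (simp add: trace_def sum_2)

lemma hecke_T_eq: "hecke_T = mat2 0 (-1) 1 0"
  by (simp add: hecke_T_def mat2_def)

lemma hecke_S_eq: "hecke_S p = mat2 1 (hecke_lambda p) 0 1"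
  by (simp add: hecke_S_def mat2_def)

lemma matrix_inv_mat2:
  fixes M :: "real^2^2"
  assumes "det M = 1"
  shows "matrix_inv M = mat2 (M$2$2) (- (M$1$2)) (- (M$2$1)) (M$1$1)"
proof -
  define N where "N = mat2 (M$2$2) (- (M$1$2)) (- (M$2$1)) (M$1$1)"
  have MN: "M ** N = mat 1" and NM: "N ** M = mat 1"
    using assms by (auto simp: mat2_eq_iff mult2_nth N_def det_2 algebra_simps)
  have inv: "matrix_inv M ** M = mat 1"
    unfolding matrix_inv_def by (rule someI2[where Q = "\<lambda>A. A ** M = mat 1"], rule conjI[OF MN NM]) simp
  have "matrix_inv M = matrix_inv M ** (M ** N)" unfolding MN by (rule matrix_mul_rid[symmetric])
  also have "\<dots> = (matrix_inv M ** M) ** N" by (rule matrix_mul_assoc)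
  also have "\<dots> = N" unfolding inv by (rule matrix_mul_lid)
  finally show ?thesis unfolding N_def .
qed

lemma det_matrix_inv2:
  fixes M :: "real^2^2"
  assumes "det M = 1"
  shows "det (matrix_inv M) = 1"
  using assms by (simp add: matrix_inv_mat2 det_2 algebra_simps)

lemma det_hecke_group: "M \<in> hecke_group p \<Longrightarrow> det M = 1"
proof (induction rule: hecke_group.induct)
  case (mult M N) then show ?case by (simp add: det_mul)
next
  case (inv M) then show ?case by (simp add: det_matrix_inv2)
qed (simp_all add: hecke_S_eq hecke_T_eq det_2)

text \<open>The entries of the rotation of order $p$ in $G_p$ are the values of this function at integers.\<close>
definition hecke_sin :: "nat \<Rightarrow> real \<Rightarrow> real" where
  "hecke_sin p x = sin (x * pi / real p) / sin (pi / real p)"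

text \<open>For 1 \<le> j < p this matrix is (ST)^(j-1) S; the explicit entries make its
  nonnegativity visible.\<close>

definition hecke_V :: "nat \<Rightarrow> nat \<Rightarrow> real^2^2" where
  "hecke_V p j = mat2 (hecke_sin p (real j)) (hecke_sin p (real j + 1))
                      (hecke_sin p (real j - 1)) (hecke_sin p (real j))"

text \<open>Since V_j = -(ST)^j T, these products are the alternating words in T and powers of ST.
  Together with a sign and a factor T at either end they are the reduced words of \<open>G_p\<close>
  as a free product of cyclic groups of orders 2 and p.\<close>

inductive_set hecke_pos :: "nat \<Rightarrow> (real^2^2) set" for p :: nat where
  one: "mat 1 \<in> hecke_pos p"
| step: "w \<in> hecke_pos p \<Longrightarrow> 1 \<le> j \<Longrightarrow> j < p \<Longrightarrow> hecke_V p j ** w \<in> hecke_pos p"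

definition hecke_half :: "nat \<Rightarrow> (real^2^2) set" where
  "hecke_half p = {X. \<exists>w\<in>hecke_pos p. X = w \<or> X = - w \<or> X = hecke_T ** w \<or> X = - (hecke_T ** w)}"

text \<open>Left multiplication works on the left end of a word, so the factor T on the right is
  kept apart from \<open>hecke_half\<close>. It arises when the word in the V_j is empty, as in ST =
  V_1 T.\<close>

definition hecke_normal :: "nat \<Rightarrow> (real^2^2) set" where
  "hecke_normal p = {X. \<exists>Y\<in>hecke_half p. X = Y \<or> X = Y ** hecke_T}"

lemma uminus_mult2: "(- M) ** N = - (M ** N)" "M ** (- N) = - (M ** N)" for M N :: "real^2^2"
  by (simp_all add: mat2_eq_iff mult2_nth)

lemma T_T_mult: "hecke_T ** (hecke_T ** M) = - M" "(M ** hecke_T) ** hecke_T = - M"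
  by (simp_all add: mat2_eq_iff mult2_nth hecke_T_eq)

lemma hecke_half_uminus: "Y \<in> hecke_half p \<Longrightarrow> - Y \<in> hecke_half p"
  by (auto simp: hecke_half_def)

lemma hecke_half_T: "Y \<in> hecke_half p \<Longrightarrow> hecke_T ** Y \<in> hecke_half p"
  unfolding hecke_half_def by (auto simp: T_T_mult uminus_mult2)

lemma hecke_normal_uminus: "X \<in> hecke_normal p \<Longrightarrow> - X \<in> hecke_normal p"
  unfolding hecke_normal_def mem_Collect_eq by (metis hecke_half_uminus uminus_mult2(1))

lemma hecke_normal_T_right: "X \<in> hecke_normal p \<Longrightarrow> X ** hecke_T \<in> hecke_normal p"
  unfolding hecke_normal_def mem_Collect_eq by (metis hecke_half_uminus T_T_mult(2))

lemma hecke_half_normal: "Y \<in> hecke_half p \<Longrightarrow> Y \<in> hecke_normal p"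
  unfolding hecke_normal_def by blast

lemma hecke_normal_T_left: "X \<in> hecke_normal p \<Longrightarrow> hecke_T ** X \<in> hecke_normal p"
  unfolding hecke_normal_def mem_Collect_eq by (metis hecke_half_T matrix_mul_assoc)

lemma hecke_pos_half: "w \<in> hecke_pos p \<Longrightarrow> w \<in> hecke_half p" "w \<in> hecke_pos p \<Longrightarrow> hecke_T ** w \<in> hecke_half p"
  by (auto simp: hecke_half_def)

context
  fixes p :: nat
  assumes p: "p \<ge> 3"
begin

lemma sin_pi_p_pos: "sin (pi / real p) > 0"
  using p by (intro sin_gt_zero) (auto simp: field_simps)

lemma hecke_sin_simps [simp]: "hecke_sin p 0 = 0" "hecke_sin p 1 = 1" "hecke_sin p (real p) = 0"
  using sin_pi_p_pos p by (auto simp: hecke_sin_def)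

lemma hecke_sin_rec: "hecke_sin p (x + 1) = hecke_lambda p * hecke_sin p x - hecke_sin p (x - 1)"
proof -
  have "(x + 1) * pi / real p = x * pi / real p + pi / real p" "(x - 1) * pi / real p = x * pi / real p - pi / real p"
    by (simp_all add: distrib_right left_diff_distrib add_divide_distrib diff_divide_distrib)
  then have "sin ((x + 1) * pi / real p) = hecke_lambda p * sin (x * pi / real p) - sin ((x - 1) * pi / real p)"
    by (simp add: hecke_lambda_def sin_add sin_diff)
  then show ?thesis by (simp add: hecke_sin_def diff_divide_distrib)
qed

lemma hecke_sin_p_minus_1: "hecke_sin p (real p - 1) = 1"
proof -
  have "(real p - 1) * pi / real p = pi - pi / real p" using p by (simp add: field_simps)
  then show ?thesis using sin_pi_p_pos by (simp add: hecke_sin_def)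
qed

text \<open>The sine is symmetric under j \<mapsto> p - j and increasing up to the middle, so its
  least value is at j = 1.\<close>

lemma hecke_sin_ge_1:
  assumes "1 \<le> j" "j < p"
  shows "hecke_sin p (real j) \<ge> 1"
proof -
  have half: "sin (pi / real p) \<le> sin (real i * pi / real p)" if i: "1 \<le> i" "2 * i \<le> p" for i
  proof (rule sin_monotone_2pi_le)
    have "0 \<le> pi / real p" by simp
    then show "- (pi / 2) \<le> pi / real p" using pi_gt_zero by linarith
    have "1 * pi \<le> real i * pi" by (rule mult_right_mono) (use i in auto)
    then show "pi / real p \<le> real i * pi / real p" by (intro divide_right_mono) auto
    have "real i / real p \<le> 1 / 2" using i p by (simp add: field_simps)
    then have "real i / real p * pi \<le> 1 / 2 * pi" by (rule mult_right_mono) simp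
    then show "real i * pi / real p \<le> pi / 2" by simp
  qed
  have "sin (pi / real p) \<le> sin (real j * pi / real p)"
  proof (cases "2 * j \<le> p")
    case True
    then show ?thesis using half[of j] assms by simp
  next
    case False
    have "sin (real j * pi / real p) = sin (pi - real j * pi / real p)" by simp
    also have "pi - real j * pi / real p = real (p - j) * pi / real p"
      using assms by (simp add: field_simps of_nat_diff)
    finally show ?thesis using half[of "p - j"] False assms by simp
  qed
  then show ?thesis using sin_pi_p_pos by (simp add: hecke_sin_def)
qed

lemma hecke_sin_0_or_ge_1:
  assumes "j \<le> p"
  shows "hecke_sin p (real j) = 0 \<or> hecke_sin p (real j) \<ge> 1"
proof -
  consider "j = 0" | "j = p" | "1 \<le> j \<and> j < p" using assms by linarith
  then show ?thesis using hecke_sin_ge_1[of j] by cases auto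
qed

lemma hecke_V_entries:
  assumes "1 \<le> j" "j < p"
  shows "hecke_V p j $ i $ i' = 0 \<or> hecke_V p j $ i $ i' \<ge> 1"
proof -
  have e: "real j + 1 = real (j + 1)" "real j - 1 = real (j - 1)" using assms by auto
  have "\<forall>i i'. hecke_V p j $ i $ i' = 0 \<or> hecke_V p j $ i $ i' \<ge> 1"
    unfolding forall_2 hecke_V_def mat2_nth e
    using assms by (intro conjI hecke_sin_0_or_ge_1) auto
  then show ?thesis by blast
qed

text \<open>The set consisting of 0 and the reals \<ge> 1 is closed under sums and products.\<close>

lemma hecke_pos_entries:
  "w \<in> hecke_pos p \<Longrightarrow> w $ i $ j = 0 \<or> w $ i $ j \<ge> 1"
proof (induction arbitrary: i j rule: hecke_pos.induct)
  case one
  then show ?case by (simp add: mat_def)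
next
  case (step w l)
  have pr: "x * y = 0 \<or> x * y \<ge> 1" if "x = 0 \<or> x \<ge> 1" "y = 0 \<or> y \<ge> 1" for x y :: real
    using that mult_mono[of 1 x 1 y] by auto
  have "hecke_V p l $ i $ 1 * w $ 1 $ j = 0 \<or> hecke_V p l $ i $ 1 * w $ 1 $ j \<ge> 1"
       "hecke_V p l $ i $ 2 * w $ 2 $ j = 0 \<or> hecke_V p l $ i $ 2 * w $ 2 $ j \<ge> 1"
    by (intro pr hecke_V_entries step)+
  then show ?case unfolding mult2_nth by linarith
qed

lemma hecke_normal_entries:
  assumes "X \<in> hecke_normal p"
  shows "X $ i $ j = 0 \<or> \<bar>X $ i $ j\<bar> \<ge> 1"
proof -
  have "(\<forall>i j. X $ i $ j = 0 \<or> \<bar>X $ i $ j\<bar> \<ge> 1)"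
  proof -
    obtain Y where Y: "Y \<in> hecke_half p" "X = Y \<or> X = Y ** hecke_T"
      using assms by (auto simp: hecke_normal_def)
    obtain w where w: "w \<in> hecke_pos p" "Y = w \<or> Y = - w \<or> Y = hecke_T ** w \<or> Y = - (hecke_T ** w)"
      using Y by (auto simp: hecke_half_def)
    have "\<forall>i j. w $ i $ j = 0 \<or> \<bar>w $ i $ j\<bar> \<ge> 1"
      using hecke_pos_entries[OF w(1)] by (meson abs_ge_self order_trans)
    then have "\<forall>i j. Y $ i $ j = 0 \<or> \<bar>Y $ i $ j\<bar> \<ge> 1"
      using w(2) by (elim disjE) (simp_all add: forall_2 mult2_nth hecke_T_eq)
    then show ?thesis using Y(2) by (elim disjE) (simp_all add: forall_2 mult2_nth hecke_T_eq)
  qed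
  then show ?thesis by blast
qed

lemma hecke_S_V: "hecke_S p = hecke_V p 1"
  using hecke_sin_rec[of 1] by (simp add: hecke_S_eq hecke_V_def)

text \<open>By the recurrence of the sine quotients ST raises the index by one; at j = p - 1 the
  chain closes with T, which is the relation (ST)^p = -I.\<close>

lemma S_T_V:
  assumes "1 \<le> j" "j < p"
  shows "hecke_S p ** (hecke_T ** hecke_V p j) = (if j + 1 < p then hecke_V p (j + 1) else hecke_T)"
proof (cases "j + 1 < p")
  case True
  have "hecke_sin p (real j + 1 + 1) = hecke_lambda p * hecke_sin p (real j + 1) - hecke_sin p (real j)"
    using hecke_sin_rec[of "real j + 1"] by simp
  then show ?thesis using True hecke_sin_rec[of "real j"]
    by (simp add: mat2_eq_iff mult2_nth hecke_T_eq hecke_S_eq hecke_V_def algebra_simps)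
next
  case False
  then have j: "real j = real p - 1" using assms by linarith
  show ?thesis using False hecke_sin_rec[of "real j"] hecke_sin_p_minus_1
    by (simp add: mat2_eq_iff mult2_nth hecke_T_eq hecke_S_eq hecke_V_def j algebra_simps)
qed

lemma Sinv_V:
  assumes "1 \<le> j" "j < p"
  shows "mat2 1 (- hecke_lambda p) 0 1 ** hecke_V p j = (if j = 1 then mat 1 else hecke_T ** hecke_V p (j - 1))"
proof (cases "j = 1")
  case True
  show ?thesis using hecke_sin_rec[of 1]
    by (simp add: True mat2_eq_iff mult2_nth hecke_T_eq hecke_V_def algebra_simps)
next
  case False
  have e: "real (j - Suc 0) = real j - 1" using assms by auto
  show ?thesis using False hecke_sin_rec[of "real j"] hecke_sin_rec[of "real j - 1"]
    by (simp add: mat2_eq_iff mult2_nth hecke_T_eq hecke_V_def e algebra_simps)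
qed

lemma Sinv_T: "mat2 1 (- hecke_lambda p) 0 1 ** hecke_T = hecke_T ** hecke_V p (p - 1)"
proof -
  have e: "real (p - Suc 0) = real p - 1" using p by auto
  have "hecke_sin p (real p - 1 - 1) = hecke_lambda p"
    using hecke_sin_rec[of "real p - 1"] hecke_sin_p_minus_1 by simp
  then show ?thesis
    using hecke_sin_p_minus_1
    by (simp add: mat2_eq_iff mult2_nth hecke_T_eq hecke_V_def e)
qed

lemma S_half:
  assumes "Y \<in> hecke_half p"
  shows "hecke_S p ** Y \<in> hecke_normal p"
proof -
  obtain w where w: "w \<in> hecke_pos p" "Y = w \<or> Y = - w \<or> Y = hecke_T ** w \<or> Y = - (hecke_T ** w)"
    using assms by (auto simp: hecke_half_def)
  have 1: "hecke_S p ** w \<in> hecke_normal p"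
    unfolding hecke_S_V using w(1) p by (intro hecke_half_normal hecke_pos_half hecke_pos.step) auto
  have 2: "hecke_S p ** (hecke_T ** w) \<in> hecke_normal p"
    using w(1)
  proof cases
    case one
    have "hecke_S p ** (hecke_T ** w) = (hecke_V p 1 ** mat 1) ** hecke_T"
      by (simp add: one hecke_S_V)
    also have "\<dots> \<in> hecke_normal p"
      using p by (intro hecke_normal_T_right hecke_half_normal hecke_pos_half hecke_pos.step hecke_pos.one) auto
    finally show ?thesis .
  next
    case (step w' j)
    have e: "hecke_S p ** (hecke_T ** w) = (hecke_S p ** (hecke_T ** hecke_V p j)) ** w'"
      by (simp add: step matrix_mul_assoc)
    show ?thesis
    proof (cases "j + 1 < p")
      case True
      then show ?thesis unfolding e S_T_V[OF step(3,4)]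
        using step by (auto intro!: hecke_half_normal hecke_pos_half hecke_pos.step)
    next
      case False
      then show ?thesis unfolding e S_T_V[OF step(3,4)]
        using step by (auto intro!: hecke_half_normal hecke_pos_half)
    qed
  qed
  show ?thesis using w(2) 1 2 hecke_normal_uminus[OF 1] hecke_normal_uminus[OF 2] by (metis uminus_mult2(2))
qed

lemma Sinv_half:
  assumes "Y \<in> hecke_half p"
  shows "mat2 1 (- hecke_lambda p) 0 1 ** Y \<in> hecke_normal p"
proof -
  let ?S = "mat2 1 (- hecke_lambda p) 0 1"
  obtain w where w: "w \<in> hecke_pos p" "Y = w \<or> Y = - w \<or> Y = hecke_T ** w \<or> Y = - (hecke_T ** w)"
    using assms by (auto simp: hecke_half_def)
  have 1: "?S ** (hecke_T ** w) \<in> hecke_normal p"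
  proof -
    have "?S ** (hecke_T ** w) = hecke_T ** (hecke_V p (p - 1) ** w)"
      using Sinv_T by (metis matrix_mul_assoc)
    then show ?thesis
      using w(1) p by (auto intro!: hecke_half_normal hecke_pos_half hecke_pos.step)
  qed
  have 2: "?S ** w \<in> hecke_normal p"
    using w(1)
  proof cases
    case one
    have "?S ** w = - ((?S ** (hecke_T ** w)) ** hecke_T)"
      by (simp add: one mat2_eq_iff mult2_nth hecke_T_eq)
    then show ?thesis using 1 hecke_normal_T_right hecke_normal_uminus by simp
  next
    case (step w' j)
    have e: "?S ** w = (?S ** hecke_V p j) ** w'"
      by (simp add: step matrix_mul_assoc)
    show ?thesis
    proof (cases "j = 1")
      case True
      then show ?thesis unfolding e Sinv_V[OF step(3,4)]
        using step by (auto intro!: hecke_half_normal hecke_pos_half)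
    next
      case False
      have "hecke_T ** (hecke_V p (j - 1) ** w') \<in> hecke_normal p"
        using step False by (intro hecke_half_normal hecke_pos_half hecke_pos.step) auto
      then show ?thesis unfolding e Sinv_V[OF step(3,4)]
        using False by (simp add: matrix_mul_assoc)
    qed
  qed
  show ?thesis using w(2) 1 2 hecke_normal_uminus[OF 1] hecke_normal_uminus[OF 2] by (metis uminus_mult2(2))
qed

text \<open>M and its inverse are treated together because the group is generated with inverses of
  arbitrary elements; quantifying over all normal words lets products follow by composition.\<close>

lemma hecke_group_normal_aux:
  assumes "M \<in> hecke_group p"
  shows "\<forall>X\<in>hecke_normal p. M ** X \<in> hecke_normal p \<and> matrix_inv M ** X \<in> hecke_normal p"
  using assms
proof (induction rule: hecke_group.induct)
  case gen_S
  have inv: "matrix_inv (hecke_S p) = mat2 1 (- hecke_lambda p) 0 1"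
    by (subst matrix_inv_mat2) (simp_all add: hecke_S_eq det_2)
  show ?case
  proof
    fix X assume "X \<in> hecke_normal p"
    then obtain Y where Y: "Y \<in> hecke_half p" "X = Y \<or> X = Y ** hecke_T"
      by (auto simp: hecke_normal_def)
    then show "hecke_S p ** X \<in> hecke_normal p \<and> matrix_inv (hecke_S p) ** X \<in> hecke_normal p"
      unfolding inv using S_half[OF Y(1)] Sinv_half[OF Y(1)]
      by (auto simp: matrix_mul_assoc intro: hecke_normal_T_right)
  qed
next
  case gen_T
  have "matrix_inv hecke_T = - hecke_T"
    by (subst matrix_inv_mat2) (simp_all add: hecke_T_eq det_2 mat2_eq_iff)
  then show ?case
    by (auto simp: uminus_mult2 intro: hecke_normal_T_left hecke_normal_uminus)
next
  case (mult M N)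
  have "matrix_inv (M ** N) = matrix_inv N ** matrix_inv M"
    using mult.hyps[THEN det_hecke_group]
    by (simp add: matrix_inv_mat2 det_mul mat2_eq_iff mult2_nth algebra_simps)
  then show ?case using mult.IH by (simp add: matrix_mul_assoc[symmetric])
next
  case (inv M)
  have "matrix_inv (matrix_inv M) = M"
    using inv.hyps[THEN det_hecke_group]
    by (simp add: matrix_inv_mat2[OF det_matrix_inv2] mat2_eq_iff) (simp add: matrix_inv_mat2)
  then show ?case using inv.IH by simp
qed

text \<open>Applied to the identity, the preceding lemma makes every element a normal word. Factors
  T and signs only permute entries and change their signs.\<close>

theorem hecke_group_entries:
  assumes "M \<in> hecke_group p"
  shows "M $ i $ j = 0 \<or> \<bar>M $ i $ j\<bar> \<ge> 1"
proof -
  have "mat 1 \<in> hecke_normal p"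
    by (intro hecke_half_normal hecke_pos_half hecke_pos.one)
  with hecke_group_normal_aux[OF assms] have "M ** mat 1 \<in> hecke_normal p" by blast
  then show ?thesis using hecke_normal_entries by simp
qed

end

section \<open>Hyperbolic elements and their forms\<close>

lemma inv_mult2:
  fixes M N :: "real^2^2"
  assumes "det M = 1"
  shows "matrix_inv M ** M = mat 1" "M ** matrix_inv M = mat 1"
    "matrix_inv M ** (M ** N) = N" "M ** (matrix_inv M ** N) = N"
    "N ** M ** matrix_inv M = N" "N ** matrix_inv M ** M = N"
proof -
  show 1: "matrix_inv M ** M = mat 1" and 2: "M ** matrix_inv M = mat 1"
    using assms by (auto simp: matrix_inv_mat2 mat2_eq_iff mult2_nth det_2 algebra_simps)
  show "matrix_inv M ** (M ** N) = N" "M ** (matrix_inv M ** N) = N"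
    using 1 2 by (simp_all add: matrix_mul_assoc)
  show "N ** M ** matrix_inv M = N" "N ** matrix_inv M ** M = N"
    using 1 2 by (simp_all add: matrix_mul_assoc[symmetric])
qed

text \<open>At a fixed point x the vector (x, 1) is an eigenvector of M and this automorphy factor
  is its eigenvalue, hence multiplicative in M.\<close>

definition cocycle :: "real^2^2 \<Rightarrow> real \<Rightarrow> real" where
  "cocycle M x = M$2$1 * x + M$2$2"

lemma fixes_point_iff:
  assumes "det M = 1"
  shows "fixes_point M x \<longleftrightarrow> M$1$1 * x + M$1$2 = x * cocycle M x"
proof
  assume "fixes_point M x"
  then show "M$1$1 * x + M$1$2 = x * cocycle M x"
    by (auto simp: fixes_point_def cocycle_def field_simps)
next
  assume e: "M$1$1 * x + M$1$2 = x * cocycle M x"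
  have "M$2$1 * x + M$2$2 \<noteq> 0"
  proof
    assume z: "M$2$1 * x + M$2$2 = 0"
    then have "M$1$1 * x + M$1$2 = 0" using e by (simp add: cocycle_def)
    moreover have "det M = M$1$1 * (M$2$1 * x + M$2$2) - M$2$1 * (M$1$1 * x + M$1$2)"
      by (simp add: det_2 algebra_simps)
    ultimately show False using z assms by simp
  qed
  then show "fixes_point M x" using e by (auto simp: fixes_point_def cocycle_def field_simps)
qed

text \<open>The second factor is the trace minus \<open>cocycle M x\<close>, that is, the other
  eigenvalue; the product of the two is the determinant.\<close>

lemma cocycle_conj:
  assumes "det M = 1" "fixes_point M x"
  shows "cocycle M x * (M$1$1 - M$2$1 * x) = 1"
proof -
  have "M$1$1 * x + M$1$2 = x * (M$2$1 * x + M$2$2)" using assms by (simp add: fixes_point_iff cocycle_def)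
  then have b: "M$1$2 = x * (M$2$1 * x + M$2$2) - M$1$1 * x" by simp
  have "M$1$1 * M$2$2 - M$1$2 * M$2$1 = 1" using assms by (simp add: det_2)
  then show ?thesis unfolding b cocycle_def by (simp add: algebra_simps)
qed

lemma cocycle_nz: "det M = 1 \<Longrightarrow> fixes_point M x \<Longrightarrow> cocycle M x \<noteq> 0"
  using cocycle_conj by fastforce

lemma fixes_mult:
  assumes "det M = 1" "det N = 1" "fixes_point M x" "fixes_point N x"
  shows "fixes_point (M ** N) x" "cocycle (M ** N) x = cocycle M x * cocycle N x"
proof -
  have M: "M$1$1 * x + M$1$2 = x * cocycle M x" and N: "N$1$1 * x + N$1$2 = x * cocycle N x"
    using assms by (simp_all add: fixes_point_iff)
  have "cocycle (M ** N) x = M$2$1 * (N$1$1 * x + N$1$2) + M$2$2 * cocycle N x"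
    by (simp add: cocycle_def mult2_nth algebra_simps)
  also have "\<dots> = cocycle M x * cocycle N x" unfolding N by (simp add: cocycle_def algebra_simps)
  finally show c: "cocycle (M ** N) x = cocycle M x * cocycle N x" .
  have "(M ** N)$1$1 * x + (M ** N)$1$2 = M$1$1 * (N$1$1 * x + N$1$2) + M$1$2 * cocycle N x"
    by (simp add: cocycle_def mult2_nth algebra_simps)
  also have "\<dots> = (M$1$1 * x + M$1$2) * cocycle N x" unfolding N by (simp add: algebra_simps)
  also have "\<dots> = x * cocycle (M ** N) x" unfolding M c by simp
  finally show "fixes_point (M ** N) x"
    using assms by (simp add: fixes_point_iff det_mul)
qed

lemma fixes_inv:
  assumes "det M = 1" "fixes_point M x"
  shows "fixes_point (matrix_inv M) x" "cocycle (matrix_inv M) x = 1 / cocycle M x"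
proof -
  have c: "cocycle (matrix_inv M) x = M$1$1 - M$2$1 * x"
    using assms by (simp add: cocycle_def matrix_inv_mat2)
  then show "cocycle (matrix_inv M) x = 1 / cocycle M x"
    using cocycle_conj[OF assms] cocycle_nz[OF assms] by (metis mult.commute nonzero_eq_divide_eq)
  have "M$1$1 * x + M$1$2 = x * (M$2$1 * x + M$2$2)" using assms by (simp add: fixes_point_iff cocycle_def)
  then show "fixes_point (matrix_inv M) x"
    using assms by (simp add: fixes_point_iff det_matrix_inv2 c) (simp add: matrix_inv_mat2 algebra_simps)
qed

lemma fixes_uminus:
  assumes "fixes_point M x"
  shows "fixes_point (- M) x" "cocycle (- M) x = - cocycle M x"
proof -
  have "(- (M$1$1) * x - M$1$2) / (- (M$2$1) * x - M$2$2) = (M$1$1 * x + M$1$2) / (M$2$1 * x + M$2$2)"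
    by (metis (no_types) minus_add_distrib minus_divide_divide mult_minus_left uminus_add_conv_diff add.commute)
  then show "fixes_point (- M) x" using assms by (auto simp: fixes_point_def)
qed (simp add: cocycle_def)

lemma mat_power_0: "mat_power N 0 = mat 1" and mat_power_Suc: "mat_power N (Suc n) = N ** mat_power N n"
  by (simp_all add: mat_power_def)

lemma det_mat_power: "det N = 1 \<Longrightarrow> det (mat_power N n) = 1"
  by (induction n) (simp_all add: mat_power_0 mat_power_Suc det_mul)

lemma mat_power_fixes:
  assumes "det N = 1" "fixes_point N x"
  shows "fixes_point (mat_power N n) x \<and> cocycle (mat_power N n) x = cocycle N x ^ n"
proof (induction n)
  case 0
  then show ?case by (simp add: mat_power_0 fixes_point_def cocycle_def)
next
  case (Suc n)
  then show ?case using fixes_mult[OF assms(1) det_mat_power[OF assms(1)] assms(2), of n]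
    by (simp add: mat_power_Suc)
qed

text \<open>This is Cayley-Hamilton, N^2 = (tr N) N - I. Where u \<noteq> 0, a fixed point of the
  power is a fixed point of N, and so roots of a stabilizing element stabilize too.\<close>

lemma mat_power_linear:
  assumes "det N = 1"
  shows "\<exists>u v. mat_power N n = mat2 (u * N$1$1 + v) (u * N$1$2) (u * N$2$1) (u * N$2$2 + v)"
proof (induction n)
  case 0
  show ?case by (rule exI[of _ 0], rule exI[of _ 1]) (simp add: mat_power_0 mat2_eq_iff)
next
  case (Suc n)
  then obtain u v where uv: "mat_power N n = mat2 (u * N$1$1 + v) (u * N$1$2) (u * N$2$1) (u * N$2$2 + v)"
    by blast
  have d: "N$1$2 * N$2$1 = N$1$1 * N$2$2 - 1" using assms by (simp add: det_2)
  have d': "u * (N$1$2 * N$2$1) = u * (N$1$1 * N$2$2) - u" by (simp add: d right_diff_distrib)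
  show ?case
    by (rule exI[of _ "u * (N$1$1 + N$2$2) + v"], rule exI[of _ "- u"])
       (simp add: mat_power_Suc uv mat2_eq_iff mult2_nth algebra_simps d')
qed

lemma mat_power_conj:
  assumes "det V = 1"
  shows "V ** mat_power N n ** matrix_inv V = mat_power (V ** N ** matrix_inv V) n"
proof (induction n)
  case 0
  then show ?case using inv_mult2[OF assms] by (simp add: mat_power_0)
next
  case (Suc n)
  have "mat_power (V ** N ** matrix_inv V) (Suc n) = V ** N ** matrix_inv V ** (V ** mat_power N n ** matrix_inv V)"
    by (simp add: mat_power_Suc Suc)
  also have "\<dots> = V ** N ** (matrix_inv V ** (V ** (mat_power N n ** matrix_inv V)))"
    by (simp only: matrix_mul_assoc)
  also have "\<dots> = V ** mat_power N (Suc n) ** matrix_inv V"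
    unfolding inv_mult2[OF assms] mat_power_Suc by (simp only: matrix_mul_assoc)
  finally show ?case by simp
qed

lemma hecke_uminus: "M \<in> hecke_group p \<Longrightarrow> - M \<in> hecke_group p"
proof -
  assume "M \<in> hecke_group p"
  then have "hecke_T ** (hecke_T ** M) \<in> hecke_group p"
    by (intro hecke_group.mult hecke_group.gen_T)
  then show ?thesis by (simp add: T_T_mult)
qed

lemma hecke_one: "mat 1 \<in> hecke_group p"
proof -
  have "matrix_inv hecke_T ** hecke_T \<in> hecke_group p"
    by (intro hecke_group.mult hecke_group.gen_T hecke_group.inv)
  then show ?thesis using inv_mult2(1)[of hecke_T] by (simp add: hecke_T_eq det_2)
qed

lemma hecke_mat_power: "M \<in> hecke_group p \<Longrightarrow> mat_power M n \<in> hecke_group p"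
  by (induction n) (auto simp: mat_power_0 mat_power_Suc intro: hecke_one hecke_group.mult)

text \<open>Fixed points are roots of c x^2 + (d - a) x - b, whence the sum. The second identity is
  the difference of the two eigenvalues; with |c| \<ge> 1 it will keep multipliers away from
  1.\<close>

lemma two_fixed_points:
  assumes d: "det N = 1" and "fixes_point N \<alpha>" "fixes_point N \<beta>" "\<alpha> \<noteq> \<beta>"
  shows "N$2$1 * (\<alpha> + \<beta>) = N$1$1 - N$2$2"
    and "N$2$1 * (\<alpha> - \<beta>) = cocycle N \<alpha> - 1 / cocycle N \<alpha>"
proof -
  have "N$1$1 * \<alpha> + N$1$2 = \<alpha> * cocycle N \<alpha>" "N$1$1 * \<beta> + N$1$2 = \<beta> * cocycle N \<beta>"
    using assms by (simp_all add: fixes_point_iff)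
  then have "(\<alpha> - \<beta>) * (N$2$1 * (\<alpha> + \<beta>) - (N$1$1 - N$2$2)) = 0"
    by (simp add: cocycle_def algebra_simps)
  then show 1: "N$2$1 * (\<alpha> + \<beta>) = N$1$1 - N$2$2" using assms(4) by simp
  have "1 / cocycle N \<alpha> = N$1$1 - N$2$1 * \<alpha>"
    using cocycle_conj[OF d assms(2)] cocycle_nz[OF d assms(2)] by (simp add: field_simps)
  then show "N$2$1 * (\<alpha> - \<beta>) = cocycle N \<alpha> - 1 / cocycle N \<alpha>"
    using 1 by (simp add: cocycle_def algebra_simps)
qed

text \<open>Two eigenlines and one eigenvalue determine a matrix of determinant 1.\<close>

lemma stabilizer_inj:
  assumes "det M = 1" "det N = 1" "fixes_point M \<alpha>" "fixes_point M \<beta>" "fixes_point N \<alpha>" "fixes_point N \<beta>"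
    "\<alpha> \<noteq> \<beta>" and e: "cocycle M \<alpha> = cocycle N \<alpha>"
  shows "M = N"
proof -
  have c: "M$2$1 = N$2$1"
    using two_fixed_points(2)[OF assms(1,3,4,7)] two_fixed_points(2)[OF assms(2,5,6,7)] e assms(7)
    by (metis eq_iff_diff_eq_0 mult_right_cancel)
  have d: "M$2$2 = N$2$2" using e c by (simp add: cocycle_def)
  have a: "M$1$1 = N$1$1"
    using two_fixed_points(1)[OF assms(1,3,4,7)] two_fixed_points(1)[OF assms(2,5,6,7)] c d by simp
  have "M$1$2 = N$1$2" using assms(1,2,3,5) e a by (simp add: fixes_point_iff)
  then show ?thesis using a c d by (simp add: mat2_eq_iff)
qed

text \<open>\<open>hyp_form\<close> is this form for \<open>hyp_matrix\<close>. Passing to matrices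
  turns the action on forms into conjugation.\<close>

definition mat_form :: "real^2^2 \<Rightarrow> bqf" where
  "mat_form M = (M$2$1, M$2$2 - M$1$1, - (M$1$2))"

lemma bqf_act_mult: "bqf_act (bqf_act Q M) N = bqf_act Q (M ** N)"
  by (cases Q) (simp add: bqf_act_def Let_def mult2_nth power2_eq_square algebra_simps)

lemma bqf_act_mat_form:
  assumes "det V = 1"
  shows "bqf_act (mat_form M) V = mat_form (matrix_inv V ** M ** V)"
  unfolding mat_form_def matrix_inv_mat2[OF assms] mult2_nth mat2_nth bqf_act_def Let_def
  by (simp add: power2_eq_square algebra_simps)

context
  fixes p :: nat
  assumes p: "p \<ge> 3"
begin

text \<open>If c = 0, the diagonal entries have product 1 and, by
  \<open>hecke_group_entries\<close>, absolute value at least 1; the trace is then at most 2 in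
  absolute value.\<close>

lemma hyperbolic_c_nz:
  assumes "hyperbolic_elt p M"
  shows "M$2$1 \<noteq> 0"
proof
  assume c: "M$2$1 = 0"
  have M: "M \<in> hecke_group p" and tr: "\<bar>M$1$1 + M$2$2\<bar> > 2"
    using assms by (auto simp: hyperbolic_elt_def trace2)
  have ad: "M$1$1 * M$2$2 = 1" using det_hecke_group[OF M] c by (simp add: det_2)
  have "M$1$1 = 0 \<or> \<bar>M$1$1\<bar> \<ge> 1" "M$2$2 = 0 \<or> \<bar>M$2$2\<bar> \<ge> 1"
    using hecke_group_entries[OF p M] by blast+
  then have a1: "\<bar>M$1$1\<bar> \<ge> 1" "\<bar>M$2$2\<bar> \<ge> 1" using ad by auto
  have "\<bar>M$1$1\<bar> * \<bar>M$2$2\<bar> = 1" using ad by (metis abs_mult abs_one)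
  then have "\<bar>M$1$1\<bar> \<le> 1" "\<bar>M$2$2\<bar> \<le> 1"
    using a1 mult_left_mono[of 1 "\<bar>M$2$2\<bar>" "\<bar>M$1$1\<bar>"] mult_right_mono[of 1 "\<bar>M$1$1\<bar>" "\<bar>M$2$2\<bar>"] by auto
  then show False using tr by linarith
qed

lemma hyperbolic_cocycle:
  assumes "hyperbolic_elt p M" "fixes_point M x"
  shows "\<bar>cocycle M x\<bar> \<noteq> 1"
proof
  assume 1: "\<bar>cocycle M x\<bar> = 1"
  have M: "det M = 1" "\<bar>M$1$1 + M$2$2\<bar> > 2" using assms(1) det_hecke_group by (auto simp: hyperbolic_elt_def trace2)
  have "cocycle M x * (M$1$1 - M$2$1 * x) = 1" by (rule cocycle_conj[OF M(1) assms(2)])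
  moreover have "cocycle M x = 1 \<or> cocycle M x = -1" using 1 by linarith
  ultimately have "M$1$1 - M$2$1 * x = cocycle M x" by auto
  then have "M$1$1 + M$2$2 = 2 * cocycle M x" by (simp add: cocycle_def)
  then show False using M(2) 1 by linarith
qed

text \<open>Conjugating a parabolic element by a hyperbolic one with the same fixed point produces arbitrarily small
  nonzero lower left entries.\<close>
lemma no_common_parabolic:
  assumes Z: "Z \<in> hecke_group p" "fixes_point Z \<alpha>" "\<bar>cocycle Z \<alpha>\<bar> > 1"
    and X: "X \<in> hecke_group p" "fixes_point X \<alpha>" "cocycle X \<alpha> = 1"
  shows "X$2$1 = 0"
proof (rule ccontr)
  assume nz: "X$2$1 \<noteq> 0"
  define \<mu> where "\<mu> = cocycle Z \<alpha>"
  have mu: "\<mu>\<^sup>2 > 1" using Z(3) by (metis \<mu>_def one_less_power pos2 power2_abs)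
  have mu0: "\<mu> \<noteq> 0" using Z(3) by (auto simp: \<mu>_def)
  have zz: "Z$1$1 - Z$2$1 * \<alpha> = 1 / \<mu>"
    using cocycle_conj[OF det_hecke_group[OF Z(1)] Z(2)] mu0 by (simp add: \<mu>_def field_simps)
  have "\<exists>Y\<in>hecke_group p. fixes_point Y \<alpha> \<and> cocycle Y \<alpha> = 1 \<and> Y$2$1 = X$2$1 / (\<mu>\<^sup>2) ^ n" for n
  proof (induction n)
    case 0 then show ?case using X by auto
  next
    case (Suc n)
    then obtain Y where Y: "Y \<in> hecke_group p" "fixes_point Y \<alpha>" "cocycle Y \<alpha> = 1" "Y$2$1 = X$2$1 / (\<mu>\<^sup>2) ^ n"
      by blast
    define W where "W = matrix_inv Z ** (Y ** Z)"
    note dets = det_hecke_group[OF Z(1)] det_hecke_group[OF Y(1)] det_matrix_inv2[OF det_hecke_group[OF Z(1)]]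
    have YZ: "det (Y ** Z) = 1" using dets by (simp add: det_mul)
    have W: "W \<in> hecke_group p" unfolding W_def by (intro hecke_group.mult hecke_group.inv Z Y)
    have fx: "fixes_point W \<alpha>" "cocycle W \<alpha> = 1"
      unfolding W_def using fixes_mult[OF dets(3) YZ fixes_inv(1)[OF dets(1) Z(2)] fixes_mult(1)[OF dets(2,1) Y(2) Z(2)]]
        fixes_mult(2)[OF dets(2,1) Y(2) Z(2)] fixes_inv(2)[OF dets(1) Z(2)] Y(3) mu0 by (simp_all add: \<mu>_def)
    define t where "t = Y$2$1"
    have d: "Y$2$2 = 1 - t * \<alpha>" using Y(3) by (simp add: cocycle_def t_def)
    have a: "Y$1$1 = 1 + t * \<alpha>" using cocycle_conj[OF dets(2) Y(2)] Y(3) by (simp add: t_def)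
    have b: "Y$1$2 = - t * \<alpha>\<^sup>2"
      using Y(2) dets(2) Y(3) by (simp add: fixes_point_iff a power2_eq_square algebra_simps)
    have "W$2$1 = t * (Z$1$1 - Z$2$1 * \<alpha>)\<^sup>2"
      unfolding W_def mult2_nth matrix_inv_mat2[OF dets(1)] mat2_nth a b d t_def[symmetric]
      by (simp add: power2_eq_square algebra_simps)
    also have "\<dots> = X$2$1 / (\<mu>\<^sup>2) ^ Suc n" unfolding zz t_def Y(4) by (simp add: power_divide)
    finally show ?case using W fx by blast
  qed note ex = this
  obtain n where n: "\<bar>X$2$1\<bar> < (\<mu>\<^sup>2) ^ n" using real_arch_pow[OF mu] by blast
  obtain Y where Y: "Y \<in> hecke_group p" "Y$2$1 = X$2$1 / (\<mu>\<^sup>2) ^ n" using ex[of n] by blast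
  have "\<bar>Y$2$1\<bar> < 1" using n mu by (simp add: Y(2) field_simps)
  moreover have "Y$2$1 \<noteq> 0" using nz mu0 by (simp add: Y(2))
  ultimately show False using hecke_group_entries[OF p Y(1), of 2 1] by linarith
qed

text \<open>The commutator of N and the inverse of M has multiplier 1 at \<alpha>. By
  \<open>no_common_parabolic\<close> its lower left entry vanishes, and a matrix that fixes \<alpha>
  with multiplier 1 and c = 0 is the identity.\<close>

lemma stabilizer_commutes:
  assumes M: "hyperbolic_elt p M" "fixes_point M \<alpha>" and N: "N \<in> hecke_group p" "fixes_point N \<alpha>"
  shows "M ** N = N ** M"
proof -
  have MG: "M \<in> hecke_group p" using M by (simp add: hyperbolic_elt_def)
  note dM = det_hecke_group[OF MG] and dN = det_hecke_group[OF N(1)]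
  note diM = det_matrix_inv2[OF dM] and diN = det_matrix_inv2[OF dN]
  \<comment> \<open>\<open>no_common_parabolic\<close> needs a multiplier of absolute value above 1,
    which M or its inverse has.\<close>
  obtain Z where Z: "Z \<in> hecke_group p" "fixes_point Z \<alpha>" "\<bar>cocycle Z \<alpha>\<bar> > 1"
  proof (cases "\<bar>cocycle M \<alpha>\<bar> > 1")
    case True then show ?thesis using that MG M by blast
  next
    case False
    then have "\<bar>cocycle M \<alpha>\<bar> < 1" using hyperbolic_cocycle[OF M] by linarith
    then have "\<bar>cocycle (matrix_inv M) \<alpha>\<bar> > 1"
      unfolding fixes_inv(2)[OF dM M(2)] using cocycle_nz[OF dM M(2)] by simp
    then show ?thesis using that hecke_group.inv[OF MG] fixes_inv(1)[OF dM M(2)] by blast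
  qed
  define A where "A = N ** matrix_inv M"
  define B where "B = matrix_inv N ** M"
  have AB: "A \<in> hecke_group p" "B \<in> hecke_group p"
    unfolding A_def B_def by (intro hecke_group.mult hecke_group.inv N MG)+
  have fA: "fixes_point A \<alpha>" "cocycle A \<alpha> = cocycle N \<alpha> * (1 / cocycle M \<alpha>)"
    unfolding A_def using fixes_mult[OF dN diM N(2) fixes_inv(1)[OF dM M(2)]] fixes_inv(2)[OF dM M(2)] by simp_all
  have fB: "fixes_point B \<alpha>" "cocycle B \<alpha> = (1 / cocycle N \<alpha>) * cocycle M \<alpha>"
    unfolding B_def using fixes_mult[OF diN dM fixes_inv(1)[OF dN N(2)] M(2)] fixes_inv(2)[OF dN N(2)] by simp_all
  define X where "X = A ** B"
  have X: "X \<in> hecke_group p" unfolding X_def by (rule hecke_group.mult[OF AB])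
  have fX: "fixes_point X \<alpha>" "cocycle X \<alpha> = 1"
    unfolding X_def using fixes_mult[OF det_hecke_group[OF AB(1)] det_hecke_group[OF AB(2)] fA(1) fB(1)] fA(2) fB(2)
      cocycle_nz[OF dM M(2)] cocycle_nz[OF dN N(2)] by simp_all
  have c: "X$2$1 = 0" by (rule no_common_parabolic[OF Z X fX])
  have d: "X$2$2 = 1" using fX(2) c by (simp add: cocycle_def)
  have a: "X$1$1 = 1" using cocycle_conj[OF det_hecke_group[OF X] fX(1)] fX(2) c by simp
  have b: "X$1$2 = 0" using fX det_hecke_group[OF X] a by (simp add: fixes_point_iff)
  have "X = mat 1" using a b c d by (simp add: mat2_eq_iff)
  then have "N ** matrix_inv M ** matrix_inv N ** M = mat 1"
    by (simp add: X_def A_def B_def matrix_mul_assoc)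
  then have "N ** matrix_inv M ** matrix_inv N ** M ** matrix_inv M ** N ** M = matrix_inv M ** N ** M"
    by (simp add: matrix_mul_lid)
  then have "N = matrix_inv M ** N ** M"
    unfolding inv_mult2(5)[OF dM] inv_mult2(6)[OF dN] inv_mult2(6)[OF dM] .
  then have "M ** N = M ** (matrix_inv M ** (N ** M))" by (simp only: matrix_mul_assoc)
  then show ?thesis unfolding inv_mult2(4)[OF dM] .
qed

text \<open>Comparing entries of MN = NM makes the fixed point equation of N, multiplied by the
  entry c of M, a multiple of that of M; and c \<noteq> 0 can be cancelled.\<close>

lemma stabilizer_fixes_conj:
  assumes M: "hyperbolic_elt p M" "fixes_point M \<alpha>" and N: "N \<in> hecke_group p" "fixes_point N \<alpha>"
    and \<beta>: "fixes_point M \<beta>"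
  shows "fixes_point N \<beta>"
proof -
  have MG: "M \<in> hecke_group p" using M by (simp add: hyperbolic_elt_def)
  have e: "M ** N = N ** M" by (rule stabilizer_commutes[OF M N])
  have 1: "M$1$2 * N$2$1 = N$1$2 * M$2$1"
    using arg_cong[OF e, of "\<lambda>X. X$1$1"] by (simp add: mult2_nth)
  have 2: "M$2$1 * (N$1$1 - N$2$2) = N$2$1 * (M$1$1 - M$2$2)"
    using arg_cong[OF e, of "\<lambda>X. X$2$1"] by (simp add: mult2_nth algebra_simps)
  have q: "M$1$1 * \<beta> + M$1$2 - \<beta> * cocycle M \<beta> = 0"
    using \<beta> det_hecke_group[OF MG] by (simp add: fixes_point_iff)
  have "M$2$1 * (N$1$1 * \<beta> + N$1$2 - \<beta> * cocycle N \<beta>)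
      = M$2$1 * (N$1$1 - N$2$2) * \<beta> + N$1$2 * M$2$1 - M$2$1 * N$2$1 * \<beta> * \<beta>"
    by (simp add: cocycle_def algebra_simps)
  also have "\<dots> = N$2$1 * (M$1$1 * \<beta> + M$1$2 - \<beta> * cocycle M \<beta>)"
    unfolding 2 1[symmetric] by (simp add: cocycle_def algebra_simps)
  finally have "M$2$1 * (N$1$1 * \<beta> + N$1$2 - \<beta> * cocycle N \<beta>) = 0" using q by simp
  then show ?thesis
    using hyperbolic_c_nz[OF M(1)] det_hecke_group[OF N(1)] by (simp add: fixes_point_iff)
qed

text \<open>The property singled out by the definite description in
  \<open>hyp_matrix\<close>.\<close>

definition hyp_generator :: "real \<Rightarrow> real^2^2 \<Rightarrow> bool" where
  "hyp_generator \<alpha> M \<longleftrightarrow> hyperbolic_elt p M \<and> primitive_elt p M \<and> trace M > 0 \<and> M$2$1 \<noteq> 0 \<and>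
     \<alpha> = (M$1$1 - M$2$2 + sqrt ((M$1$1 + M$2$2)\<^sup>2 - 4)) / (2 * M$2$1)"

text \<open>The plus sign of the square root selects the fixed point with multiplier (t + sqrt(t^2 -
  4)) / 2 > 1, where t is the trace. With the converse below, the formula for \<alpha> and the
  condition \<open>cocycle M \<alpha> > 1\<close> become interchangeable.\<close>

lemma attracting_root:
  assumes M: "M \<in> hecke_group p" "trace M > 2" "M$2$1 \<noteq> 0"
    and \<alpha>: "\<alpha> = (M$1$1 - M$2$2 + sqrt ((M$1$1 + M$2$2)\<^sup>2 - 4)) / (2 * M$2$1)"
    and \<beta>: "\<beta> = (M$1$1 - M$2$2 - sqrt ((M$1$1 + M$2$2)\<^sup>2 - 4)) / (2 * M$2$1)"
  shows "fixes_point M \<alpha>" "fixes_point M \<beta>" "cocycle M \<alpha> > 1" "\<alpha> \<noteq> \<beta>"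
proof -
  define r where "r = sqrt ((M$1$1 + M$2$2)\<^sup>2 - 4)"
  have tr: "M$1$1 + M$2$2 > 2" using M(2) by (simp add: trace2)
  then have gt: "(M$1$1 + M$2$2)\<^sup>2 > 2\<^sup>2" by (intro power_strict_mono) auto
  have r: "r > 0" "r\<^sup>2 = (M$1$1 + M$2$2)\<^sup>2 - 4" using gt by (simp_all add: r_def)
  have d: "M$1$1 * M$2$2 - M$1$2 * M$2$1 = 1" using det_hecke_group[OF M(1)] by (simp add: det_2)
  have key: "M$1$1 * x + M$1$2 = x * cocycle M x" if x: "2 * M$2$1 * x = M$1$1 - M$2$2 + s" "s\<^sup>2 = r\<^sup>2" for x s
  proof -
    have "4 * M$2$1 * (x * cocycle M x - (M$1$1 * x + M$1$2))
       = (2 * M$2$1 * x)\<^sup>2 + 2 * (M$2$2 - M$1$1) * (2 * M$2$1 * x) - 4 * (M$1$2 * M$2$1)"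
      by (simp add: cocycle_def power2_eq_square algebra_simps)
    also have "\<dots> = s\<^sup>2 - (M$1$1 - M$2$2)\<^sup>2 - 4 * (M$1$1 * M$2$2 - 1)"
      unfolding x(1) using d by (simp add: power2_eq_square algebra_simps)
    also have "\<dots> = 0" unfolding x(2) r(2) by (simp add: power2_eq_square algebra_simps)
    finally show ?thesis using M(3) by simp
  qed
  have a2: "2 * M$2$1 * \<alpha> = M$1$1 - M$2$2 + r" using M(3) by (simp add: \<alpha> r_def)
  have b2: "2 * M$2$1 * \<beta> = M$1$1 - M$2$2 + (- r)" using M(3) by (simp add: \<beta> r_def)
  show "fixes_point M \<alpha>" "fixes_point M \<beta>"
    using key[OF a2] key[OF b2] det_hecke_group[OF M(1)] by (simp_all add: fixes_point_iff)
  have "2 * cocycle M \<alpha> = M$1$1 + M$2$2 + r" using a2 by (simp add: cocycle_def)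
  then show "cocycle M \<alpha> > 1" using tr r by linarith
  show "\<alpha> \<noteq> \<beta>" using a2 b2 r by auto
qed

lemma attracting_root_converse:
  assumes M: "M \<in> hecke_group p" "fixes_point M \<alpha>" "cocycle M \<alpha> > 1"
  shows "trace M > 2" "M$2$1 \<noteq> 0"
    "\<alpha> = (M$1$1 - M$2$2 + sqrt ((M$1$1 + M$2$2)\<^sup>2 - 4)) / (2 * M$2$1)"
proof -
  define \<epsilon> where "\<epsilon> = cocycle M \<alpha>"
  have eps: "\<epsilon> > 1" using M by (simp add: \<epsilon>_def)
  have i: "M$1$1 - M$2$1 * \<alpha> = 1 / \<epsilon>"
    using cocycle_conj[OF det_hecke_group[OF M(1)] M(2)] eps by (simp add: \<epsilon>_def field_simps)
  have tr: "M$1$1 + M$2$2 = \<epsilon> + 1 / \<epsilon>" using i by (simp add: \<epsilon>_def cocycle_def)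
  have "\<epsilon> + 1 / \<epsilon> - 2 = (\<epsilon> - 1)\<^sup>2 / \<epsilon>" using eps by (simp add: field_simps power2_eq_square)
  also have "\<dots> > 0" using eps by simp
  finally show t: "trace M > 2" using tr by (simp add: trace2)
  then show c: "M$2$1 \<noteq> 0" using M(1) by (intro hyperbolic_c_nz) (simp add: hyperbolic_elt_def)
  have "(M$1$1 + M$2$2)\<^sup>2 - 4 = (\<epsilon> - 1 / \<epsilon>)\<^sup>2" using eps unfolding tr by (simp add: field_simps power2_eq_square)
  moreover have "\<epsilon> - 1 / \<epsilon> \<ge> 0" using eps by (simp add: field_simps) (smt (verit) mult_less_cancel_right2)
  ultimately have "sqrt ((M$1$1 + M$2$2)\<^sup>2 - 4) = \<epsilon> - 1 / \<epsilon>" by simp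
  then show "\<alpha> = (M$1$1 - M$2$2 + sqrt ((M$1$1 + M$2$2)\<^sup>2 - 4)) / (2 * M$2$1)"
    using c i by (simp add: field_simps \<epsilon>_def cocycle_def)
qed

text \<open>If x > y are multipliers above 1, so is x/y, and all of them exceed 1 by at least half
  the distance of the two fixed points. Distinct multipliers thus have ratio bounded away from 1,
  and the infimum is attained.\<close>

lemma stabilizer_generator:
  assumes "hyperbolic_fixed_point p \<alpha>"
  obtains \<beta> N where "\<alpha> \<noteq> \<beta>" "\<And>M. M \<in> hecke_stabilizer p \<alpha> \<Longrightarrow> fixes_point M \<beta>"
    "N \<in> hecke_stabilizer p \<alpha>" "cocycle N \<alpha> > 1"
    "\<And>M. M \<in> hecke_stabilizer p \<alpha> \<Longrightarrow> cocycle M \<alpha> > 1 \<Longrightarrow> cocycle N \<alpha> \<le> cocycle M \<alpha>"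
proof -
  let ?G = "hecke_stabilizer p \<alpha>"
  have GD: "M \<in> hecke_group p" "fixes_point M \<alpha>" "det M = 1" if "M \<in> ?G" for M
    using that det_hecke_group by (auto simp: hecke_stabilizer_def)
  have G_mult: "M ** N \<in> ?G" and G_inv: "matrix_inv M \<in> ?G" and G_neg: "- M \<in> ?G"
    if "M \<in> ?G" "N \<in> ?G" for M N
    using GD[OF that(1)] GD[OF that(2)] fixes_mult(1)[of M N] fixes_inv(1)[of M] fixes_uminus(1)[of M \<alpha>]
    by (auto simp: hecke_stabilizer_def intro: hecke_group.mult hecke_group.inv hecke_uminus)
  obtain M1 where M1: "hyperbolic_elt p M1" "fixes_point M1 \<alpha>"
    using assms by (auto simp: hyperbolic_fixed_point_def)
  have M1G: "M1 \<in> ?G" using M1 by (auto simp: hecke_stabilizer_def hyperbolic_elt_def)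
  define E where "E = {\<epsilon>. \<epsilon> > 1 \<and> (\<exists>M\<in>?G. cocycle M \<alpha> = \<epsilon>)}"
  have "E \<noteq> {}"
  proof -
    obtain M2 where M2: "M2 \<in> ?G" "\<bar>cocycle M2 \<alpha>\<bar> > 1"
    proof (cases "\<bar>cocycle M1 \<alpha>\<bar> > 1")
      case True then show ?thesis using that M1G by blast
    next
      case False
      then have "\<bar>cocycle M1 \<alpha>\<bar> < 1" using hyperbolic_cocycle[OF M1] by linarith
      then have "\<bar>cocycle (matrix_inv M1) \<alpha>\<bar> > 1"
        unfolding fixes_inv(2)[OF GD(3)[OF M1G] M1(2)] using cocycle_nz[OF GD(3)[OF M1G] M1(2)] by simp
      then show ?thesis using that G_inv[OF M1G M1G] by blast
    qed
    then have "cocycle M2 \<alpha> \<in> E \<or> cocycle (- M2) \<alpha> \<in> E"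
      using G_neg[OF M2(1) M2(1)] fixes_uminus(2)[OF GD(2)[OF M2(1)]] unfolding E_def by fastforce
    then show ?thesis by blast
  qed
  then obtain N0 where N0: "N0 \<in> ?G" "cocycle N0 \<alpha> > 1" by (auto simp: E_def)
  note r0 = attracting_root_converse[OF GD(1,2)[OF N0(1)] N0(2)]
  define \<beta> where "\<beta> = (N0$1$1 - N0$2$2 - sqrt ((N0$1$1 + N0$2$2)\<^sup>2 - 4)) / (2 * N0$2$1)"
  note r1 = attracting_root[OF GD(1)[OF N0(1)] r0 \<beta>_def]
  have N0h: "hyperbolic_elt p N0" using r0(1) GD(1)[OF N0(1)] by (simp add: hyperbolic_elt_def)
  have fb: "fixes_point M \<beta>" if "M \<in> ?G" for M
    using stabilizer_fixes_conj[OF N0h GD(2)[OF N0(1)] GD(1,2)[OF that] r1(2)] .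
  define \<delta> where "\<delta> = \<bar>\<alpha> - \<beta>\<bar>"
  have \<delta>: "\<delta> > 0" using r1(4) by (simp add: \<delta>_def)
  \<comment> \<open>|c| \<ge> 1 gives |\<alpha> - \<beta>| \<le> \<epsilon> - 1/\<epsilon> =
    (\<epsilon> - 1)(\<epsilon> + 1)/\<epsilon> \<le> 2(\<epsilon> - 1).\<close>
  have gap: "\<epsilon> \<ge> 1 + \<delta> / 2" if eE: "\<epsilon> \<in> E" for \<epsilon>
  proof -
    obtain M where M: "M \<in> ?G" "cocycle M \<alpha> = \<epsilon>" "\<epsilon> > 1" using eE by (auto simp: E_def)
    have e: "M$2$1 * (\<alpha> - \<beta>) = \<epsilon> - 1 / \<epsilon>"
      using two_fixed_points(2)[OF GD(3)[OF M(1)] GD(2)[OF M(1)] fb[OF M(1)] r1(4)] M(2) by simp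
    have c: "M$2$1 \<noteq> 0" using attracting_root_converse(2)[OF GD(1,2)[OF M(1)]] M by simp
    then have "\<bar>M$2$1\<bar> \<ge> 1" using hecke_group_entries[OF p GD(1)[OF M(1)], of 2 1] by blast
    then have "1 * \<delta> \<le> \<bar>M$2$1\<bar> * \<bar>\<alpha> - \<beta>\<bar>" unfolding \<delta>_def by (intro mult_right_mono) auto
    also have "\<dots> = \<bar>\<epsilon> - 1 / \<epsilon>\<bar>" using e by (metis abs_mult)
    also have "\<dots> = \<epsilon> - 1 / \<epsilon>"
    proof -
      have "1 / \<epsilon> \<le> 1" using M(3) by simp
      then show ?thesis using M(3) by linarith
    qed
    also have "\<dots> = (\<epsilon> - 1) * ((\<epsilon> + 1) / \<epsilon>)" using M(3) by (simp add: field_simps)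
    also have "\<dots> \<le> (\<epsilon> - 1) * 2" using M(3) by (intro mult_left_mono) (auto simp: field_simps)
    finally show ?thesis by simp
  qed
  have quot: "x / y \<in> E" if xy: "x \<in> E" "y \<in> E" "y < x" for x y
  proof -
    obtain M N where M: "M \<in> ?G" "cocycle M \<alpha> = x" and N: "N \<in> ?G" "cocycle N \<alpha> = y"
      using xy by (auto simp: E_def)
    have "cocycle (M ** matrix_inv N) \<alpha> = x / y"
      using fixes_mult(2)[OF GD(3)[OF M(1)] GD(3)[OF G_inv[OF N(1) N(1)]] GD(2)[OF M(1)] GD(2)[OF G_inv[OF N(1) N(1)]]]
        fixes_inv(2)[OF GD(3)[OF N(1)] GD(2)[OF N(1)]] M N by simp
    moreover have "x / y > 1" using xy by (simp add: E_def)
    ultimately show ?thesis using G_mult[OF M(1) G_inv[OF N(1) N(1)]] by (auto simp: E_def)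
  qed
  have bdd: "bdd_below E" by (rule bdd_belowI[of _ 1]) (auto simp: E_def)
  define m where "m = Inf E"
  have m1: "m \<ge> 1" unfolding m_def using \<open>E \<noteq> {}\<close> by (intro cInf_greatest) (auto simp: E_def)
  \<comment> \<open>An element of \<open>E\<close> below this bound is its minimum: a smaller one
    would produce a quotient below 1 + \<delta>/2.\<close>
  have "m < m * (1 + \<delta> / 2)" using m1 \<delta> by simp
  then obtain x where x: "x \<in> E" "x < m * (1 + \<delta> / 2)"
    unfolding m_def using \<open>E \<noteq> {}\<close> cInf_lessD by blast
  have min: "x \<le> y" if "y \<in> E" for y
  proof (rule ccontr)
    assume "\<not> x \<le> y"
    then have "x / y \<ge> 1 + \<delta> / 2" using gap[OF quot[OF x(1) that]] by simp
    moreover have y: "y \<ge> m" unfolding m_def using bdd that by (rule cInf_lower[rotated])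
    ultimately have "x \<ge> (1 + \<delta> / 2) * y" using m1 by (simp add: field_simps)
    also have "(1 + \<delta> / 2) * y \<ge> (1 + \<delta> / 2) * m" using y \<delta> by (intro mult_left_mono) auto
    finally show False using x(2) by (simp add: mult.commute)
  qed
  obtain N where N: "N \<in> ?G" "cocycle N \<alpha> = x" "x > 1" using x(1) by (auto simp: E_def)
  show ?thesis
    by (rule that[of \<beta> N]) (use r1(4) fb N min in \<open>auto simp: E_def\<close>)
qed

text \<open>The element of least multiplier \<epsilon> is primitive, since a root of it would have a
  smaller multiplier above 1. The multiplier of any other candidate lies in some interval from
  \<epsilon>^j to \<epsilon>^(j+1); dividing by \<epsilon>^j leaves 1 by minimality, so the
  candidate is a power of the first element, and primitivity forces j = 1.\<close>

lemma hyp_generator_ex1: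
  assumes "hyperbolic_fixed_point p \<alpha>"
  shows "\<exists>!M. hyp_generator \<alpha> M"
proof -
  let ?G = "hecke_stabilizer p \<alpha>"
  have GD: "M \<in> hecke_group p" "fixes_point M \<alpha>" "det M = 1" if "M \<in> ?G" for M
    using that det_hecke_group by (auto simp: hecke_stabilizer_def)
  obtain \<beta> N where ab: "\<alpha> \<noteq> \<beta>" and fb: "\<And>M. M \<in> ?G \<Longrightarrow> fixes_point M \<beta>"
    and N: "N \<in> ?G" "cocycle N \<alpha> > 1"
    and min: "\<And>M. M \<in> ?G \<Longrightarrow> cocycle M \<alpha> > 1 \<Longrightarrow> cocycle N \<alpha> \<le> cocycle M \<alpha>"
    using stabilizer_generator[OF assms] by blast
  define \<epsilon> where "\<epsilon> = cocycle N \<alpha>"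
  have eps: "\<epsilon> > 1" using N by (simp add: \<epsilon>_def)
  note rN = attracting_root_converse[OF GD(1,2)[OF N(1)] N(2)]
  have prim: "primitive_elt p N"
    unfolding primitive_elt_def
  proof (intro conjI notI)
    show "N \<in> hecke_group p" using GD N by blast
    assume "\<exists>K\<in>hecke_group p. \<exists>n\<ge>2. N = mat_power K n \<or> N = - mat_power K n"
    then obtain K n where K: "K \<in> hecke_group p" "n \<ge> 2" "N = mat_power K n \<or> N = - mat_power K n" by blast
    have dK: "det K = 1" using det_hecke_group K by blast
    \<comment> \<open>The representation uK + v transfers the fixed point \<alpha> from the power to
      \<open>K\<close>.\<close>
    obtain u v where uv: "mat_power K n = mat2 (u * K$1$1 + v) (u * K$1$2) (u * K$2$1) (u * K$2$2 + v)"
      using mat_power_linear[OF dK] by blast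
    have u: "u \<noteq> 0" using rN(2) K(3) uv by auto
    have "fixes_point (mat_power K n) \<alpha>"
      using K(3) GD(2)[OF N(1)] fixes_uminus(1)[of N \<alpha>] by auto
    then have "(u * K$1$1 + v) * \<alpha> + u * K$1$2 = \<alpha> * (u * K$2$1 * \<alpha> + (u * K$2$2 + v))"
      using det_mat_power[OF dK, of n] by (simp add: fixes_point_iff cocycle_def uv)
    then have "u * (K$1$1 * \<alpha> + K$1$2) = u * (\<alpha> * cocycle K \<alpha>)"
      by (simp add: cocycle_def algebra_simps)
    then have fK: "fixes_point K \<alpha>" using u dK by (simp add: fixes_point_iff)
    have cp: "\<bar>cocycle K \<alpha>\<bar> ^ n = \<epsilon>"
      using mat_power_fixes[OF dK fK, of n] K(3) eps fixes_uminus(2)[of "mat_power K n" \<alpha>]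
      by (auto simp: \<epsilon>_def power_abs[symmetric])
    obtain K' where K': "K' \<in> ?G" "cocycle K' \<alpha> = \<bar>cocycle K \<alpha>\<bar>"
    proof (cases "cocycle K \<alpha> \<ge> 0")
      case True then show ?thesis using that[of K] K fK by (auto simp: hecke_stabilizer_def)
    next
      case False then show ?thesis using that[of "- K"] K fK fixes_uminus[OF fK]
        by (auto simp: hecke_stabilizer_def intro: hecke_uminus)
    qed
    have gt1: "\<bar>cocycle K \<alpha>\<bar> > 1"
    proof (rule ccontr)
      assume "\<not> \<bar>cocycle K \<alpha>\<bar> > 1"
      then have "\<bar>cocycle K \<alpha>\<bar> ^ n \<le> 1" by (intro power_le_one) auto
      then show False using cp eps by simp
    qed
    have "\<epsilon> \<le> \<bar>cocycle K \<alpha>\<bar>" using min[OF K'(1)] K'(2) gt1 by (simp add: \<epsilon>_def)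
    moreover have "\<bar>cocycle K \<alpha>\<bar> ^ 1 < \<bar>cocycle K \<alpha>\<bar> ^ n"
      using gt1 K(2) by (intro power_strict_increasing) auto
    ultimately show False using cp by simp
  qed
  have genN: "hyp_generator \<alpha> N"
    unfolding hyp_generator_def hyperbolic_elt_def using prim rN GD(1)[OF N(1)] by auto
  moreover have "M = N" if M: "hyp_generator \<alpha> M" for M
  proof -
    have MG: "M \<in> hecke_group p" "trace M > 2" "M$2$1 \<noteq> 0" "primitive_elt p M"
      and ra: "\<alpha> = (M$1$1 - M$2$2 + sqrt ((M$1$1 + M$2$2)\<^sup>2 - 4)) / (2 * M$2$1)"
      using M by (auto simp: hyp_generator_def hyperbolic_elt_def)
    note aM = attracting_root[OF MG(1-3) ra refl]
    have MS: "M \<in> ?G" using MG aM by (simp add: hecke_stabilizer_def)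
    define \<mu> where "\<mu> = cocycle M \<alpha>"
    have mu: "\<mu> > 1" using aM by (simp add: \<mu>_def)
    obtain n where n: "\<mu> < \<epsilon> ^ n" using real_arch_pow[OF eps] by blast
    define m where "m = (LEAST n. \<mu> < \<epsilon> ^ n)"
    have m: "\<mu> < \<epsilon> ^ m" unfolding m_def by (rule LeastI[of _ n]) (rule n)
    have m0: "m \<noteq> 0" using m mu by (cases m) auto
    then obtain j where j: "m = Suc j" by (cases m) auto
    have le: "\<epsilon> ^ j \<le> \<mu>" using not_less_Least[of j "\<lambda>n. \<mu> < \<epsilon> ^ n"] j by (simp add: m_def)
    define K where "K = mat_power N j"
    have KG: "K \<in> ?G" unfolding K_def using N GD[OF N(1)] mat_power_fixes[of N \<alpha> j] hecke_mat_power[of N p j]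
      by (simp add: hecke_stabilizer_def)
    have cK: "cocycle K \<alpha> = \<epsilon> ^ j"
      unfolding K_def \<epsilon>_def using mat_power_fixes[OF GD(3,2)[OF N(1) ]] N by simp
    define W where "W = M ** matrix_inv K"
    note iK = fixes_inv[OF GD(3)[OF KG] GD(2)[OF KG]]
    have WG: "W \<in> ?G" and cW: "cocycle W \<alpha> = \<mu> / \<epsilon> ^ j"
      using fixes_mult[OF GD(3)[OF MS] det_matrix_inv2[OF GD(3)[OF KG]] GD(2)[OF MS] iK(1)] iK(2) cK
      by (auto simp: W_def hecke_stabilizer_def \<mu>_def intro!: hecke_group.mult hecke_group.inv MG GD[OF KG])
    have "\<not> cocycle W \<alpha> > 1"
    proof
      assume "cocycle W \<alpha> > 1"
      then have "\<epsilon> \<le> \<mu> / \<epsilon> ^ j" using min[OF WG] cW by (simp add: \<epsilon>_def)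
      then have "\<epsilon> ^ m \<le> \<mu>" using eps by (simp add: j field_simps)
      then show False using m by simp
    qed
    then have "\<mu> = \<epsilon> ^ j" using cW le eps by (simp add: field_simps)
    then have MK: "M = K"
      by (intro stabilizer_inj[OF GD(3)[OF MS] GD(3)[OF KG] GD(2)[OF MS] fb[OF MS] GD(2)[OF KG] fb[OF KG] ab])
         (simp add: cK \<mu>_def[symmetric])
    have "\<not> j \<ge> 2" using MG(4) MK GD(1)[OF N(1)] unfolding primitive_elt_def K_def by blast
    moreover have "j \<noteq> 0" using \<open>\<mu> = \<epsilon> ^ j\<close> mu by (cases j) auto
    ultimately have "j = Suc 0" by linarith
    then show "M = N" using MK by (simp add: K_def mat_power_Suc mat_power_0)
  qed
  ultimately show ?thesis by blast
qed

lemma hyp_matrix_eq: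
  assumes "hyp_generator \<alpha> M"
  shows "hyp_matrix p \<alpha> = M"
proof -
  have M: "M \<in> hecke_group p" "trace M > 2" "M$2$1 \<noteq> 0" "hyperbolic_elt p M"
    and ra: "\<alpha> = (M$1$1 - M$2$2 + sqrt ((M$1$1 + M$2$2)\<^sup>2 - 4)) / (2 * M$2$1)"
    using assms by (auto simp: hyp_generator_def hyperbolic_elt_def)
  have "hyperbolic_fixed_point p \<alpha>"
    unfolding hyperbolic_fixed_point_def using M(4) attracting_root(1)[OF M(1-3) ra refl] by blast
  from hyp_generator_ex1[OF this] assms show ?thesis
    unfolding hyp_matrix_def hyp_generator_def by (rule the1_equality)
qed

lemma hyp_generator_hyp_matrix:
  assumes "hyperbolic_fixed_point p \<alpha>"
  shows "hyp_generator \<alpha> (hyp_matrix p \<alpha>)"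
  using hyp_generator_ex1[OF assms] hyp_matrix_eq by (metis)

lemma hecke_conj_eq:
  assumes M: "hyperbolic_elt p M" "fixes_point M \<alpha>" "fixes_point M \<beta>" "\<alpha> \<noteq> \<beta>"
  shows "hecke_conj p \<alpha> = \<beta>"
  unfolding hecke_conj_def
proof (rule the_equality)
  show "\<beta> \<noteq> \<alpha> \<and> (\<forall>M\<in>hecke_stabilizer p \<alpha>. fixes_point M \<beta>)"
    using M stabilizer_fixes_conj[OF M(1,2) _ _ M(3)] by (auto simp: hecke_stabilizer_def)
  fix \<gamma> assume g: "\<gamma> \<noteq> \<alpha> \<and> (\<forall>M\<in>hecke_stabilizer p \<alpha>. fixes_point M \<gamma>)"
  have "M \<in> hecke_stabilizer p \<alpha>" using M by (auto simp: hecke_stabilizer_def hyperbolic_elt_def)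
  then have fg: "fixes_point M \<gamma>" using g by blast
  have dM: "det M = 1" using M(1) det_hecke_group by (auto simp: hyperbolic_elt_def)
  have "M$2$1 * (\<alpha> + \<beta>) = M$2$1 * (\<alpha> + \<gamma>)"
    using two_fixed_points(1)[OF dM M(2) M(3) M(4)] two_fixed_points(1)[OF dM M(2) fg] g by simp
  then show "\<gamma> = \<beta>" using hyperbolic_c_nz[OF M(1)] by simp
qed

lemma hyp_generator_conj:
  assumes M: "hyperbolic_elt p M" "primitive_elt p M" "trace M > 0" and V: "V \<in> hecke_group p"
  shows "hyperbolic_elt p (matrix_inv V ** M ** V)" "primitive_elt p (matrix_inv V ** M ** V)"
    "trace (matrix_inv V ** M ** V) > 0"
proof -
  note dV = det_hecke_group[OF V]
  have MG: "M \<in> hecke_group p" using M by (simp add: hyperbolic_elt_def)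
  have "trace (matrix_inv V ** M ** V) = (M$1$1 + M$2$2) * (V$1$1 * V$2$2 - V$1$2 * V$2$1)"
    unfolding trace2 mult2_nth matrix_inv_mat2[OF dV] mat2_nth by (simp add: algebra_simps)
  then have tr: "trace (matrix_inv V ** M ** V) = trace M" using dV by (simp add: det_2 trace2)
  have G: "matrix_inv V ** M ** V \<in> hecke_group p"
    by (intro hecke_group.mult hecke_group.inv V MG)
  show "hyperbolic_elt p (matrix_inv V ** M ** V)" "trace (matrix_inv V ** M ** V) > 0"
    using M G by (simp_all add: hyperbolic_elt_def tr)
  have conj_back: "V ** (matrix_inv V ** M ** V) ** matrix_inv V = M"
  proof -
    have "V ** (matrix_inv V ** M ** V) ** matrix_inv V = V ** (matrix_inv V ** M) ** V ** matrix_inv V"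
      by (simp only: matrix_mul_assoc)
    then show ?thesis unfolding inv_mult2(4)[OF dV] inv_mult2(5)[OF dV] .
  qed
  show "primitive_elt p (matrix_inv V ** M ** V)"
    unfolding primitive_elt_def
  proof (intro conjI notI G)
    assume "\<exists>N\<in>hecke_group p. \<exists>n\<ge>2. matrix_inv V ** M ** V = mat_power N n \<or> matrix_inv V ** M ** V = - mat_power N n"
    then obtain N n where N: "N \<in> hecke_group p" "n \<ge> 2"
      "matrix_inv V ** M ** V = mat_power N n \<or> matrix_inv V ** M ** V = - mat_power N n" by blast
    have "M = mat_power (V ** N ** matrix_inv V) n \<or> M = - mat_power (V ** N ** matrix_inv V) n"
      using N(3) conj_back unfolding mat_power_conj[OF dV, symmetric] by (auto simp: uminus_mult2)
    moreover have "V ** N ** matrix_inv V \<in> hecke_group p" by (intro hecke_group.mult hecke_group.inv V N)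
    ultimately show False using M(2) N(2) unfolding primitive_elt_def by blast
  qed
qed

text \<open>The class contains the form of one generator, and acting on it by V conjugates that
  generator. Conjugation preserves primitivity and trace, so each form of the class comes from a
  generator; this one is attached to the root of the form itself, and the discriminant is trace^2 -
  4.\<close>

theorem hyperbolic_class_simple:
  assumes cl: "hyperbolic_class p \<A>" and Q: "(A, B, C) \<in> \<A>" "simple_bqf (A, B, C)"
  shows "hyp_form p (bqf_root (A, B, C)) = (A, B, C)"
    "bqf_disc (A, B, C) > 0"
    "hecke_conj p (bqf_root (A, B, C)) = (- B - sqrt (bqf_disc (A, B, C))) / (2 * A)"
proof -
  obtain Q1 where Q1: "\<A> = bqf_act Q1 ` hecke_group p"
    using cl by (auto simp: hyperbolic_class_def bqf_class_def)
  obtain \<alpha>0 where a0: "hyperbolic_fixed_point p \<alpha>0" "hyp_form p \<alpha>0 \<in> \<A>"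
    using cl by (auto simp: hyperbolic_class_def hyperbolic_bqf_def)
  define M0 where "M0 = hyp_matrix p \<alpha>0"
  have M0: "hyp_generator \<alpha>0 M0" unfolding M0_def by (rule hyp_generator_hyp_matrix[OF a0(1)])
  have f0: "hyp_form p \<alpha>0 = mat_form M0" by (simp add: hyp_form_def M0_def mat_form_def Let_def)
  obtain V0 where V0: "V0 \<in> hecke_group p" "mat_form M0 = bqf_act Q1 V0" using a0(2) Q1 f0 by auto
  obtain V1 where V1: "V1 \<in> hecke_group p" "(A, B, C) = bqf_act Q1 V1" using Q(1) Q1 by auto
  define V where "V = matrix_inv V0 ** V1"
  have V: "V \<in> hecke_group p" unfolding V_def by (intro hecke_group.mult hecke_group.inv V0 V1)
  have "bqf_act (mat_form M0) V = bqf_act Q1 (V0 ** V)" unfolding V0(2) bqf_act_mult ..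
  also have "V0 ** V = V1" unfolding V_def by (rule inv_mult2(4)[OF det_hecke_group[OF V0(1)]])
  finally have QV: "(A, B, C) = bqf_act (mat_form M0) V" using V1(2) by simp
  define M where "M = matrix_inv V ** M0 ** V"
  have form: "(A, B, C) = mat_form M" unfolding M_def QV by (rule bqf_act_mat_form[OF det_hecke_group[OF V]])
  have M: "hyperbolic_elt p M" "primitive_elt p M" "trace M > 0"
    unfolding M_def using M0 hyp_generator_conj[OF _ _ _ V] by (simp_all add: hyp_generator_def)
  have ent: "M$2$1 = A" "M$2$2 - M$1$1 = B" "- (M$1$2) = C" using form by (simp_all add: mat_form_def)
  have A0: "A > 0" using Q(2) by (simp add: simple_bqf_def)
  have MG: "M \<in> hecke_group p" "trace M > 2" "M$2$1 \<noteq> 0"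
    using M A0 ent by (auto simp: hyperbolic_elt_def)
  have "M$1$1 * M$2$2 - M$1$2 * M$2$1 = 1" using det_hecke_group[OF MG(1)] by (simp add: det_2)
  then have disc: "bqf_disc (A, B, C) = (M$1$1 + M$2$2)\<^sup>2 - 4"
    unfolding ent[symmetric] by (simp add: bqf_disc_def power2_eq_square algebra_simps)
  have "2\<^sup>2 < (M$1$1 + M$2$2)\<^sup>2" using MG(2) by (intro power_strict_mono) (auto simp: trace2)
  then show "bqf_disc (A, B, C) > 0" using disc by simp
  have B: "- B = M$1$1 - M$2$2" using ent by simp
  have root: "bqf_root (A, B, C) = (M$1$1 - M$2$2 + sqrt ((M$1$1 + M$2$2)\<^sup>2 - 4)) / (2 * M$2$1)"
    by (simp add: bqf_root_def disc ent(1)) (simp add: ent(2)[symmetric])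
  have gen: "hyp_generator (bqf_root (A, B, C)) M"
    unfolding hyp_generator_def using M MG root by blast
  show "hyp_form p (bqf_root (A, B, C)) = (A, B, C)"
    unfolding hyp_form_def hyp_matrix_eq[OF gen] Let_def using ent by simp
  note ar = attracting_root[OF MG root refl]
  have "hecke_conj p (bqf_root (A, B, C)) = (M$1$1 - M$2$2 - sqrt ((M$1$1 + M$2$2)\<^sup>2 - 4)) / (2 * M$2$1)"
    by (rule hecke_conj_eq[OF M(1) ar(1,2,4)])
  then show "hecke_conj p (bqf_root (A, B, C)) = (- B - sqrt (bqf_disc (A, B, C))) / (2 * A)"
    by (simp only: B disc ent(1))
qed

end

section \<open>Fourier expansions and growth\<close>

lemma gamma_kernel:
  fixes s :: complex
  assumes b: "b > 0" and s: "Re s > 0"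
  shows "set_integrable lborel {0<..} (\<lambda>y. exp (- of_real (b * y)) * complex_of_real y powr s / of_real y)"
    and "(LINT y:{0<..}|lborel. exp (- of_real (b * y)) * complex_of_real y powr s / of_real y) = of_real b powr (- s) * Gamma s"
proof -
  have e: "exp (- of_real (c * y)) * complex_of_real y powr s / of_real y = complex_of_real y powr (s - 1) / of_real (exp (c * y))"
    if "y \<in> {0<..}" for c y
    using that by (simp add: powr_diff exp_minus exp_of_real[symmetric] field_simps)
  have int: "set_integrable lborel {0<..} (\<lambda>y. exp (- of_real (c * y)) * complex_of_real y powr s / of_real y)" if c: "c > 0" for c
  proof (subst set_integrable_cong[OF refl refl e])
    have "continuous_on {0<..} (\<lambda>y. complex_of_real y powr (s - 1) / of_real (exp (c * y)))"
      by (intro continuous_intros) auto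
    then show "set_integrable lborel {0<..} (\<lambda>y. complex_of_real y powr (s - 1) / of_real (exp (c * y)))"
      using absolutely_integrable_Gamma_integral[OF s c] by (subst set_integrable_lborel_iff_absolutely) auto
  qed
  show "set_integrable lborel {0<..} (\<lambda>y. exp (- of_real (b * y)) * complex_of_real y powr s / of_real y)"
    by (rule int[OF b])
  define h where "h c y = indicat_real {0<..} y *\<^sub>R (exp (- of_real (c * y)) * complex_of_real y powr s / of_real y)" for c y
  have "(LINT y:{0<..}|lborel. exp (- of_real (1 * y)) * complex_of_real y powr s / of_real y) = Gamma s"
  proof -
    have "(LINT y:{0<..}|lborel. exp (- of_real (1 * y)) * complex_of_real y powr s / of_real y)
       = integral {0<..} (\<lambda>y. exp (- of_real (1 * y)) * complex_of_real y powr s / of_real y)"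
      by (rule set_borel_integral_eq_integral(2)) (use int[of 1] in simp)
    also have "\<dots> = integral {0<..} (\<lambda>y. complex_of_real y powr (s - 1) / of_real (exp (1 * y)))"
      by (rule integral_cong, rule e)
    finally show ?thesis using Gamma_integral_complex'[OF s] by (simp add: integral_unique)
  qed
  then have h1: "(\<integral>y. h 1 y \<partial>lborel) = Gamma s" by (simp add: h_def[abs_def] set_lebesgue_integral_def)
  have bb: "b *\<^sub>R h 1 (0 + b * y) = of_real b powr s * h b y" for y
  proof (cases "y > 0")
    case True
    have "complex_of_real (b * y) powr s = of_real b powr s * of_real y powr s"
      using b True by (simp add: powr_times_real)
    then show ?thesis using b True by (simp add: h_def scaleR_conv_of_real)
  next
    case False
    then have "\<not> b * y > 0" using b by (simp add: zero_less_mult_iff)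
    then show ?thesis using False by (simp add: h_def)
  qed
  have "(\<integral>y. h 1 y \<partial>lborel) = \<bar>b\<bar> *\<^sub>R (\<integral>y. h 1 (0 + b * y) \<partial>lborel)"
    using b by (intro lborel_integral_real_affine) auto
  also have "\<dots> = (\<integral>y. b *\<^sub>R h 1 (0 + b * y) \<partial>lborel)" using b by simp
  also have "\<dots> = of_real b powr s * (\<integral>y. h b y \<partial>lborel)" unfolding bb by simp
  finally have "of_real b powr s * (\<integral>y. h b y \<partial>lborel) = Gamma s" using h1 by simp
  then have "(\<integral>y. h b y \<partial>lborel) = of_real b powr (- s) * Gamma s"
    using b by (simp add: powr_minus field_simps)
  then show "(LINT y:{0<..}|lborel. exp (- of_real (b * y)) * complex_of_real y powr s / of_real y) = of_real b powr (- s) * Gamma s"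
    by (simp add: h_def[abs_def] set_lebesgue_integral_def)
qed

context
  fixes F :: "complex \<Rightarrow> complex" and a :: "nat \<Rightarrow> complex" and lam :: real
  assumes lam: "lam > 0"
    and four: "\<And>z. Im z > 0 \<Longrightarrow>
      (\<lambda>n. a (Suc n) * exp (2 * of_real pi * \<i> * of_nat (Suc n) * z / of_real lam)) sums F z"
begin

text \<open>The local parameter at the cusp, in which \<open>F\<close> becomes a power series on the
  unit disc.\<close>

definition nome :: "complex \<Rightarrow> complex" where
  "nome z = exp (2 * of_real pi * \<i> * z / of_real lam)"

lemma nome_power: "exp (2 * of_real pi * \<i> * of_nat n * z / of_real lam) = nome z ^ n"
  unfolding nome_def exp_of_nat_mult[symmetric] by (simp add: mult_ac)

lemma norm_nome: "norm (nome z) = exp (- (2 * pi / lam) * Im z)"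
  by (simp add: nome_def norm_exp_eq_Re)

lemma fourier_nome: "Im z > 0 \<Longrightarrow> (\<lambda>n. a (Suc n) * nome z ^ Suc n) sums F z"
  using four[of z] unfolding nome_power .

lemma nome_surj:
  assumes "w \<noteq> 0"
  obtains z where "nome z = w" "Im z = - ln (norm w) / (2 * pi / lam)"
proof -
  define z where "z = Ln w * of_real lam / (2 * of_real pi * \<i>)"
  have "nome z = w" unfolding nome_def z_def using assms lam by simp
  moreover have "Im z = - ln (norm w) / (2 * pi / lam)"
  proof -
    have "z = of_real (lam / (2 * pi)) * (- \<i> * Ln w)" by (simp add: z_def field_simps)
    then show ?thesis using assms by simp
  qed
  ultimately show ?thesis using that by blast
qed

text \<open>\<open>nome\<close> maps the half plane onto the punctured unit disc, so the power
  series converges at some w with r < |w| < 1 and hence absolutely at r.\<close>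

lemma fourier_abs_summable:
  assumes "0 \<le> r" "r < 1"
  shows "summable (\<lambda>n. norm (a (Suc n)) * r ^ n)"
proof -
  define w where "w = complex_of_real ((1 + r) / 2)"
  have nw: "norm w = (1 + r) / 2" using assms unfolding w_def norm_of_real by simp
  have w: "w \<noteq> 0" "r < norm w" "norm w < 1"
  proof -
    have "norm w > 0" unfolding nw using assms by simp
    then show "w \<noteq> 0" by auto
    show "r < norm w" "norm w < 1" unfolding nw using assms by simp_all
  qed
  obtain z where z: "nome z = w" "Im z = - ln (norm w) / (2 * pi / lam)" using nome_surj[OF w(1)] by blast
  have "ln (norm w) < 0" using w by (subst ln_less_zero_iff) auto
  then have "Im z > 0" unfolding z(2) using lam by (intro divide_pos_pos) auto
  then have "summable (\<lambda>n. a (Suc n) * w ^ Suc n)"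
    using fourier_nome[of z] z(1) by (auto simp: sums_iff)
  then have "summable (\<lambda>n. (1 / w) * (a (Suc n) * w ^ Suc n))" by (rule summable_mult)
  then have "summable (\<lambda>n. a (Suc n) * w ^ n)" using w(1) by simp
  from powser_insidea[OF this, of "of_real r"] show ?thesis
    using assms w by (simp add: norm_mult norm_power)
qed

text \<open>With no constant term, a factor \<open>nome z\<close> comes out of the series; what
  remains is bounded for Im z \<ge> y0.\<close>

lemma fourier_decay:
  assumes "y0 > 0"
  obtains C where "C \<ge> 0" "\<And>z. Im z \<ge> y0 \<Longrightarrow> norm (F z) \<le> C * exp (- (2 * pi / lam) * Im z)"
proof -
  define r where "r = exp (- (2 * pi / lam) * y0)"
  have c: "2 * pi / lam > 0" using lam by simp
  have r: "0 \<le> r" "r < 1" using assms lam by (auto simp: r_def)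
  have S: "summable (\<lambda>n. norm (a (Suc n)) * r ^ n)" by (rule fourier_abs_summable[OF r])
  define C where "C = (\<Sum>n. norm (a (Suc n)) * r ^ n)"
  have "norm (F z) \<le> C * exp (- (2 * pi / lam) * Im z)" if z: "Im z \<ge> y0" for z
  proof -
    have nle: "norm (nome z) \<le> r" unfolding norm_nome r_def
      using z c by (simp only: exp_le_cancel_iff) (simp only: mult_minus_left neg_le_iff_le mult_left_mono less_imp_le)
    have s: "(\<lambda>n. a (Suc n) * nome z ^ Suc n) sums F z" using fourier_nome z assms by simp
    have bd: "norm (a (Suc n) * nome z ^ Suc n) \<le> norm (nome z) * (norm (a (Suc n)) * r ^ n)" for n
    proof -
      have "norm (nome z) ^ n \<le> r ^ n" using nle by (intro power_mono) auto
      then have "norm (nome z) * (norm (a (Suc n)) * norm (nome z) ^ n) \<le> norm (nome z) * (norm (a (Suc n)) * r ^ n)"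
        by (intro mult_left_mono) auto
      then show ?thesis by (simp add: norm_mult norm_power mult_ac)
    qed
    have "norm (F z) = norm (\<Sum>n. a (Suc n) * nome z ^ Suc n)" using s by (simp add: sums_iff)
    also have "\<dots> \<le> (\<Sum>n. norm (nome z) * (norm (a (Suc n)) * r ^ n))"
      by (rule norm_suminf_le[OF bd summable_mult[OF S]])
    also have "\<dots> = norm (nome z) * C" unfolding C_def by (rule suminf_mult[OF S])
    finally show ?thesis unfolding norm_nome by (simp add: mult.commute)
  qed
  moreover have "C \<ge> 0" unfolding C_def using r by (intro suminf_nonneg[OF S]) auto
  ultimately show ?thesis using that by blast
qed

lemma fourier_periodic:
  assumes "Im z > 0"
  shows "F (z + of_int m * of_real lam) = F z"
proof -
  have "nome (z + of_int m * of_real lam) = nome z"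
  proof -
    have "2 * of_real pi * \<i> * (z + of_int m * of_real lam) / of_real lam = 2 * of_real pi * \<i> * z / of_real lam + 2 * of_int m * of_real pi * \<i>"
      using lam by (simp add: field_simps)
    then show ?thesis unfolding nome_def exp_add using exp_integer_2pi[of "of_int m"] by (simp add: mult_ac)
  qed
  then show ?thesis
    using fourier_nome[OF assms] fourier_nome[of "z + of_int m * of_real lam"] assms by (simp add: sums_iff)
qed

text \<open>Cauchy's inequality on the circle that is the image of the line Im z = y. The height y
  is free and will be taken proportional to the reciprocal of the index.\<close>

lemma fourier_coeff_bound:
  assumes y: "y > 0" and B: "\<And>z. Im z = y \<Longrightarrow> norm (F z) \<le> B"
  shows "norm (a (Suc n)) \<le> B * exp ((2 * pi / lam) * y * real (Suc n))"
proof -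
  \<comment> \<open>The expansion involves a 1, a 2, ... only, so the constant coefficient is set to
    0.\<close>
  define a0 where "a0 i = (case i of 0 \<Rightarrow> 0 | Suc i \<Rightarrow> a (Suc i))" for i
  define f where "f = Abs_fps a0"
  have c: "2 * pi / lam > 0" using lam by simp
  have sm: "(\<lambda>i. a0 i * nome z ^ i) sums F z" if "Im z > 0" for z
    using fourier_nome[OF that] by (subst sums_Suc_iff[symmetric] sums_Suc_imp) (auto simp: a0_def sums_Suc_iff)
  have rad: "fps_conv_radius f \<ge> 1"
    unfolding fps_conv_radius_def
  proof (rule conv_radius_geI_ex)
    fix r :: real assume r: "0 < r" "ereal r < 1"
    obtain z where z: "nome z = of_real r" "Im z = - ln (norm (complex_of_real r)) / (2 * pi / lam)"
      using nome_surj[of "complex_of_real r"] r by auto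
    have "ln r < 0" using r by (subst ln_less_zero_iff) auto
    then have "Im z > 0" unfolding z(2) using r lam by (intro divide_pos_pos) auto
    then have "summable (\<lambda>i. a0 i * of_real r ^ i)" using sm[of z] z(1) by (auto simp: sums_iff)
    then show "\<exists>z. norm z = r \<and> summable (\<lambda>n. fps_nth f n * z ^ n)"
      using r by (intro exI[of _ "complex_of_real r"]) (auto simp: f_def)
  qed
  define r where "r = exp (- (2 * pi / lam) * y)"
  have r: "0 < r" "r < 1" using lam y by (auto simp: r_def)
  have sub: "cball (0 :: complex) r \<subseteq> eball 0 (fps_conv_radius f)"
  proof
    fix w assume "w \<in> cball (0::complex) r"
    then have "ereal (norm w) < 1" using r by simp
    also note rad
    finally show "w \<in> eball 0 (fps_conv_radius f)" by (simp add: in_eball_iff)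
  qed
  have hol: "eval_fps f holomorphic_on cball 0 r" by (rule holomorphic_on_eval_fps[OF sub])
  have "norm ((deriv ^^ Suc n) (eval_fps f) 0) \<le> fact (Suc n) * B / r ^ Suc n"
  proof (rule Cauchy_inequality)
    show "norm (eval_fps f w) \<le> B" if "norm (0 - w) = r" for w
    proof -
      have w: "w \<noteq> 0" "norm w = r" using that r by auto
      obtain z where z: "nome z = w" "Im z = - ln (norm w) / (2 * pi / lam)" using nome_surj[OF w(1)] by blast
      have "Im z = y" unfolding z(2) w(2) r_def using lam by simp
      moreover have "eval_fps f w = F z"
        using sm[of z] y calculation z(1) by (simp add: eval_fps_def f_def sums_iff)
      ultimately show ?thesis using B by simp
    qed
  qed (use hol r in \<open>auto intro: holomorphic_on_subset holomorphic_on_imp_continuous_on\<close>)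
  moreover have "fps_nth f (Suc n) = (deriv ^^ Suc n) (eval_fps f) 0 / fact (Suc n)"
    by (rule fps_nth_conv_deriv) (use rad in \<open>auto intro: less_le_trans[of 0 1]\<close>)
  ultimately have "norm (fps_nth f (Suc n)) \<le> B / r ^ Suc n"
    by (simp only: norm_divide norm_fact) (simp add: field_simps del: fact_Suc power_Suc)
  then have "norm (a (Suc n)) \<le> B / r ^ Suc n" by (simp add: f_def a0_def)
  also have "r ^ Suc n = exp (- ((2 * pi / lam) * y * real (Suc n)))"
    unfolding r_def exp_of_nat_mult[symmetric] by (simp add: algebra_simps)
  also have "B / \<dots> = B * exp ((2 * pi / lam) * y * real (Suc n))"
    by (simp only: exp_minus divide_inverse inverse_inverse_eq)
  finally show ?thesis .
qed

text \<open>Termwise integration is justified by the integrals of the absolute values: their sum is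
  a constant times the Dirichlet series of |a n| at Re s.\<close>

lemma fourier_mellin:
  assumes s: "Re s > 0" and S: "summable (\<lambda>n. norm (a (Suc n)) * real (Suc n) powr (- Re s))"
  shows "summable (\<lambda>n. a (Suc n) * of_nat (Suc n) powr (- s))"
    and "(LINT y:{0<..}|lborel. mellin_integrand F s y) =
       of_real (2 * pi / lam) powr (- s) * Gamma s * (\<Sum>n. a (Suc n) * of_nat (Suc n) powr (- s))"
proof -
  define c where "c = 2 * pi / lam"
  have c: "c > 0" using lam by (simp add: c_def)
  have nn: "norm (of_nat (Suc n) powr (- s)) = real (Suc n) powr (- Re s)" for n
    using norm_of_real_powr_complex[of "real (Suc n)" "- s"] by simp
  show sumd: "summable (\<lambda>n. a (Suc n) * of_nat (Suc n) powr (- s))"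
    by (rule summable_norm_cancel) (use S nn in \<open>simp add: norm_mult del: of_nat_Suc\<close>)
  define f where "f n y = indicat_real {0<..} y *\<^sub>R (a (Suc n) * (exp (- of_real (c * real (Suc n) * y)) * complex_of_real y powr s / of_real y))" for n y
  have cn: "c * real (Suc n) > 0" for n using c by (intro mult_pos_pos) auto
  have int: "integrable lborel (f n)" for n
    using set_integrable_mult_right[OF gamma_kernel(1)[OF cn s]] unfolding f_def set_integrable_def .
  have val: "integral\<^sup>L lborel (f n) = a (Suc n) * (of_real (c * real (Suc n)) powr (- s) * Gamma s)" for n
    unfolding f_def set_lebesgue_integral_def[symmetric] set_integral_mult_right gamma_kernel(2)[OF cn s] ..
  have nval: "(\<integral>y. norm (f n y) \<partial>lborel) = norm (a (Suc n)) * ((c * real (Suc n)) powr (- Re s) * Gamma (Re s))" for n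
  proof -
    have e: "complex_of_real (norm (f n y)) = indicat_real {0<..} y *\<^sub>R (of_real (norm (a (Suc n))) * (exp (- of_real (c * real (Suc n) * y)) * complex_of_real y powr of_real (Re s) / of_real y))" for y
    proof (cases "y > 0")
      case True
      have "norm (exp (- complex_of_real (c * real (Suc n) * y))) = exp (- (c * real (Suc n) * y))"
        by (simp add: norm_exp_eq_Re del: of_nat_Suc)
      then have "norm (f n y) = norm (a (Suc n)) * (exp (- (c * real (Suc n) * y)) * y powr Re s / y)"
        using True by (simp add: f_def norm_mult norm_divide norm_of_real_powr_complex del: of_nat_Suc)
      then show ?thesis using True by (simp add: powr_of_real exp_of_real[symmetric] del: of_nat_Suc)
    qed (simp add: f_def)
    have "complex_of_real (\<integral>y. norm (f n y) \<partial>lborel) = (\<integral>y. complex_of_real (norm (f n y)) \<partial>lborel)"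
      by simp
    also have "\<dots> = of_real (norm (a (Suc n))) * (of_real (c * real (Suc n)) powr (- of_real (Re s)) * Gamma (of_real (Re s)))"
      unfolding e set_lebesgue_integral_def[symmetric] set_integral_mult_right
      by (subst gamma_kernel(2)[OF cn]) (use s in simp_all)
    also have "\<dots> = of_real (norm (a (Suc n)) * ((c * real (Suc n)) powr (- Re s) * Gamma (Re s)))"
      using powr_of_real[of "c * real (Suc n)" "- Re s"] less_imp_le[OF cn[of n]] by (simp add: Gamma_complex_of_real del: of_nat_Suc)
    finally show ?thesis by (simp only: of_real_eq_iff)
  qed
  have sm1: "AE y in lborel. summable (\<lambda>n. norm (f n y))"
  proof (rule AE_I2)
    fix y :: real
    show "summable (\<lambda>n. norm (f n y))"
    proof (cases "y > 0")
      case True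
      define r where "r = exp (- (c * y))"
      have r: "0 \<le> r" "r < 1" using True c by (auto simp: r_def)
      have "norm (f n y) = (r * (y powr Re s / y)) * (norm (a (Suc n)) * r ^ n)" for n
      proof -
        have "norm (exp (- complex_of_real (c * real (Suc n) * y))) = exp (real (Suc n) * (- (c * y)))"
          by (simp add: norm_exp_eq_Re algebra_simps)
        also have "\<dots> = r ^ Suc n" unfolding exp_of_nat_mult r_def ..
        finally show ?thesis using True
          by (simp add: f_def norm_mult norm_divide norm_of_real_powr_complex mult_ac del: of_nat_Suc)
      qed
      then show ?thesis using summable_mult[OF fourier_abs_summable[OF r]] by simp
    qed (simp add: f_def)
  qed
  have sm2: "summable (\<lambda>n. (\<integral>y. norm (f n y) \<partial>lborel))"
  proof -
    have "(\<integral>y. norm (f n y) \<partial>lborel) = (c powr (- Re s) * Gamma (Re s)) * (norm (a (Suc n)) * real (Suc n) powr (- Re s))" for n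
      unfolding nval using c by (simp add: powr_mult mult_ac del: of_nat_Suc)
    then show ?thesis using summable_mult[OF S] by simp
  qed
  have pt: "(\<Sum>n. f n y) = indicat_real {0<..} y *\<^sub>R mellin_integrand F s y" for y
  proof (cases "y > 0")
    case True
    have e: "nome (\<i> * of_real y) ^ Suc n = exp (- of_real (c * real (Suc n) * y))" for n
      unfolding nome_def exp_of_nat_mult[symmetric] c_def by (simp add: algebra_simps)
    have "(\<lambda>n. a (Suc n) * exp (- of_real (c * real (Suc n) * y))) sums F (\<i> * of_real y)"
      using fourier_nome[of "\<i> * of_real y"] True unfolding e by simp
    then have "(\<lambda>n. a (Suc n) * exp (- of_real (c * real (Suc n) * y)) * (complex_of_real y powr s / of_real y)) sums (F (\<i> * of_real y) * (complex_of_real y powr s / of_real y))"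
      by (rule sums_mult2)
    then have "(\<lambda>n. f n y) sums mellin_integrand F s y"
      using True by (simp add: f_def mellin_integrand_def mult.assoc del: of_nat_Suc)
    then show ?thesis using True by (simp add: sums_iff)
  qed (simp add: f_def)
  have "(LINT y:{0<..}|lborel. mellin_integrand F s y) = (\<integral>y. (\<Sum>n. f n y) \<partial>lborel)"
    unfolding pt set_lebesgue_integral_def ..
  also have "\<dots> = (\<Sum>n. integral\<^sup>L lborel (f n))" by (rule integral_suminf[OF int sm1 sm2])
  also have "\<dots> = (\<Sum>n. (of_real c powr (- s) * Gamma s) * (a (Suc n) * of_nat (Suc n) powr (- s)))"
  proof (rule suminf_cong)
    fix n
    have "complex_of_real (c * real (Suc n)) powr (- s) = of_real c powr (- s) * of_nat (Suc n) powr (- s)"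
      using powr_times_real[of "of_real c" "of_nat (Suc n)" "- s"] c by simp
    then show "integral\<^sup>L lborel (f n) = (of_real c powr (- s) * Gamma s) * (a (Suc n) * of_nat (Suc n) powr (- s))"
      unfolding val by (simp only: mult_ac)
  qed
  also have "\<dots> = (of_real c powr (- s) * Gamma s) * (\<Sum>n. a (Suc n) * of_nat (Suc n) powr (- s))"
    by (rule suminf_mult[OF sumd])
  finally show "(LINT y:{0<..}|lborel. mellin_integrand F s y) =
       of_real (2 * pi / lam) powr (- s) * Gamma s * (\<Sum>n. a (Suc n) * of_nat (Suc n) powr (- s))"
    unfolding c_def .
qed

end

text \<open>Along $z \mapsto -1/z$ the imaginary part of a point low in the strip $|\mathrm{Re}\, z| \le \lambda/2$ grows
  by a fixed factor, so the functional equation contracts the bound.\<close>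
lemma automorphic_growth:
  fixes f h :: "complex \<Rightarrow> complex" and \<kappa> lam y0 :: real and k :: nat
  assumes lam: "0 < lam" "lam < 2" and k: "\<kappa> > real k"
    and per: "\<And>z m. Im z > 0 \<Longrightarrow> f (z + of_int m * of_real lam) = f z"
    and T: "\<And>z. Im z > 0 \<Longrightarrow> f (- 1 / z) / z ^ (2 * k) = f z + h z"
    and h: "\<And>z. Im z > 0 \<Longrightarrow> norm (h z) \<le> K * Im z powr (- real k)" and K: "K \<ge> 0"
    and y0: "0 < y0" "lam\<^sup>2 / 4 + y0\<^sup>2 < 1"
    and top: "\<And>z. Im z > 0 \<Longrightarrow> norm z \<le> 1 \<Longrightarrow> Im (- 1 / z) \<ge> y0 \<Longrightarrow>
                norm (f (- 1 / z)) / norm z ^ (2 * k) \<le> C1 * Im z powr (- \<kappa>)" and C1: "C1 \<ge> 0"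
    and top2: "\<And>z. Im z = y0 \<Longrightarrow> norm (f z) \<le> C2"
  obtains C where "C \<ge> 0" "\<And>z. 0 < Im z \<Longrightarrow> Im z \<le> y0 \<Longrightarrow> norm (f z) \<le> C * Im z powr (- \<kappa>)"
proof -
  \<comment> \<open>For |Re z| \<le> \<lambda>/2 and 0 < Im z \<le> y0 this bounds |z|^2, so -1/z
    lies higher than z by the factor 1/\<rho> at least.\<close>
  define \<rho> where "\<rho> = lam\<^sup>2 / 4 + y0\<^sup>2"
  have \<rho>: "0 < \<rho>" "\<rho> < 1" using y0 lam by (auto simp: \<rho>_def intro: add_nonneg_pos)
  have y01: "y0 < 1"
  proof -
    have "y0\<^sup>2 < 1" using y0 lam by (smt (verit) divide_nonneg_nonneg zero_le_power2)
    then show ?thesis using y0 by (metis abs_of_pos abs_square_less_1)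
  qed
  \<comment> \<open>One application of z \<mapsto> -1/z multiplies the bound by N^(\<kappa> - k)
    with N = |z|^2 \<le> \<rho>.\<close>
  define \<theta> where "\<theta> = \<rho> powr (\<kappa> - real k)"
  have \<theta>: "0 \<le> \<theta>" "\<theta> < 1" using \<rho> k powr_less_mono2[of "\<kappa> - real k" \<rho> 1] by (auto simp: \<theta>_def)
  \<comment> \<open>Large enough for \<theta> C + C1 + K \<le> C, so that one step reproduces the
    bound.\<close>
  define C where "C = max \<bar>C2\<bar> ((C1 + K) / (1 - \<theta>))"
  have C0: "C \<ge> 0" by (simp add: C_def)
  have "(C1 + K) / (1 - \<theta>) \<le> C" by (simp add: C_def)
  then have C3: "C1 + K \<le> C * (1 - \<theta>)" using \<theta> by (simp add: pos_divide_le_eq)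
  have C4: "C1 + K \<le> C"
  proof -
    have "C * (1 - \<theta>) \<le> C * 1" using C0 \<theta> by (intro mult_left_mono) auto
    then show ?thesis using C3 by linarith
  qed
  \<comment> \<open>Extends the bound from heights at least y0 \<rho>^n to heights at least y0
    \<rho>^(n+1) inside the strip: -1/z either lands at height y0 or above, where \<open>top\<close>
    applies, or in the range already treated.\<close>
  have step: "norm (f z) \<le> C * Im z powr (- \<kappa>)"
    if IH: "\<And>w. y0 * \<rho> ^ n \<le> Im w \<Longrightarrow> Im w \<le> y0 \<Longrightarrow> norm (f w) \<le> C * Im w powr (- \<kappa>)"
      and z: "y0 * \<rho> ^ Suc n \<le> Im z" "Im z \<le> y0" and re: "\<bar>Re z\<bar> \<le> lam / 2" for n z
  proof -
    define y where "y = Im z"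
    have "0 < y0 * \<rho> ^ Suc n" using y0 \<rho> by simp
    then have y: "0 < y" "y \<le> y0" using z by (auto simp: y_def)
    have z0: "z \<noteq> 0" using y by (auto simp: y_def)
    define N where "N = (norm z)\<^sup>2"
    have Npos: "N > 0" using z0 by (simp add: N_def)
    have "N = (Re z)\<^sup>2 + y\<^sup>2" by (simp add: N_def y_def cmod_power2)
    also have "(Re z)\<^sup>2 \<le> (lam / 2)\<^sup>2" using re by (metis abs_ge_zero power2_abs power_mono)
    also have "y\<^sup>2 \<le> y0\<^sup>2" using y by (intro power_mono) auto
    finally have N\<rho>: "N \<le> \<rho>" by (simp add: \<rho>_def power_divide)
    have norm1: "norm z \<le> 1" using N\<rho> \<rho> by (metis N_def abs_norm_cancel abs_square_le_1 less_imp_le order_trans)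
    have pw: "norm z ^ (2 * k) = N powr real k" using Npos by (simp add: N_def power_mult powr_realpow)
    have Imw: "Im (- 1 / z) = y / N"
      by (simp add: Im_divide y_def N_def cmod_power2)
    have yk: "y powr (- real k) \<le> y powr (- \<kappa>)"
      using y y01 k by (intro powr_mono') auto
    have main: "norm (f (- 1 / z)) / norm z ^ (2 * k) \<le> (C - K) * y powr (- \<kappa>)"
    proof (cases "y / N \<ge> y0")
      case True
      have "norm (f (- 1 / z)) / norm z ^ (2 * k) \<le> C1 * y powr (- \<kappa>)"
        using top[of z] y norm1 Imw True by (simp add: y_def)
      also have "\<dots> \<le> (C - K) * y powr (- \<kappa>)" using C4 by (intro mult_right_mono) auto
      finally show ?thesis .
    next
      case False
      have "y0 * \<rho> ^ n * \<rho> \<le> y" using z(1) by (simp add: y_def mult_ac)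
      then have "y0 * \<rho> ^ n \<le> y / \<rho>" using \<rho> by (simp add: field_simps)
      also have "y / \<rho> \<le> y / N" using y N\<rho> Npos by (intro divide_left_mono) (auto intro: mult_pos_pos \<rho>)
      finally have "norm (f (- 1 / z)) \<le> C * (y / N) powr (- \<kappa>)"
        using IH[of "- 1 / z"] False Imw by simp
      then have "norm (f (- 1 / z)) / norm z ^ (2 * k) \<le> C * (y / N) powr (- \<kappa>) / N powr real k"
        unfolding pw by (intro divide_right_mono) auto
      also have "\<dots> = C * y powr (- \<kappa>) * N powr (\<kappa> - real k)"
        using y Npos by (simp add: powr_divide powr_minus powr_diff field_simps)
      also have "\<dots> \<le> C * y powr (- \<kappa>) * \<theta>"
        unfolding \<theta>_def using N\<rho> Npos k C0 by (intro mult_left_mono powr_mono2) auto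
      also have "\<dots> = C * \<theta> * y powr (- \<kappa>)" by simp
      also have "\<dots> \<le> (C - K) * y powr (- \<kappa>)"
        using C3 C1 by (intro mult_right_mono) (auto simp: algebra_simps)
      finally show ?thesis .
    qed
    have "f z = f (- 1 / z) / z ^ (2 * k) - h z" using T[of z] y by (simp add: y_def)
    then have "norm (f z) \<le> norm (f (- 1 / z)) / norm z ^ (2 * k) + norm (h z)"
      using norm_triangle_ineq4[of "f (- 1 / z) / z ^ (2 * k)" "h z"] by (simp add: norm_divide norm_power)
    also have "norm (h z) \<le> K * y powr (- \<kappa>)"
      using h[of z] y mult_left_mono[OF yk K] by (simp add: y_def)
    also note main
    finally show ?thesis by (simp add: y_def algebra_simps)
  qed
  have P: "norm (f z) \<le> C * Im z powr (- \<kappa>)" if "y0 * \<rho> ^ n \<le> Im z" "Im z \<le> y0" for n z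
    using that
  proof (induction n arbitrary: z)
    case 0
    then have z: "Im z = y0" by simp
    have "y0 powr 0 \<le> y0 powr (- \<kappa>)" using y0 y01 k by (intro powr_mono') auto
    then have "C * 1 \<le> C * y0 powr (- \<kappa>)" using y0 C0 by (intro mult_left_mono) auto
    moreover have "norm (f z) \<le> C" using top2[OF z] by (auto simp: C_def)
    ultimately show ?case using z by simp
  next
    case (Suc n)
    have "0 < y0 * \<rho> ^ Suc n" using y0 \<rho> by simp
    then have pos: "Im z > 0" using Suc.prems by linarith
    \<comment> \<open>Translation by the nearest multiple of the period brings z into the
      strip.\<close>
    define m where "m = - round (Re z / lam)"
    define z' where "z' = z + of_int m * of_real lam"
    have "\<bar>of_int (round (Re z / lam)) - Re z / lam\<bar> \<le> 1 / 2" by (rule of_int_round_abs_le)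
    then have "\<bar>of_int (round (Re z / lam)) - Re z / lam\<bar> * lam \<le> 1 / 2 * lam" using lam by (intro mult_right_mono) auto
    moreover have "\<bar>of_int (round (Re z / lam)) - Re z / lam\<bar> * lam = \<bar>of_int (round (Re z / lam)) * lam - Re z\<bar>"
    proof -
      have "\<bar>of_int (round (Re z / lam)) - Re z / lam\<bar> * lam = \<bar>(of_int (round (Re z / lam)) - Re z / lam) * lam\<bar>"
        using lam by (simp add: abs_mult)
      then show ?thesis using lam by (simp add: left_diff_distrib)
    qed
    ultimately have "\<bar>Re z'\<bar> \<le> lam / 2" by (simp add: z'_def m_def abs_minus_commute)
    moreover have im: "Im z' = Im z" by (simp add: z'_def)
    moreover have "f z' = f z" unfolding z'_def by (rule per[OF pos])
    ultimately show ?case using step[of n z'] Suc by simp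
  qed
  have "norm (f z) \<le> C * Im z powr (- \<kappa>)" if z: "0 < Im z" "Im z \<le> y0" for z
  proof -
    obtain n where "\<rho> ^ n < Im z / y0" using real_arch_pow_inv[of "Im z / y0" \<rho>] z y0 \<rho> by auto
    then have "y0 * \<rho> ^ n \<le> Im z" using y0 by (simp add: field_simps)
    then show ?thesis using P z by blast
  qed
  then show ?thesis using that C0 by blast
qed

section \<open>Asymptotic expansions of period functions\<close>

text \<open>The coefficients are the Taylor coefficients of h at u = 1/y = 0. Iterated difference
  quotients stay holomorphic on all of S, so the remainder is u^N times a function bounded on the
  whole segment [0, 1]; this gives the error bound for all y \<ge> 1 and not just near
  infinity.\<close>

lemma asymptotic_expansion_holomorphic:
  assumes S: "open S" "h holomorphic_on S" "complex_of_real ` {0..1} \<subseteq> S"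
  shows "\<exists>c. asymptotic_expansion (\<lambda>y. h (of_real (1 / y))) c"
proof -
  define st where "st f = (\<lambda>z :: complex. if z = 0 then deriv f 0 else (f z - f 0) / (z - 0))" for f :: "complex \<Rightarrow> complex"
  define H where "H N = (st ^^ N) h" for N
  define c where "c N = H N 0" for N
  have hol: "H N holomorphic_on S" for N
  proof (induction N)
    case (Suc N)
    then show ?case unfolding H_def funpow.simps o_def st_def by (rule pole_lemma_open[OF _ S(1)])
  qed (use S in \<open>simp add: H_def\<close>)
  have ex: "h u = (\<Sum>n<N. c n * u ^ n) + u ^ N * H N u" if "u \<noteq> 0" for u N
  proof (induction N)
    case (Suc N)
    have "H N u = c N + u * H (Suc N) u" using that by (simp add: H_def st_def c_def)
    then show ?case using Suc by (simp add: algebra_simps)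
  qed (simp add: H_def)
  have "asymptotic_expansion (\<lambda>y. h (of_real (1 / y))) c"
    unfolding asymptotic_expansion_def
  proof (intro conjI allI)
    have sub: "(\<lambda>y. complex_of_real (1 / y)) ` {1..} \<subseteq> S"
    proof
      fix x assume "x \<in> (\<lambda>y. complex_of_real (1 / y)) ` {1..}"
      then obtain y where "x = of_real (1 / y)" "y \<ge> 1" by auto
      then have "x \<in> complex_of_real ` {0..1}" by (intro image_eqI[of _ _ "1 / y"]) auto
      then show "x \<in> S" using S(3) by blast
    qed
    show "continuous_on {1..} (\<lambda>y. h (of_real (1 / y)))"
      by (rule continuous_on_compose2[OF holomorphic_on_imp_continuous_on[OF S(2)] _ sub])
         (intro continuous_intros, auto)
    fix N
    have "compact (complex_of_real ` {0..1})"
      by (intro compact_continuous_image continuous_intros) auto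
    moreover have "continuous_on (complex_of_real ` {0..1}) (H N)"
      using hol[of N] S(3) holomorphic_on_imp_continuous_on continuous_on_subset by blast
    ultimately have "bounded (H N ` (complex_of_real ` {0..1}))"
      using compact_continuous_image compact_imp_bounded by blast
    then obtain C where "\<forall>x\<in>H N ` (complex_of_real ` {0..1}). norm x \<le> C" unfolding bounded_iff by blast
    then have C: "\<And>u. u \<in> {0..1} \<Longrightarrow> norm (H N (of_real u)) \<le> C" by blast
    have "norm (h (of_real (1 / y)) - (\<Sum>n<N. c n / of_real y ^ n)) \<le> C / y ^ N" if y: "y \<ge> 1" for y
    proof -
      have "h (of_real (1 / y)) - (\<Sum>n<N. c n / of_real y ^ n) = of_real (1 / y) ^ N * H N (of_real (1 / y))"
        using ex[of "of_real (1 / y)" N] y by (simp add: power_divide)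
      then have "norm (h (of_real (1 / y)) - (\<Sum>n<N. c n / of_real y ^ n)) = (1 / y) ^ N * norm (H N (of_real (1 / y)))"
        using y by (simp add: norm_mult norm_power norm_divide)
      also have "\<dots> \<le> (1 / y) ^ N * C" using y by (intro mult_left_mono C) auto
      finally show ?thesis by (simp add: power_divide)
    qed
    then show "\<exists>C. \<forall>y\<ge>1. norm (h (of_real (1 / y)) - (\<Sum>n<N. c n / of_real y ^ n)) \<le> C / y ^ N" by blast
  qed
  then show ?thesis by blast
qed

lemma asymptotic_expansion_cong:
  assumes "\<And>y. y \<ge> 1 \<Longrightarrow> g y = h y"
  shows "asymptotic_expansion g c \<longleftrightarrow> asymptotic_expansion h c"
proof -
  have "continuous_on {1..} g \<longleftrightarrow> continuous_on {1..} h" by (rule continuous_on_cong) (auto simp: assms)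
  then show ?thesis unfolding asymptotic_expansion_def by (simp add: assms)
qed

text \<open>The coefficients are hidden under a quantifier so that sums over many forms need no
  bookkeeping. Decay of order m gives convergence of the Mellin integral for Re w < m.\<close>

definition tame_expansion :: "nat \<Rightarrow> (real \<Rightarrow> complex) \<Rightarrow> bool" where
  "tame_expansion m g \<longleftrightarrow> (\<exists>c. asymptotic_expansion g c) \<and> (\<exists>C. \<forall>y\<ge>1. norm (g y) \<le> C / y ^ m)"

lemma tame_expansion_add:
  assumes "tame_expansion m g" "tame_expansion m h"
  shows "tame_expansion m (\<lambda>y. g y + h y)"
proof -
  obtain C E where "\<And>y. y \<ge> 1 \<Longrightarrow> norm (g y) \<le> C / y ^ m" "\<And>y. y \<ge> 1 \<Longrightarrow> norm (h y) \<le> E / y ^ m"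
    using assms unfolding tame_expansion_def by meson
  then have "\<forall>y\<ge>1. norm (g y + h y) \<le> (C + E) / y ^ m"
    by (auto simp: add_divide_distrib intro!: norm_triangle_mono)
  then show ?thesis using assms asymptotic_expansion_add unfolding tame_expansion_def by blast
qed

lemma tame_expansion_cmult:
  assumes "tame_expansion m g"
  shows "tame_expansion m (\<lambda>y. a * g y)"
proof -
  obtain C where C: "\<And>y. y \<ge> 1 \<Longrightarrow> norm (g y) \<le> C / y ^ m"
    using assms unfolding tame_expansion_def by meson
  have "norm (a * g y) \<le> (norm a * C) / y ^ m" if "y \<ge> 1" for y
    using mult_left_mono[OF C[OF that], of "norm a"] by (simp add: norm_mult)
  then show ?thesis using assms asymptotic_expansion_cmult unfolding tame_expansion_def by blast
qed

lemma tame_expansion_zero: "tame_expansion m (\<lambda>y. 0)"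
  unfolding tame_expansion_def using asymptotic_expansion_zero by (auto intro!: exI[of _ 0])

lemma tame_expansion_sum:
  assumes "\<And>x. x \<in> A \<Longrightarrow> tame_expansion m (g x)"
  shows "tame_expansion m (\<lambda>y. \<Sum>x\<in>A. g x y)"
  using assms
  by (induction A rule: infinite_finite_induct) (auto intro: tame_expansion_zero tame_expansion_add)

lemma tame_expansion_integrable:
  assumes "tame_expansion m g" "Re w < real m"
  shows "set_integrable lborel {1..} (\<lambda>y. g y * complex_of_real y powr w / of_real y)"
proof -
  obtain c C where c: "asymptotic_expansion g c" and C: "\<And>y. y \<ge> 1 \<Longrightarrow> norm (g y) \<le> C / y ^ m"
    using assms unfolding tame_expansion_def by meson
  have "norm (g y) \<le> C * y powr (- real m)" if "y \<ge> 1" for y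
    using C[OF that] that by (simp add: powr_minus powr_realpow field_simps)
  from set_integrable_tail_bound[OF expansion_cont[OF c] this] show ?thesis using assms(2) by simp
qed

text \<open>With u = 1/y, Q(iy) = y^2 P(u), and for A > 0 > C the real part -A + C u^2 of P is
  negative on [0, 1]. So 1/P^k is holomorphic near the segment, and u^(2k) supplies the
  decay.\<close>

lemma tame_expansion_quadratic:
  assumes "A > 0" "C < 0"
  shows "tame_expansion (2 * k) (\<lambda>y. 1 / bqf_eval (A, B, C) (\<i> * of_real y) 1 ^ k)"
proof -
  define P where "P u = - of_real A + \<i> * of_real B * u + of_real C * u\<^sup>2" for u :: complex
  define S where "S = {u. P u \<noteq> 0}"
  have S: "open S" unfolding S_def P_def by (intro open_Collect_neq continuous_intros)
  have sub: "complex_of_real ` {0..1} \<subseteq> S"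
  proof
    fix x assume "x \<in> complex_of_real ` {0..1}"
    then obtain t where t: "x = of_real t" by auto
    have "Re (P x) = - A + C * t\<^sup>2" by (simp add: P_def t power2_eq_square)
    also have "\<dots> < 0" using assms by (smt (verit) mult_nonpos_nonneg zero_le_power2)
    finally show "x \<in> S" by (auto simp: S_def)
  qed
  have h1: "(\<lambda>u. 1 / P u ^ k) holomorphic_on S"
    unfolding P_def S_def by (intro holomorphic_intros) auto
  have h2: "(\<lambda>u. u ^ (2 * k) * (1 / P u ^ k)) holomorphic_on S"
    by (intro holomorphic_intros h1)
  have eq: "1 / bqf_eval (A, B, C) (\<i> * of_real y) 1 ^ k = of_real (1 / y) ^ (2 * k) * (1 / P (of_real (1 / y)) ^ k)"
    if y: "y \<ge> 1" for y
  proof -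
    have y0: "complex_of_real y \<noteq> 0" using y by auto
    have "bqf_eval (A, B, C) (\<i> * of_real y) 1 = of_real y ^ 2 * P (of_real (1 / y))"
      using y0 by (simp add: bqf_eval_def P_def power2_eq_square field_simps)
    then show ?thesis by (simp add: power_mult_distrib power_mult power_divide)
  qed
  obtain c where c: "asymptotic_expansion (\<lambda>y. of_real (1 / y) ^ (2 * k) * (1 / P (of_real (1 / y)) ^ k)) c"
    using asymptotic_expansion_holomorphic[OF S h2 sub] by blast
  have "asymptotic_expansion (\<lambda>y. 1 / bqf_eval (A, B, C) (\<i> * of_real y) 1 ^ k) c"
    using c asymptotic_expansion_cong[OF eq] by simp
  moreover have "\<exists>K. \<forall>y\<ge>1. norm (1 / bqf_eval (A, B, C) (\<i> * of_real y) 1 ^ k) \<le> K / y ^ (2 * k)"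
  proof -
    have "continuous_on (complex_of_real ` {0..1}) (\<lambda>u. 1 / P u ^ k)"
      using h1 sub holomorphic_on_imp_continuous_on continuous_on_subset by blast
    moreover have "compact (complex_of_real ` {0..1})"
      by (intro compact_continuous_image continuous_intros) auto
    ultimately have "bounded ((\<lambda>u. 1 / P u ^ k) ` (complex_of_real ` {0..1}))"
      using compact_continuous_image compact_imp_bounded by blast
    then obtain K where "\<forall>x\<in>(\<lambda>u. 1 / P u ^ k) ` (complex_of_real ` {0..1}). norm x \<le> K" unfolding bounded_iff by blast
    then have K: "\<And>u. u \<in> {0..1} \<Longrightarrow> norm (1 / P (of_real u) ^ k) \<le> K" by blast
    have "norm (1 / bqf_eval (A, B, C) (\<i> * of_real y) 1 ^ k) \<le> K / y ^ (2 * k)" if y: "y \<ge> 1" for y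
    proof -
      have "norm (1 / bqf_eval (A, B, C) (\<i> * of_real y) 1 ^ k) = (1 / y) ^ (2 * k) * norm (1 / P (of_real (1 / y)) ^ k)"
        unfolding eq[OF y] norm_mult norm_power norm_of_real using y by simp
      also have "\<dots> \<le> (1 / y) ^ (2 * k) * K" using y by (intro mult_left_mono K) auto
      finally show ?thesis by (simp add: power_divide)
    qed
    then show ?thesis by blast
  qed
  ultimately show ?thesis unfolding tame_expansion_def by blast
qed

lemma asymptotic_expansion_poly:
  assumes "\<And>n. n > M \<Longrightarrow> e n = 0"
  shows "asymptotic_expansion (\<lambda>y. \<Sum>n\<le>M. e n / of_real y ^ n) e"
  unfolding asymptotic_expansion_def
proof (intro conjI allI)
  show "continuous_on {1..} (\<lambda>y. \<Sum>n\<le>M. e n / complex_of_real y ^ n)"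
    by (intro continuous_intros) auto
  fix N
  have "norm ((\<Sum>n\<le>M. e n / of_real y ^ n) - (\<Sum>n<N. e n / of_real y ^ n)) \<le> (\<Sum>n\<le>M. norm (e n)) / y ^ N" if y: "y \<ge> 1" for y
  proof -
    have 1: "(\<Sum>n<N. e n / of_real y ^ n) = (\<Sum>n\<in>{..M} \<inter> {..<N}. e n / of_real y ^ n)"
      by (rule sum.mono_neutral_right) (use assms in auto)
    have 2: "(\<Sum>n\<le>M. e n / complex_of_real y ^ n) = (\<Sum>n\<in>{..M} \<inter> {..<N}. e n / of_real y ^ n) + (\<Sum>n\<in>{..M} - {..<N}. e n / of_real y ^ n)"
      by (rule sum.Int_Diff) auto
    have "norm ((\<Sum>n\<le>M. e n / of_real y ^ n) - (\<Sum>n<N. e n / of_real y ^ n)) = norm (\<Sum>n\<in>{..M} - {..<N}. e n / of_real y ^ n)"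
      unfolding 1 2 by simp
    also have "\<dots> \<le> (\<Sum>n\<in>{..M} - {..<N}. norm (e n) / y ^ N)"
    proof (rule sum_norm_le)
      fix n assume "n \<in> {..M} - {..<N}"
      then have "y ^ N \<le> y ^ n" using y by (intro power_increasing) auto
      then have "norm (e n) / y ^ n \<le> norm (e n) / y ^ N" using y by (intro divide_left_mono) auto
      then show "norm (e n / of_real y ^ n) \<le> norm (e n) / y ^ N" using y by (simp add: norm_divide norm_power)
    qed
    also have "\<dots> \<le> (\<Sum>n\<le>M. norm (e n) / y ^ N)" using y by (intro sum_mono2) auto
    finally show ?thesis by (simp add: sum_divide_distrib)
  qed
  then show "\<exists>C. \<forall>y\<ge>1. norm ((\<Sum>n\<le>M. e n / of_real y ^ n) - (\<Sum>n<N. e n / of_real y ^ n)) \<le> C / y ^ N" by blast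
qed

text \<open>Taking \<open>N\<close> beyond the last coefficient leaves the remainder 0, so the
  continuation is an explicit rational function.\<close>

lemma mellin_cont_poly:
  assumes "\<And>n. n > M \<Longrightarrow> e n = 0"
  shows "mellin_cont (\<lambda>y. \<Sum>n\<le>M. e n / of_real y ^ n) e w = (\<Sum>n\<le>M. e n / (of_nat n - w))"
proof -
  define N where "N = max (Suc M) (nat (\<lfloor>Re w\<rfloor> + 1))"
  have "Re w < real (nat (\<lfloor>Re w\<rfloor> + 1))" by linarith
  then have N: "Re w < real N" "M < N" unfolding N_def by auto
  have s: "(\<Sum>n<N. e n * f n) = (\<Sum>n\<le>M. e n * f n)" for f :: "nat \<Rightarrow> complex"
    by (rule sum.mono_neutral_right) (use N assms in auto)
  have "expansion_rem (\<lambda>y. \<Sum>n\<le>M. e n / of_real y ^ n) e N y = 0" for y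
    unfolding expansion_rem_def using s[of "\<lambda>n. 1 / of_real y ^ n"] by simp
  then have "tail_mellin (expansion_rem (\<lambda>y. \<Sum>n\<le>M. e n / of_real y ^ n) e N) w = 0"
    unfolding tail_mellin_def by (simp add: set_lebesgue_integral_def)
  then show ?thesis
    using s[of "\<lambda>n. 1 / (of_nat n - w)"] mellin_cont_eq[OF asymptotic_expansion_poly, OF assms N(1)] by simp
qed

text \<open>If G z were 0, f would have the finite limit G'(z) at z, contrary to the pole.\<close>

lemma simple_pole_zorder:
  assumes G: "G analytic_on {z}" and f: "\<forall>\<^sub>F w in at z. f w = G w / (w - z)" and pole: "is_pole f z"
  shows "zorder f z = - 1"
proof -
  obtain S where S: "open S" "z \<in> S" "G holomorphic_on S" using G analytic_at by blast
  obtain S2 where S2: "open S2" "z \<in> S2" "\<And>w. w \<in> S2 \<Longrightarrow> w \<noteq> z \<Longrightarrow> f w = G w / (w - z)"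
    using f unfolding eventually_at_topological by blast
  have "G z \<noteq> 0"
  proof
    assume "G z = 0"
    have "(G has_field_derivative deriv G z) (at z)" using S holomorphic_derivI by blast
    then have "((\<lambda>w. (G w - G z) / (w - z)) \<longlongrightarrow> deriv G z) (at z)" by (simp add: has_field_derivative_iff)
    then have "((\<lambda>w. G w / (w - z)) \<longlongrightarrow> deriv G z) (at z)" using \<open>G z = 0\<close> by simp
    then have "(f \<longlongrightarrow> deriv G z) (at z)"
      by (rule Lim_transform_eventually) (use f in \<open>auto elim: eventually_mono\<close>)
    then show False using pole unfolding is_pole_def
      by (meson at_neq_bot not_tendsto_and_filterlim_at_infinity)
  qed
  then show ?thesis
    by (intro zorder_eqI[of "S \<inter> S2" z G])
       (use S S2 in \<open>auto intro: holomorphic_on_subset simp: power_int_minus field_simps\<close>)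
qed

text \<open>\<open>remove_sings\<close> repairs the default values at the points s = 2k - n, as
  \<open>nicely_meromorphic_on\<close> demands. On \<open>E_domain\<close> the function is analytic,
  so nothing changes there.\<close>

lemma E_continuation:
  assumes c: "asymptotic_expansion (\<lambda>y. g (\<i> * of_real y)) c"
  shows "meromorphic_continuation (E_int k g) (E_domain k g)
           (remove_sings (\<lambda>s. - mellin_cont (\<lambda>y. g (\<i> * of_real y)) c (2 * of_nat k - s)))"
  unfolding meromorphic_continuation_def
proof (intro conjI ballI)
  have "(\<lambda>s. - mellin_cont (\<lambda>y. g (\<i> * of_real y)) c (2 * of_nat k - s)) meromorphic_on UNIV"
    by (intro meromorphic_intros meromorphic_on_compose[OF mellin_cont_meromorphic[OF c]]) (auto intro!: analytic_intros)
  then show "remove_sings (\<lambda>s. - mellin_cont (\<lambda>y. g (\<i> * of_real y)) c (2 * of_nat k - s)) nicely_meromorphic_on UNIV"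
    by (rule remove_sings_nicely_meromorphic)
  fix s assume "s \<in> E_domain k g"
  then have I: "set_integrable lborel {1..} (\<lambda>y. g (\<i> * of_real y) * of_real y powr (2 * of_nat k - s) / of_real y)"
    by (simp add: E_domain_def mellin_integrand_def[abs_def])
  have an: "mellin_cont (\<lambda>y. g (\<i> * of_real y)) c analytic_on {2 * of_nat k - s}"
    by (rule mellin_cont_eq_tail_mellin(2)[OF c I])
  have "(\<lambda>s. - mellin_cont (\<lambda>y. g (\<i> * of_real y)) c (2 * of_nat k - s)) analytic_on {s}"
    by (intro analytic_on_neg analytic_on_compose[of "\<lambda>s. 2 * of_nat k - s" _ "mellin_cont (\<lambda>y. g (\<i> * of_real y)) c", unfolded o_def])
       (use an in \<open>auto intro!: analytic_intros\<close>)
  then show "remove_sings (\<lambda>s. - mellin_cont (\<lambda>y. g (\<i> * of_real y)) c (2 * of_nat k - s)) s = E_int k g s"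
    using mellin_cont_eq_tail_mellin(1)[OF c I]
    by (simp add: E_int_def tail_mellin_def mellin_integrand_def[abs_def])
qed

text \<open>A single term of the exponential series handles y \<ge> 1; the summand 1 in
  \<open>M\<close> covers y < 1, where y^\<kappa> \<le> 1.\<close>

lemma exp_neg_le_powr:
  fixes c \<kappa> :: real
  assumes c: "c > 0" and k: "\<kappa> \<ge> 0"
  obtains M where "M \<ge> 0" "\<And>y. y > 0 \<Longrightarrow> exp (- c * y) \<le> M * y powr (- \<kappa>)"
proof -
  define N where "N = nat \<lceil>\<kappa>\<rceil>"
  have N: "\<kappa> \<le> real N" unfolding N_def by linarith
  define M where "M = 1 + fact N / c ^ N"
  have "exp (- c * y) \<le> M * y powr (- \<kappa>)" if y: "y > 0" for y
  proof -
    have "(\<Sum>n\<in>{N}. (c * y) ^ n /\<^sub>R fact n) \<le> (\<Sum>n. (c * y) ^ n /\<^sub>R fact n)"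
      using c y by (intro sum_le_suminf summable_exp_generic) auto
    then have "(c * y) ^ N / fact N \<le> exp (c * y)" by (simp add: exp_def divide_inverse mult.commute)
    then have 1: "y ^ N \<le> fact N / c ^ N * exp (c * y)"
      using c by (simp add: field_simps power_mult_distrib)
    have "y powr \<kappa> \<le> 1 + y ^ N"
    proof (cases "y \<ge> 1")
      case True
      then have "y powr \<kappa> \<le> y powr real N" using N by (intro powr_mono) auto
      then show ?thesis using y by (simp add: powr_realpow)
    next
      case False
      then have "y powr \<kappa> \<le> 1" using k y by (intro powr_le1) auto
      then show ?thesis using y by (smt (verit) zero_le_power)
    qed
    also have "\<dots> \<le> exp (c * y) + fact N / c ^ N * exp (c * y)" using 1 c y by (intro add_mono) auto
    also have "\<dots> = M * exp (c * y)" by (simp add: M_def algebra_simps)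
    finally have "y powr \<kappa> \<le> M * exp (c * y)" .
    then have "y powr \<kappa> * exp (- c * y) \<le> M" by (simp add: exp_minus field_simps)
    then show ?thesis using y by (simp add: powr_minus field_simps)
  qed
  moreover have "M \<ge> 0" unfolding M_def using c by simp
  ultimately show ?thesis using that by blast
qed

lemma set_lborel_split_at_1:
  fixes f :: "real \<Rightarrow> complex"
  assumes "set_integrable lborel {0<..} f"
  shows "set_integrable lborel {0<..1} f" "set_integrable lborel {1..} f"
    "(LINT y:{0<..}|lborel. f y) = (LINT y:{0<..1}|lborel. f y) + (LINT y:{1..}|lborel. f y)"
proof -
  show 1: "set_integrable lborel {0<..1} f" and 2: "set_integrable lborel {1..} f"
    by (rule set_integrable_subset[OF assms]; auto)+
  have "(LINT y:{0<..}|lborel. f y) = (\<integral>y. indicat_real {0<..1} y *\<^sub>R f y + indicat_real {1..} y *\<^sub>R f y \<partial>lborel)"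
    unfolding set_lebesgue_integral_def
  proof (rule integral_cong_AE)
    show "(\<lambda>y. indicat_real {0<..} y *\<^sub>R f y) \<in> borel_measurable lborel"
      using assms by (simp add: set_integrable_def borel_measurable_integrable)
    show "(\<lambda>y. indicat_real {0<..1} y *\<^sub>R f y + indicat_real {1..} y *\<^sub>R f y) \<in> borel_measurable lborel"
      using 1 2 by (intro borel_measurable_add) (simp_all add: set_integrable_def borel_measurable_integrable)
    show "AE y in lborel. indicat_real {0<..} y *\<^sub>R f y = indicat_real {0<..1} y *\<^sub>R f y + indicat_real {1..} y *\<^sub>R f y"
      using AE_lborel_singleton[of 1] by eventually_elim (auto simp: indicator_def)
  qed
  also have "\<dots> = (LINT y:{0<..1}|lborel. f y) + (LINT y:{1..}|lborel. f y)"
    unfolding set_lebesgue_integral_def using 1 2 by (intro Bochner_Integration.integral_add) (auto simp: set_integrable_def)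
  finally show "(LINT y:{0<..}|lborel. f y) = (LINT y:{0<..1}|lborel. f y) + (LINT y:{1..}|lborel. f y)" .
qed

text \<open>Behind the bound is the identity |Q(z)|^2 = (A|z|^2 + Bx + C)^2 + D y^2 for z = x +
  iy.\<close>

lemma bqf_eval_lower_bound:
  assumes D: "bqf_disc Q > 0" and z: "Im z > 0"
  shows "sqrt (bqf_disc Q) * Im z \<le> norm (bqf_eval Q z 1)"
proof -
  obtain A B C where Q: "Q = (A, B, C)" by (cases Q)
  define x y where "x = Re z" and "y = Im z"
  have zz: "z = Complex x y" by (simp add: x_def y_def)
  have "(norm (bqf_eval Q z 1))\<^sup>2 = (A * x\<^sup>2 + B * x + C + A * y\<^sup>2)\<^sup>2 + bqf_disc Q * y\<^sup>2"
  proof -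
    have re: "Re (bqf_eval Q z 1) = A * (x\<^sup>2 - y\<^sup>2) + B * x + C" and im: "Im (bqf_eval Q z 1) = 2 * A * x * y + B * y"
      by (simp_all add: Q zz bqf_eval_def power2_eq_square algebra_simps)
    show ?thesis unfolding cmod_power2 re im by (simp add: Q bqf_disc_def power2_eq_square algebra_simps)
  qed
  then have "bqf_disc Q * y\<^sup>2 \<le> (norm (bqf_eval Q z 1))\<^sup>2" by simp
  then have "sqrt (bqf_disc Q * y\<^sup>2) \<le> norm (bqf_eval Q z 1)" by (rule real_le_lsqrt[OF norm_ge_zero])
  then show ?thesis using z by (simp add: real_sqrt_mult y_def)
qed

section \<open>The period integral\<close>

lemma mellin_kernel_inversion:
  fixes X s :: complex
  assumes y: "y > 0"
  shows "of_real y ^ (2 * k) * X * complex_of_real (1 / y) powr s / of_real (1 / y) / of_real y ^ 2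
    = X * complex_of_real y powr (2 * of_nat k - s) / of_real y"
proof -
  define W where "W = complex_of_real y powr s"
  define Y where "Y = complex_of_real y"
  have nz: "W \<noteq> 0" "Y \<noteq> 0" using y by (auto simp: W_def Y_def)
  have "complex_of_real (1 / y) powr s * W = (of_real (1 / y) * of_real y) powr s"
    unfolding W_def using y by (subst powr_times_real) auto
  then have 1: "complex_of_real (1 / y) powr s = 1 / W" using y nz by (simp add: field_simps)
  have 2: "complex_of_real y powr (2 * of_nat k - s) = Y ^ (2 * k) / W"
    unfolding W_def Y_def using y powr_nat'[of "complex_of_real y" "2 * k"] by (simp add: powr_diff)
  have 3: "complex_of_real (1 / y) = 1 / Y" by (simp add: Y_def)
  show ?thesis unfolding 1 2 unfolding 3 Y_def[symmetric] using nz by (simp add: field_simps power2_eq_square)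
qed

lemma holomorphic_cpow:
  "(\<lambda>s. cpow z (s - c)) holomorphic_on A"
  unfolding cpow_def by (cases "z = 0") (auto intro!: holomorphic_intros)

context
  fixes p :: nat
  assumes p: "p \<ge> 3"
begin

lemma hecke_lambda_bounds: "0 < hecke_lambda p" "hecke_lambda p < 2"
proof -
  have "pi / real p \<le> pi / 3" using p by (intro divide_left_mono) auto
  moreover have "0 < pi / real p" using p by simp
  ultimately have a: "0 < pi / real p" "pi / real p \<le> pi / 3" by auto
  then have b: "pi / real p < pi / 2" using pi_gt_zero by linarith
  show "0 < hecke_lambda p" unfolding hecke_lambda_def using a b by (intro mult_pos_pos cos_gt_zero_pi) auto
  have "pi / real p \<le> pi" using b pi_gt_zero by linarith
  from cos_monotone_0_pi[OF order_refl a(1) this] have "cos (pi / real p) < cos 0" .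
  then show "hecke_lambda p < 2" by (simp add: hecke_lambda_def)
qed

text \<open>AC < 0 makes |B| smaller than the square root of the discriminant, so the two roots have
  opposite signs, as the choice of branches in \<open>period_integral\<close> presupposes.\<close>

lemma Z_class_form:
  assumes cl: "hyperbolic_class p \<A>" and al: "\<alpha> \<in> Z_class \<A>"
  obtains A B C where "(A, B, C) \<in> \<A>" "simple_bqf (A, B, C)" "\<alpha> = bqf_root (A, B, C)"
    "hyp_form p \<alpha> = (A, B, C)" "A > 0" "C < 0" "bqf_disc (A, B, C) > 0"
    "\<alpha> > 0" "hecke_conj p \<alpha> < 0" "A * (\<alpha> - hecke_conj p \<alpha>) = sqrt (bqf_disc (A, B, C))"
    "\<And>z :: complex. bqf_eval (A, B, C) z 1 = of_real A * (z - of_real \<alpha>) * (z - of_real (hecke_conj p \<alpha>))"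
proof -
  obtain Q where "Q \<in> \<A>" "simple_bqf Q" "\<alpha> = bqf_root Q" using al by (auto simp: Z_class_def)
  moreover obtain A B C where Q: "Q = (A, B, C)" by (cases Q)
  ultimately have Q': "(A, B, C) \<in> \<A>" "simple_bqf (A, B, C)" "\<alpha> = bqf_root (A, B, C)" by auto
  note hc = hyperbolic_class_simple[OF p cl Q'(1,2), folded Q'(3)]
  define r where "r = sqrt (bqf_disc (A, B, C))"
  have AC: "A > 0" "C < 0" using Q'(2) by (auto simp: simple_bqf_def)
  have r2: "r\<^sup>2 = B\<^sup>2 - 4 * A * C" using hc(2) by (simp add: r_def bqf_disc_def)
  have "A * C < 0" using AC by (rule mult_pos_neg)
  then have "\<bar>B\<bar>\<^sup>2 < r\<^sup>2" using r2 by simp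
  then have Br: "\<bar>B\<bar> < r" by (rule power2_less_imp_less) (use hc(2) in \<open>simp add: r_def\<close>)
  have a: "2 * A * \<alpha> = - B + r" using AC by (simp add: Q'(3) bqf_root_def r_def)
  have b: "2 * A * hecke_conj p \<alpha> = - B - r" using AC by (simp add: hc(3) r_def)
  have apos: "\<alpha> > 0" using a Br AC by (smt (verit) mult_nonneg_nonpos mult_pos_pos)
  have bneg: "hecke_conj p \<alpha> < 0" using b Br AC by (smt (verit) mult_nonneg_nonneg mult_pos_pos)
  have ar: "A * (\<alpha> - hecke_conj p \<alpha>) = r" using a b by (simp add: algebra_simps)
  have s: "A * (\<alpha> + hecke_conj p \<alpha>) = - B" using a b by (simp add: algebra_simps)
  have pr: "A * \<alpha> * hecke_conj p \<alpha> = C"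
  proof -
    have "4 * A * (A * \<alpha> * hecke_conj p \<alpha>) = (2 * A * \<alpha>) * (2 * A * hecke_conj p \<alpha>)" by simp
    also have "\<dots> = B\<^sup>2 - r\<^sup>2" unfolding a b by (simp add: power2_eq_square algebra_simps)
    also have "\<dots> = 4 * A * C" using r2 by simp
    finally show ?thesis using AC by simp
  qed
  have ev: "bqf_eval (A, B, C) z 1 = of_real A * (z - of_real \<alpha>) * (z - of_real (hecke_conj p \<alpha>))" for z :: complex
  proof -
    have "of_real A * (z - of_real \<alpha>) * (z - of_real (hecke_conj p \<alpha>))
      = of_real A * z\<^sup>2 - of_real (A * (\<alpha> + hecke_conj p \<alpha>)) * z + of_real (A * \<alpha> * hecke_conj p \<alpha>)"
      by (simp add: power2_eq_square algebra_simps)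
    then show ?thesis unfolding s pr by (simp add: bqf_eval_def)
  qed
  show ?thesis using that[OF Q' hc(1) AC hc(2) apos bneg ar[unfolded r_def] ev] by blast
qed

text \<open>\<open>hyp_form\<close> inverts \<open>bqf_root\<close> on the simple forms of the
  class, so \<open>bqf_root\<close> is injective there.\<close>

lemma simple_forms_sum:
  fixes f :: "bqf \<Rightarrow> complex"
  assumes cl: "hyperbolic_class p \<A>"
  shows "(\<Sum>\<alpha>\<in>Z_class \<A>. f (hyp_form p \<alpha>)) = (\<Sum>Q\<in>{Q \<in> \<A>. simple_bqf Q}. f Q)"
proof -
  have hf: "hyp_form p (bqf_root Q) = Q" if "Q \<in> {Q \<in> \<A>. simple_bqf Q}" for Q
    using hyperbolic_class_simple(1)[OF p cl] that by (cases Q) auto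
  then have "inj_on bqf_root {Q \<in> \<A>. simple_bqf Q}" by (rule inj_on_inverseI)
  then have "(\<Sum>\<alpha>\<in>Z_class \<A>. f (hyp_form p \<alpha>)) = (\<Sum>Q\<in>{Q \<in> \<A>. simple_bqf Q}. f (hyp_form p (bqf_root Q)))"
    unfolding Z_class_def by (rule sum.reindex_cong) auto
  also have "\<dots> = (\<Sum>Q\<in>{Q \<in> \<A>. simple_bqf Q}. f Q)"
    by (rule sum.cong[OF refl]) (simp only: hf)
  finally show ?thesis .
qed

text \<open>The map \<phi>, (A, B, C) \<mapsto> (-C, B, -A), sends Q to -(Q \<circ> T). It is an
  involution of the simple forms of a class equal to its negative, and \<phi>(Q) at iy equals y^2
  times Q at i/y.\<close>

lemma class_sum_inversion:
  assumes cl: "hyperbolic_class p \<A>" and neg: "bqf_neg ` \<A> = \<A>" and y: "y > 0"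
  shows "(\<Sum>\<alpha>\<in>Z_class \<A>. 1 / bqf_eval (hyp_form p \<alpha>) (\<i> * of_real (1 / y)) 1 ^ k)
    = of_real y ^ (2 * k) * (\<Sum>\<alpha>\<in>Z_class \<A>. 1 / bqf_eval (hyp_form p \<alpha>) (\<i> * of_real y) 1 ^ k)"
proof -
  define S where "S = {Q \<in> \<A>. simple_bqf Q}"
  define \<phi> :: "bqf \<Rightarrow> bqf" where "\<phi> = (\<lambda>(A, B, C). (- C, B, - A))"
  have inv: "\<phi> (\<phi> Q) = Q" for Q by (cases Q) (simp add: \<phi>_def)
  have S\<phi>: "\<phi> Q \<in> S" if QS: "Q \<in> S" for Q
  proof -
    obtain A B C where Q: "Q = (A, B, C)" by (cases Q)
    obtain Q1 where Q1: "\<A> = bqf_act Q1 ` hecke_group p"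
      using cl by (auto simp: hyperbolic_class_def bqf_class_def)
    obtain M where M: "M \<in> hecke_group p" "Q = bqf_act Q1 M" using QS Q1 by (auto simp: S_def)
    have "bqf_act Q hecke_T = bqf_act Q1 (M ** hecke_T)" unfolding M(2) by (rule bqf_act_mult)
    then have "bqf_act Q hecke_T \<in> \<A>" unfolding Q1 using M(1) hecke_group.mult hecke_group.gen_T by blast
    then have "bqf_neg (bqf_act Q hecke_T) \<in> \<A>" using neg by blast
    then show ?thesis using QS by (simp add: S_def Q \<phi>_def bqf_act_def bqf_neg_def hecke_T_eq simple_bqf_def)
  qed
  have ev: "1 / bqf_eval Q (\<i> * of_real (1 / y)) 1 ^ k = of_real y ^ (2 * k) * (1 / bqf_eval (\<phi> Q) (\<i> * of_real y) 1 ^ k)" for Q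
  proof -
    obtain A B C where Q: "Q = (A, B, C)" by (cases Q)
    have "bqf_eval (\<phi> Q) (\<i> * of_real y) 1 = of_real y ^ 2 * bqf_eval Q (\<i> * of_real (1 / y)) 1"
      using y by (simp add: Q \<phi>_def bqf_eval_def power2_eq_square field_simps)
    then show ?thesis using y by (simp add: power_mult_distrib power_mult)
  qed
  have "(\<Sum>\<alpha>\<in>Z_class \<A>. 1 / bqf_eval (hyp_form p \<alpha>) (\<i> * of_real (1 / y)) 1 ^ k) = (\<Sum>Q\<in>S. 1 / bqf_eval Q (\<i> * of_real (1 / y)) 1 ^ k)"
    unfolding S_def by (rule simple_forms_sum[OF cl])
  also have "\<dots> = of_real y ^ (2 * k) * (\<Sum>Q\<in>S. 1 / bqf_eval (\<phi> Q) (\<i> * of_real y) 1 ^ k)"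
    unfolding ev sum_distrib_left ..
  also have "(\<Sum>Q\<in>S. 1 / bqf_eval (\<phi> Q) (\<i> * of_real y) 1 ^ k) = (\<Sum>Q\<in>S. 1 / bqf_eval Q (\<i> * of_real y) 1 ^ k)"
    by (rule sum.reindex_bij_witness[of _ \<phi> \<phi>]) (use inv S\<phi> in auto)
  also have "\<dots> = (\<Sum>\<alpha>\<in>Z_class \<A>. 1 / bqf_eval (hyp_form p \<alpha>) (\<i> * of_real y) 1 ^ k)"
    unfolding S_def by (rule simple_forms_sum[OF cl, symmetric])
  finally show ?thesis .
qed

definition period_term :: "nat \<Rightarrow> real \<Rightarrow> complex \<Rightarrow> complex" where
  "period_term k \<alpha> s = (let \<alpha>' = hecke_conj p \<alpha>;
                x = of_real (\<alpha>' / (\<alpha>' - \<alpha>));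
                \<kappa> = of_nat k
            in cpow (of_real \<alpha>) (s - \<kappa>) * Beta (2 * \<kappa> - s) (s - \<kappa>) *
                 hyp_2F1 \<kappa> (1 - \<kappa>) (\<kappa> - s + 1) x
             + cpow (of_real \<alpha>') (s - \<kappa>) * Beta s (\<kappa> - s) *
                 hyp_2F1 \<kappa> (1 - \<kappa>) (s - \<kappa> + 1) x)"

lemma R_fun_eq:
  "R_fun p k L \<A> D d s = - (\<Sum>l=1..L. d l * of_real (D l powr (- real k / 2)) * cpow \<i> s * (\<Sum>\<alpha>\<in>Z_class (\<A> l). period_term k \<alpha> s))"
  unfolding R_fun_def period_term_def ..

lemma class_period:
  assumes cl: "hyperbolic_class p \<A>" and al: "\<alpha> \<in> Z_class \<A>" and D: "\<And>Q. Q \<in> \<A> \<Longrightarrow> bqf_disc Q = D"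
    and k: "odd k" and s: "0 < Re s" "Re s < 1"
  shows "set_integrable lborel {0<..} (\<lambda>y. 1 / bqf_eval (hyp_form p \<alpha>) (\<i> * of_real y) 1 ^ k * of_real y powr s / of_real y)"
    and "(LINT y:{0<..}|lborel. 1 / bqf_eval (hyp_form p \<alpha>) (\<i> * of_real y) 1 ^ k * of_real y powr s / of_real y)
      = of_real (D powr (- real k / 2)) * cpow \<i> s * period_term k \<alpha> s"
proof -
  obtain A B C where Q: "(A, B, C) \<in> \<A>" "hyp_form p \<alpha> = (A, B, C)" "A > 0" "bqf_disc (A, B, C) > 0"
    "\<alpha> > 0" "hecke_conj p \<alpha> < 0" "A * (\<alpha> - hecke_conj p \<alpha>) = sqrt (bqf_disc (A, B, C))"
    "\<And>z :: complex. bqf_eval (A, B, C) z 1 = of_real A * (z - of_real \<alpha>) * (z - of_real (hecke_conj p \<alpha>))"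
    using Z_class_form[OF cl al] by metis
  note pi = period_integral[OF k Q(3,5,6) s]
  show "set_integrable lborel {0<..} (\<lambda>y. 1 / bqf_eval (hyp_form p \<alpha>) (\<i> * of_real y) 1 ^ k * of_real y powr s / of_real y)"
    unfolding Q(2,8) by (rule pi(1))
  have DD: "bqf_disc (A, B, C) = D" "D > 0" using D[OF Q(1)] Q(4) by auto
  have "D powr (- real k / 2) = 1 / sqrt D ^ k"
  proof -
    have "D powr (- real k / 2) = (D powr (1 / 2)) powr (- real k)" by (simp add: powr_powr)
    also have "\<dots> = sqrt D powr (- real k)" using DD by (simp add: powr_half_sqrt)
    also have "\<dots> = 1 / sqrt D powr real k" by (rule powr_minus_divide)
    also have "sqrt D powr real k = sqrt D ^ k" by (rule powr_realpow) (use DD in simp)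
    finally show ?thesis .
  qed
  then show "(LINT y:{0<..}|lborel. 1 / bqf_eval (hyp_form p \<alpha>) (\<i> * of_real y) 1 ^ k * of_real y powr s / of_real y)
      = of_real (D powr (- real k / 2)) * cpow \<i> s * period_term k \<alpha> s"
    unfolding Q(2,8) pi(2) Q(7) DD(1) period_term_def Let_def by simp
qed

text \<open>At nonintegral s no Gamma argument is a nonpositive integer and no Pochhammer symbol in
  a denominator vanishes.\<close>

lemma period_term_holomorphic:
  assumes "k > 0"
  shows "period_term k \<alpha> holomorphic_on - \<int>"
proof -
  obtain n where n: "k = Suc n" using assms by (cases k) auto
  have k1: "(1 - of_nat k :: complex) = - of_nat n" by (simp add: n)
  have Z: "of_int m + s \<notin> \<int>" "of_int m - s \<notin> \<int>" if "s \<notin> \<int>" for m and s :: complex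
  proof -
    show "of_int m + s \<notin> \<int>" using that Ints_diff[of "of_int m + s" "of_int m"] by auto
    show "of_int m - s \<notin> \<int>" using that Ints_diff[of "of_int m" "of_int m - s"] by auto
  qed
  have Z': "s - of_nat k \<notin> \<int>" "2 * of_nat k - s \<notin> \<int>" "of_nat k - s \<notin> \<int>" "of_nat k - s + 1 \<notin> \<int>" "s - of_nat k + 1 \<notin> \<int>"
    if "s \<in> - \<int>" for s :: complex
    using Z(1)[of s "- int k"] Z(2)[of s "2 * int k"] Z(2)[of s "int k"] Z(2)[of s "int k + 1"] Z(1)[of s "1 - int k"] that
    by (simp_all add: algebra_simps)
  have nonpos: "z \<notin> \<int>\<^sub>\<le>\<^sub>0" if "z \<notin> \<int>" for z :: complex using that nonpos_Ints_subset_Ints by blast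
  show ?thesis
    unfolding period_term_def Let_def k1 hyp_2F1_eq_poly hypergeo_poly_def
    by (intro holomorphic_intros holomorphic_cpow holomorphic_pochhammer)
       (auto intro!: Z' nonpos pochhammer_nz)
qed

lemma R_fun_holomorphic:
  assumes "k > 0"
  shows "R_fun p k L \<A> D d holomorphic_on - \<int>"
proof -
  have "(\<lambda>s. cpow \<i> (s - 0)) holomorphic_on - \<int>" by (rule holomorphic_cpow)
  then have c: "cpow \<i> holomorphic_on - \<int>" by simp
  show ?thesis unfolding R_fun_eq[abs_def]
    by (intro holomorphic_intros c period_term_holomorphic assms)
qed

section \<open>The part of the period function that comes from quadratic forms\<close>

context
  fixes k L :: nat and \<A> :: "nat \<Rightarrow> bqf set" and D :: "nat \<Rightarrow> real" and d :: "nat \<Rightarrow> complex"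
  assumes k: "odd k"
    and cl: "\<And>l. l \<in> {1..L} \<Longrightarrow> hyperbolic_class p (\<A> l)"
    and neg: "\<And>l. l \<in> {1..L} \<Longrightarrow> bqf_neg ` \<A> l = \<A> l"
    and disc: "\<And>l Q. l \<in> {1..L} \<Longrightarrow> Q \<in> \<A> l \<Longrightarrow> bqf_disc Q = D l"
begin

lemma k_pos: "k > 0" using k by (cases k) auto

lemma q_star_inversion:
  assumes "y > 0"
  shows "q_star p k L \<A> d (\<i> * of_real (1 / y)) = of_real y ^ (2 * k) * q_star p k L \<A> d (\<i> * of_real y)"
proof -
  have "q_star p k L \<A> d (\<i> * of_real (1 / y)) =
    (\<Sum>l=1..L. of_real y ^ (2 * k) * (d l * (\<Sum>\<alpha>\<in>Z_class (\<A> l). 1 / bqf_eval (hyp_form p \<alpha>) (\<i> * of_real y) 1 ^ k)))"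
    unfolding q_star_def
  proof (rule sum.cong[OF refl])
    fix l assume l: "l \<in> {1..L}"
    show "d l * (\<Sum>\<alpha>\<in>Z_class (\<A> l). 1 / bqf_eval (hyp_form p \<alpha>) (\<i> * of_real (1 / y)) 1 ^ k) =
       of_real y ^ (2 * k) * (d l * (\<Sum>\<alpha>\<in>Z_class (\<A> l). 1 / bqf_eval (hyp_form p \<alpha>) (\<i> * of_real y) 1 ^ k))"
      unfolding class_sum_inversion[OF cl[OF l] neg[OF l] assms] by (simp only: mult_ac)
  qed
  also have "\<dots> = of_real y ^ (2 * k) * q_star p k L \<A> d (\<i> * of_real y)"
    unfolding q_star_def by (rule sum_distrib_left[symmetric])
  finally show ?thesis .
qed

lemma q_star_tame: "tame_expansion (2 * k) (\<lambda>y. q_star p k L \<A> d (\<i> * of_real y))"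
  unfolding q_star_def
proof (intro tame_expansion_sum tame_expansion_cmult)
  fix l \<alpha> assume l: "l \<in> {1..L}" and al: "\<alpha> \<in> Z_class (\<A> l)"
  obtain A B C where "hyp_form p \<alpha> = (A, B, C)" "A > 0" "C < 0"
    using Z_class_form[OF cl[OF l] al] by metis
  then show "tame_expansion (2 * k) (\<lambda>y. 1 / bqf_eval (hyp_form p \<alpha>) (\<i> * of_real y) 1 ^ k)"
    using tame_expansion_quadratic by simp
qed

lemma q_star_bound:
  "\<exists>K\<ge>0. \<forall>z. Im z > 0 \<longrightarrow> norm (q_star p k L \<A> d z) \<le> K * Im z powr (- real k)"
proof -
  define K where "K = (\<Sum>l=1..L. norm (d l) * (\<Sum>\<alpha>\<in>Z_class (\<A> l). 1 / sqrt (D l) ^ k))"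
  have Dp: "D l > 0" "\<And>z. Im z > 0 \<Longrightarrow> sqrt (D l) * Im z \<le> norm (bqf_eval (hyp_form p \<alpha>) z 1)"
    if l: "l \<in> {1..L}" and al: "\<alpha> \<in> Z_class (\<A> l)" for l \<alpha>
  proof -
    obtain A B C where Q: "(A, B, C) \<in> \<A> l" "hyp_form p \<alpha> = (A, B, C)" "bqf_disc (A, B, C) > 0"
      using Z_class_form[OF cl[OF l] al] by metis
    have "bqf_disc (A, B, C) = D l" using disc[OF l Q(1)] .
    then show "D l > 0" "\<And>z. Im z > 0 \<Longrightarrow> sqrt (D l) * Im z \<le> norm (bqf_eval (hyp_form p \<alpha>) z 1)"
      using Q bqf_eval_lower_bound[of "(A, B, C)"] by auto
  qed
  have "norm (q_star p k L \<A> d z) \<le> K * Im z powr (- real k)" if z: "Im z > 0" for z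
  proof -
    have "norm (q_star p k L \<A> d z) \<le> (\<Sum>l=1..L. norm (d l) * (\<Sum>\<alpha>\<in>Z_class (\<A> l). 1 / sqrt (D l) ^ k / Im z ^ k))"
      unfolding q_star_def
    proof (rule sum_norm_le)
      fix l assume l: "l \<in> {1..L}"
      have "norm (\<Sum>\<alpha>\<in>Z_class (\<A> l). 1 / bqf_eval (hyp_form p \<alpha>) z 1 ^ k) \<le> (\<Sum>\<alpha>\<in>Z_class (\<A> l). 1 / sqrt (D l) ^ k / Im z ^ k)"
      proof (rule sum_norm_le)
        fix \<alpha> assume al: "\<alpha> \<in> Z_class (\<A> l)"
        have pos: "sqrt (D l) * Im z > 0" using Dp(1)[OF l al] z by simp
        have "(sqrt (D l) * Im z) ^ k \<le> norm (bqf_eval (hyp_form p \<alpha>) z 1) ^ k"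
          using Dp(2)[OF l al z] pos by (intro power_mono) auto
        then have "1 / norm (bqf_eval (hyp_form p \<alpha>) z 1) ^ k \<le> 1 / (sqrt (D l) * Im z) ^ k"
          using pos by (intro divide_left_mono mult_pos_pos) (auto intro: less_le_trans[OF zero_less_power[OF pos]])
        then show "norm (1 / bqf_eval (hyp_form p \<alpha>) z 1 ^ k) \<le> 1 / sqrt (D l) ^ k / Im z ^ k"
          by (simp add: norm_divide norm_power power_mult_distrib)
      qed
      then show "norm (d l * (\<Sum>\<alpha>\<in>Z_class (\<A> l). 1 / bqf_eval (hyp_form p \<alpha>) z 1 ^ k)) \<le> norm (d l) * (\<Sum>\<alpha>\<in>Z_class (\<A> l). 1 / sqrt (D l) ^ k / Im z ^ k)"
        unfolding norm_mult by (intro mult_left_mono) auto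
    qed
    also have "\<dots> = K / Im z ^ k" unfolding K_def sum_divide_distrib by (intro sum.cong refl) simp
    finally show ?thesis using z by (simp add: powr_minus powr_realpow divide_inverse)
  qed
  moreover have "K \<ge> 0"
    unfolding K_def
  proof (intro sum_nonneg mult_nonneg_nonneg norm_ge_zero)
    fix l \<alpha> assume l: "l \<in> {1..L}" "\<alpha> \<in> Z_class (\<A> l)"
    show "0 \<le> 1 / sqrt (D l) ^ k" using Dp(1)[OF l] by simp
  qed
  ultimately show ?thesis by blast
qed

lemma q_star_period:
  assumes s: "0 < Re s" "Re s < 1"
  shows "set_integrable lborel {0<..} (\<lambda>y. q_star p k L \<A> d (\<i> * of_real y) * of_real y powr s / of_real y)"
    and "(LINT y:{0<..}|lborel. q_star p k L \<A> d (\<i> * of_real y) * of_real y powr s / of_real y) = - R_fun p k L \<A> D d s"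
proof -
  define f where "f \<alpha> y = 1 / bqf_eval (hyp_form p \<alpha>) (\<i> * of_real y) 1 ^ k * complex_of_real y powr s / of_real y" for \<alpha> y
  have fI: "set_integrable lborel {0<..} (f \<alpha>)" 
    and fv: "(LINT y:{0<..}|lborel. f \<alpha> y) = of_real (D l powr (- real k / 2)) * cpow \<i> s * period_term k \<alpha> s"
    if "l \<in> {1..L}" "\<alpha> \<in> Z_class (\<A> l)" for l \<alpha>
    unfolding f_def using class_period[OF cl[OF that(1)] that(2) disc[OF that(1)] k s] by auto
  have q: "q_star p k L \<A> d (\<i> * of_real y) * complex_of_real y powr s / of_real y = (\<Sum>l=1..L. d l * (\<Sum>\<alpha>\<in>Z_class (\<A> l). f \<alpha> y))" for y
  proof -
    have "(\<Sum>\<alpha>\<in>Z_class (\<A> l). f \<alpha> y) = (\<Sum>\<alpha>\<in>Z_class (\<A> l). 1 / bqf_eval (hyp_form p \<alpha>) (\<i> * of_real y) 1 ^ k) * of_real y powr s / of_real y" for l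
      unfolding f_def by (simp only: sum_distrib_right sum_divide_distrib)
    note sf = this
    have "q_star p k L \<A> d (\<i> * of_real y) * complex_of_real y powr s / of_real y
      = (\<Sum>l=1..L. d l * (\<Sum>\<alpha>\<in>Z_class (\<A> l). 1 / bqf_eval (hyp_form p \<alpha>) (\<i> * of_real y) 1 ^ k) * of_real y powr s / of_real y)"
      unfolding q_star_def sum_distrib_right sum_divide_distrib ..
    then show ?thesis unfolding sf by (simp only: mult.assoc times_divide_eq_right)
  qed
  have sI: "set_integrable lborel {0<..} (\<lambda>y. d l * (\<Sum>\<alpha>\<in>Z_class (\<A> l). f \<alpha> y))" if "l \<in> {1..L}" for l
  proof (rule set_integrable_mult_right)
    show "set_integrable lborel {0<..} (\<lambda>y. \<Sum>\<alpha>\<in>Z_class (\<A> l). f \<alpha> y)"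
      using fI[OF that] unfolding set_integrable_def scaleR_sum_right
      by (intro Bochner_Integration.integrable_sum) auto
  qed
  show "set_integrable lborel {0<..} (\<lambda>y. q_star p k L \<A> d (\<i> * of_real y) * of_real y powr s / of_real y)"
    unfolding q using sI unfolding set_integrable_def scaleR_sum_right
    by (intro Bochner_Integration.integrable_sum) auto
  have "(LINT y:{0<..}|lborel. q_star p k L \<A> d (\<i> * of_real y) * of_real y powr s / of_real y)
     = (\<Sum>l=1..L. (LINT y:{0<..}|lborel. d l * (\<Sum>\<alpha>\<in>Z_class (\<A> l). f \<alpha> y)))"
    unfolding q using sI unfolding set_integrable_def set_lebesgue_integral_def scaleR_sum_right
    by (intro Bochner_Integration.integral_sum) auto
  also have "\<dots> = (\<Sum>l=1..L. d l * of_real (D l powr (- real k / 2)) * cpow \<i> s * (\<Sum>\<alpha>\<in>Z_class (\<A> l). period_term k \<alpha> s))"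
  proof (rule sum.cong[OF refl])
    fix l assume l: "l \<in> {1..L}"
    have "(LINT y:{0<..}|lborel. \<Sum>\<alpha>\<in>Z_class (\<A> l). f \<alpha> y) = (\<Sum>\<alpha>\<in>Z_class (\<A> l). (LINT y:{0<..}|lborel. f \<alpha> y))"
      using fI[OF l] unfolding set_integrable_def set_lebesgue_integral_def scaleR_sum_right
      by (intro Bochner_Integration.integral_sum) auto
    also have "\<dots> = (\<Sum>\<alpha>\<in>Z_class (\<A> l). of_real (D l powr (- real k / 2)) * cpow \<i> s * period_term k \<alpha> s)"
      by (rule sum.cong[OF refl], rule fv[OF l])
    finally show "(LINT y:{0<..}|lborel. d l * (\<Sum>\<alpha>\<in>Z_class (\<A> l). f \<alpha> y)) = d l * of_real (D l powr (- real k / 2)) * cpow \<i> s * (\<Sum>\<alpha>\<in>Z_class (\<A> l). period_term k \<alpha> s)"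
      unfolding set_integral_mult_right by (simp only: sum_distrib_left mult.assoc)
  qed
  finally show "(LINT y:{0<..}|lborel. q_star p k L \<A> d (\<i> * of_real y) * of_real y powr s / of_real y) = - R_fun p k L \<A> D d s"
    unfolding R_fun_eq by simp
qed

text \<open>In this strip both tails and the integral over (0, \<infinity>) converge, so
  \<open>mellin_cont\<close> is the integral itself; cutting at 1 and inverting the lower part gives
  the two summands.\<close>

lemma q_star_functional_equation_strip:
  assumes c: "asymptotic_expansion (\<lambda>y. q_star p k L \<A> d (\<i> * of_real y)) c" and s: "0 < Re s" "Re s < 1"
  shows "mellin_cont (\<lambda>y. q_star p k L \<A> d (\<i> * of_real y)) c (2 * of_nat k - s)
      + mellin_cont (\<lambda>y. q_star p k L \<A> d (\<i> * of_real y)) c s = - R_fun p k L \<A> D d s"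
proof -
  define g where "g y = q_star p k L \<A> d (\<i> * complex_of_real y)" for y
  have tame: "tame_expansion (2 * k) g" unfolding g_def by (rule q_star_tame)
  have k1: "k \<ge> 1" using k_pos by simp
  have I1: "set_integrable lborel {1..} (\<lambda>y. g y * complex_of_real y powr s / of_real y)"
    by (rule tame_expansion_integrable[OF tame]) (use s k1 in simp)
  have I2: "set_integrable lborel {1..} (\<lambda>y. g y * complex_of_real y powr (2 * of_nat k - s) / of_real y)"
    by (rule tame_expansion_integrable[OF tame]) (use s in simp)
  define f where "f y = g y * complex_of_real y powr s / of_real y" for y
  have I: "set_integrable lborel {0<..} f" and val: "(LINT y:{0<..}|lborel. f y) = - R_fun p k L \<A> D d s"
    unfolding f_def g_def using q_star_period[OF s] by auto
  have ginv: "g (1 / y) = of_real y ^ (2 * k) * g y" if "y > 0" for y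
    unfolding g_def by (rule q_star_inversion[OF that])
  have "continuous_on {1..} g" using tame expansion_cont unfolding tame_expansion_def by blast
  then have "continuous_on {0<..1} (\<lambda>y. g (1 / y))"
    by (rule continuous_on_compose2[where t = "{1..}"]) (auto intro!: continuous_intros)
  then have "continuous_on {0<..1} (\<lambda>y. of_real (1 / y) ^ (2 * k) * g (1 / y))"
    by (intro continuous_intros) auto
  moreover have "of_real (1 / y) ^ (2 * k) * g (1 / y) = g y" if "y \<in> {0<..1}" for y
    using that ginv[of y] by (simp add: power_divide)
  ultimately have "continuous_on {0<..1} g" by (rule continuous_on_eq)
  then have cf: "continuous_on {0<..1} f" unfolding f_def by (intro continuous_intros) auto
  have e: "f (1 / y) / of_real y ^ 2 = g y * complex_of_real y powr (2 * of_nat k - s) / of_real y" if "y \<in> {1..}" for y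
  proof -
    have y: "y > 0" using that by simp
    show ?thesis unfolding f_def ginv[OF y] by (rule mellin_kernel_inversion[OF y])
  qed
  have "(LINT y:{0<..1}|lborel. f y) = (LINT y:{1..}|lborel. f (1 / y) / of_real y ^ 2)"
    by (rule lborel_inversion(2)[OF cf, symmetric])
  also have "\<dots> = tail_mellin g (2 * of_nat k - s)"
    unfolding tail_mellin_def by (rule set_lebesgue_integral_cong) (use e in auto)
  finally have "(LINT y:{0<..1}|lborel. f y) = tail_mellin g (2 * of_nat k - s)" .
  moreover have "(LINT y:{1..}|lborel. f y) = tail_mellin g s" by (simp add: tail_mellin_def f_def[abs_def])
  ultimately have "(LINT y:{0<..}|lborel. f y) = tail_mellin g (2 * of_nat k - s) + tail_mellin g s"
    using set_lborel_split_at_1(3)[OF I] by simp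
  then show ?thesis
    using val mellin_cont_eq_tail_mellin(1)[OF c] I1 I2 unfolding g_def by simp
qed

text \<open>Both sides are holomorphic off \<int>, whose complement is connected because \<int> is
  countable, and they agree on a disc inside the strip.\<close>

lemma q_star_functional_equation:
  assumes c: "asymptotic_expansion (\<lambda>y. q_star p k L \<A> d (\<i> * of_real y)) c" and s: "s \<notin> \<int>"
  shows "mellin_cont (\<lambda>y. q_star p k L \<A> d (\<i> * of_real y)) c (2 * of_nat k - s)
      + mellin_cont (\<lambda>y. q_star p k L \<A> d (\<i> * of_real y)) c s = - R_fun p k L \<A> D d s"
proof -
  define M where "M = mellin_cont (\<lambda>y. q_star p k L \<A> d (\<i> * of_real y)) c"
  define X where "X s = M (2 * of_nat k - s) + M s + R_fun p k L \<A> D d s" for s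
  have op: "open (- (\<int> :: complex set))" by (simp add: open_Compl)
  have "countable (\<int> :: complex set)" unfolding Ints_def by simp
  then have "connected (UNIV - (\<int> :: complex set))"
    by (intro connected_open_diff_countable) auto
  then have con: "connected (- (\<int> :: complex set))" by (simp add: Compl_eq_Diff_UNIV)
  have Man: "M analytic_on {w}" if "w \<notin> \<int>" for w
    unfolding M_def using that by (intro mellin_cont_analytic[OF c]) auto
  have M1: "M holomorphic_on - \<int>"
    using Man by (intro analytic_imp_holomorphic) (auto simp: analytic_on_def)
  have "(M \<circ> (\<lambda>s. 2 * of_nat k - s)) holomorphic_on - \<int>"
  proof (rule holomorphic_on_compose_gen[OF _ M1])
    show "(\<lambda>s. 2 * complex_of_nat k - s) ` (- \<int>) \<subseteq> - \<int>"
    proof (rule image_subsetI)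
      fix z :: complex assume z: "z \<in> - \<int>"
      show "2 * of_nat k - z \<in> - \<int>"
      proof
        assume "2 * of_nat k - z \<in> \<int>"
        then show False using z Ints_diff[of "2 * of_nat k" "2 * of_nat k - z"] by (simp add: Ints_mult)
      qed
    qed
  qed (intro holomorphic_intros)
  then have "X holomorphic_on - \<int>" unfolding X_def[abs_def] o_def
    by (intro holomorphic_intros M1 R_fun_holomorphic k_pos)
  moreover have "X z = 0" if "z \<in> ball (1 / 2) (1 / 2)" for z
  proof -
    have "\<bar>Re z - 1 / 2\<bar> < 1 / 2"
      using that abs_Re_le_cmod[of "z - 1 / 2"] by (simp add: dist_norm norm_minus_commute)
    then have "0 < Re z" "Re z < 1" by linarith+
    from q_star_functional_equation_strip[OF c this] show ?thesis by (simp add: X_def M_def)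
  qed
  moreover have "ball (1 / 2) (1 / 2) \<subseteq> - (\<int> :: complex set)"
  proof
    fix z :: complex assume "z \<in> ball (1 / 2) (1 / 2)"
    then have "\<bar>Re z - 1 / 2\<bar> < 1 / 2"
      using abs_Re_le_cmod[of "z - 1 / 2"] by (simp add: dist_norm norm_minus_commute)
    then have "0 < Re z" "Re z < 1" by linarith+
    then show "z \<in> - \<int>" by (auto elim!: Ints_cases)
  qed
  moreover have "(1 / 2) islimpt ball (1 / 2 :: complex) (1 / 2)"
    by (rule interior_limit_point) (simp add: interior_open)
  moreover have "(1 / 2 :: complex) \<in> - \<int>" by (rule subsetD[OF calculation(3)]) simp
  ultimately have "X s = 0"
    using s by (intro analytic_continuation[OF _ op con, of X "ball (1 / 2) (1 / 2)" "1 / 2" s]) auto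
  then show ?thesis by (simp add: X_def M_def add_eq_0_iff)
qed

end

end

section \<open>The functional equation\<close>

text \<open>Decay faster than every power is what makes the tail integral entire and bounded on
  every left half plane; \<open>F\<close> on the imaginary axis decays exponentially.\<close>

definition rapidly_decaying :: "(real \<Rightarrow> complex) \<Rightarrow> bool" where
  "rapidly_decaying f \<longleftrightarrow> continuous_on {1..} f \<and> (\<forall>\<kappa>\<ge>0. \<exists>C. \<forall>y\<ge>1. norm (f y) \<le> C * y powr (- \<kappa>))"

lemma rapidly_decaying_bound:
  assumes "rapidly_decaying f"
  obtains C \<tau> where "\<And>y. y \<ge> 1 \<Longrightarrow> norm (f y) \<le> C * y powr \<tau>" "\<sigma> + \<tau> < 0"
proof -
  obtain C where "\<forall>y\<ge>1. norm (f y) \<le> C * y powr (- (\<bar>\<sigma>\<bar> + 1))"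
    using assms unfolding rapidly_decaying_def by (metis abs_ge_zero add_nonneg_nonneg zero_le_one)
  then show ?thesis using that[of C "- (\<bar>\<sigma>\<bar> + 1)"] by auto
qed

lemma rapidly_decaying_integrable:
  assumes "rapidly_decaying f"
  shows "set_integrable lborel {1..} (\<lambda>y. f y * complex_of_real y powr w / of_real y)"
proof -
  obtain C \<tau> where "\<And>y. y \<ge> 1 \<Longrightarrow> norm (f y) \<le> C * y powr \<tau>" "Re w + \<tau> < 0"
    using rapidly_decaying_bound[OF assms] by blast
  then show ?thesis using assms set_integrable_tail_bound unfolding rapidly_decaying_def by blast
qed

lemma rapidly_decaying_holomorphic:
  assumes "rapidly_decaying f"
  shows "tail_mellin f holomorphic_on UNIV"
proof (rule holomorphic_onI)
  fix w :: complex
  obtain C \<tau> where b: "\<And>y. y \<ge> 1 \<Longrightarrow> norm (f y) \<le> C * y powr \<tau>" "Re w + \<tau> < 0"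
    using rapidly_decaying_bound[OF assms] by blast
  have "tail_mellin f holomorphic_on {w. Re w + \<tau> < 0}"
    using assms b(1) by (intro tail_mellin_holomorphic) (auto simp: rapidly_decaying_def)
  moreover have "open {w. Re w + \<tau> < 0}" by (intro open_Collect_less continuous_intros)
  ultimately have "tail_mellin f field_differentiable at w"
    using b(2) holomorphic_on_imp_differentiable_at by blast
  then show "tail_mellin f field_differentiable at w within UNIV" by simp
qed

lemma rapidly_decaying_bounded:
  assumes "rapidly_decaying f"
  obtains B where "\<And>w. Re w \<le> \<sigma> \<Longrightarrow> norm (tail_mellin f w) \<le> B"
proof -
  obtain C \<tau> where b: "\<And>y. y \<ge> 1 \<Longrightarrow> norm (f y) \<le> C * y powr \<tau>" "\<sigma> + \<tau> < 0"
    using rapidly_decaying_bound[OF assms] by blast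
  then show ?thesis using that tail_mellin_norm_le[OF b(1) _ b(2)] by blast
qed

lemma D_integrand_rapidly_decaying:
  assumes f: "rapidly_decaying (\<lambda>y. F (\<i> * of_real y))"
  shows "set_integrable lborel {1..} (D_integrand k F s)"
    and "D_int k F s = tail_mellin (\<lambda>y. F (\<i> * of_real y)) s - tail_mellin (\<lambda>y. F (\<i> * of_real y)) (2 * of_nat k - s)"
proof -
  have e: "D_integrand k F s = (\<lambda>y. F (\<i> * of_real y) * complex_of_real y powr s / of_real y
      - F (\<i> * of_real y) * complex_of_real y powr (2 * of_nat k - s) / of_real y)"
    by (rule ext) (simp add: D_integrand_def right_diff_distrib diff_divide_distrib)
  note I = rapidly_decaying_integrable[OF f]
  show "set_integrable lborel {1..} (D_integrand k F s)" unfolding e by (intro set_integral_diff(1) I)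
  show "D_int k F s = tail_mellin (\<lambda>y. F (\<i> * of_real y)) s - tail_mellin (\<lambda>y. F (\<i> * of_real y)) (2 * of_nat k - s)"
    unfolding D_int_def e tail_mellin_def by (intro set_integral_diff(2) I)
qed

text \<open>For odd k, \<nu>(1 - z^(-2k)) becomes \<nu>(1 + y^(-2k)) at z = iy, and \<eta>/z
  contributes \<eta>/i at index 1 when k = 1. The coefficients are symmetric under n \<mapsto> 2k -
  n, which makes \<open>q_zero\<close> cancel from the functional equation.\<close>

definition q_zero_coeff :: "nat \<Rightarrow> complex \<Rightarrow> complex \<Rightarrow> nat \<Rightarrow> complex" where
  "q_zero_coeff k \<nu> \<eta> n = (if n = 0 then \<nu> else 0) + (if n = 2 * k then \<nu> else 0)
     + (if n = 1 then if k = 1 then \<eta> / \<i> else 0 else 0)"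

lemma q_zero_coeff_simps:
  assumes "k > 0"
  shows "q_zero_coeff k \<nu> \<eta> 0 = \<nu>" "n > 2 * k \<Longrightarrow> q_zero_coeff k \<nu> \<eta> n = 0"
    "n \<le> 2 * k \<Longrightarrow> q_zero_coeff k \<nu> \<eta> (2 * k - n) = q_zero_coeff k \<nu> \<eta> n"
proof -
  show "q_zero_coeff k \<nu> \<eta> 0 = \<nu>" "n > 2 * k \<Longrightarrow> q_zero_coeff k \<nu> \<eta> n = 0"
    using assms by (simp_all add: q_zero_coeff_def)
  assume n: "n \<le> 2 * k"
  then have "2 * k - n = 0 \<longleftrightarrow> n = 2 * k" "2 * k - n = 2 * k \<longleftrightarrow> n = 0" using assms by linarith+
  moreover have "2 * k - n = 1 \<longleftrightarrow> n = 1" if "k = 1" using n that by linarith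
  ultimately show "q_zero_coeff k \<nu> \<eta> (2 * k - n) = q_zero_coeff k \<nu> \<eta> n"
    by (cases "k = 1") (simp_all add: q_zero_coeff_def)
qed

lemma q_zero_imag_axis:
  assumes "odd k"
  shows "q_zero k \<nu> \<eta> (\<i> * of_real y) = (\<Sum>n\<le>2 * k. q_zero_coeff k \<nu> \<eta> n / of_real y ^ n)"
proof -
  have k0: "1 \<le> 2 * k" using assms by (cases k) auto
  have pw: "(\<i> * complex_of_real y) ^ (2 * k) = - (of_real y ^ (2 * k))"
    using assms by (simp add: power_mult_distrib power_mult)
  have delta: "(\<Sum>n\<le>2 * k. (if n = j then v else 0) / complex_of_real y ^ n) = v / of_real y ^ j" if "j \<le> 2 * k" for j v
  proof -
    have "(\<Sum>n\<le>2 * k. (if n = j then v else 0) / complex_of_real y ^ n) = (\<Sum>n\<le>2 * k. if n = j then v / of_real y ^ j else 0)"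
      by (rule sum.cong) auto
    then show ?thesis using that by simp
  qed
  have "(\<Sum>n\<le>2 * k. q_zero_coeff k \<nu> \<eta> n / of_real y ^ n)
     = \<nu> / of_real y ^ 0 + \<nu> / of_real y ^ (2 * k) + (if k = 1 then \<eta> / \<i> else 0) / of_real y ^ 1"
    unfolding q_zero_coeff_def add_divide_distrib sum.distrib
    by (simp only: delta[OF le0] delta[OF order_refl] delta[OF k0])
  also have "\<dots> = q_zero k \<nu> \<eta> (\<i> * of_real y)"
  proof (cases "k = 1")
    case True
    have "q_zero k \<nu> \<eta> (\<i> * of_real y) = \<nu> * (1 - 1 / (- (of_real y ^ 2))) + \<eta> / (\<i> * of_real y)"
      using pw by (simp add: q_zero_def True)
    also have "\<dots> = \<nu> + \<nu> / of_real y ^ 2 + \<eta> / \<i> / of_real y"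
      by (simp only: right_diff_distrib distrib_left mult_1_right divide_divide_eq_left divide_minus_right diff_minus_eq_add mult_minus_right times_divide_eq_right)
    finally show ?thesis by (simp add: True)
  next
    case False
    then show ?thesis unfolding q_zero_def pw by (simp add: distrib_left)
  qed
  finally show ?thesis by simp
qed

text \<open>Absolute convergence of the Dirichlet series needs a bound on the coefficients. The
  growth of \<open>F\<close> yields O(n^\<kappa>) for \<kappa> above both k and \<beta>, hence the
  alternative Re s > k + 1; the other alternative takes the bound n^\<beta> as given. The functional
  equation is stated off the integers, away from the poles of \<Phi> and from the integers at which
  the Beta values in \<open>R_fun\<close> degenerate.\<close>

theorem theorem1:
  fixes p k L :: nat
    and \<A> :: "nat \<Rightarrow> bqf set"
    and D :: "nat \<Rightarrow> real"
    and d :: "nat \<Rightarrow> complex"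
    and c\<^sub>0 \<nu> \<eta> :: complex
    and q\<^sub>0 qs q F \<Phi> :: "complex \<Rightarrow> complex"
    and a :: "nat \<Rightarrow> complex"
    and \<beta> :: real
  assumes "p \<ge> 3" and "k > 0" and "odd k"
    and "\<And>l. l \<in> {1..L} \<Longrightarrow> hyperbolic_class p (\<A> l)"
    and "\<And>l. l \<in> {1..L} \<Longrightarrow> bqf_neg ` \<A> l = \<A> l"
    and "\<And>l Q. l \<in> {1..L} \<Longrightarrow> Q \<in> \<A> l \<Longrightarrow> bqf_disc Q = D l"
    and "qs = q_star p k L \<A> d"
    and "q\<^sub>0 = q_zero k \<nu> \<eta>"
    and "q = (\<lambda>z. qs z + c\<^sub>0 * q\<^sub>0 z)"
    and "rational_period_function p k q" and "hecke_symmetric p q"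
    and "entire_automorphic_integral p k q F"
    and "\<And>z. z \<in> upper_half_plane \<Longrightarrow>
           (\<lambda>n. a (Suc n) * exp (2 * of_real pi * \<i> * of_nat (Suc n) * z / of_real (hecke_lambda p)))
             sums F z"
    and "\<beta> > 0"
    and "\<And>s. Re s > \<beta> \<Longrightarrow> set_integrable lborel {0<..} (mellin_integrand F s)"
    and "\<And>s. Re s > \<beta> \<Longrightarrow> \<Phi> s = (LINT y:{0<..}|lborel. mellin_integrand F s y)"
  shows
    "(\<forall>s. Re s > \<beta> + 1 \<and> (Re s > real k + 1 \<or> (\<lambda>n. norm (a n)) \<in> O(\<lambda>n. real n powr \<beta>)) \<longrightarrow>
        summable (\<lambda>n. a (Suc n) * of_nat (Suc n) powr (- s)) \<and>
        \<Phi> s = of_real (2 * pi / hecke_lambda p) powr (- s) * Gamma s *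
              (\<Sum>n. a (Suc n) * of_nat (Suc n) powr (- s)))
     \<and> (\<forall>s. set_integrable lborel {1..} (D_integrand k F s))
     \<and> D_int k F holomorphic_on UNIV
     \<and> (\<forall>s. Re s > \<beta> \<longrightarrow>
          s \<in> E_domain k (\<lambda>z. c\<^sub>0 * q\<^sub>0 z) \<and> s \<in> E_domain k qs \<and>
          \<Phi> s = D_int k F s + E_int k (\<lambda>z. c\<^sub>0 * q\<^sub>0 z) s + E_int k qs s)
     \<and> (\<exists>E0. meromorphic_continuation (E_int k (\<lambda>z. c\<^sub>0 * q\<^sub>0 z)) (E_domain k (\<lambda>z. c\<^sub>0 * q\<^sub>0 z)) E0)
     \<and> (\<exists>Es. meromorphic_continuation (E_int k qs) (E_domain k qs) Es)
     \<and> (\<exists>\<Phi>c. meromorphic_continuation \<Phi> {s. Re s > \<beta>} \<Phi>c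
          \<and> (\<forall>z. is_pole \<Phi>c z \<longrightarrow>
                (\<exists>m::int. z = of_int m \<and> m \<le> 2 * int k) \<and> zorder \<Phi>c z = -1)
          \<and> (\<forall>\<sigma>1 \<sigma>2 t0. t0 > 0 \<longrightarrow> bounded (\<Phi>c ` lacunary_strip \<sigma>1 \<sigma>2 t0))
          \<and> (\<forall>s. s \<notin> \<int> \<longrightarrow> \<Phi>c (2 * of_nat k - s) + \<Phi>c s = R_fun p k L \<A> D d s))"
proof -
  note p = assms(1) and kpos = assms(2) and k = assms(3)
  note cl = assms(4) and neg = assms(5) and disc = assms(6)
  note lam = hecke_lambda_bounds[OF p]
  have four: "(\<lambda>n. a (Suc n) * exp (2 * of_real pi * \<i> * of_nat (Suc n) * z / of_real (hecke_lambda p))) sums F z"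
    if "Im z > 0" for z
    using assms(13)[of z] that by (simp add: upper_half_plane_def)
  have Fhol: "F holomorphic_on upper_half_plane"
    and feq: "\<And>z. Im z > 0 \<Longrightarrow> F (- 1 / z) / z ^ (2 * k) = F z + q z"
    using assms(12) by (auto simp: entire_automorphic_integral_def upper_half_plane_def)

  \<comment> \<open>\<open>F\<close> on the imaginary axis and the entire part of \<Phi>\<close>
  define \<gamma> where "\<gamma> = 2 * pi / hecke_lambda p"
  have \<gamma>: "\<gamma> > 0" using lam by (simp add: \<gamma>_def)
  define f where "f y = F (\<i> * complex_of_real y)" for y
  have f_cont: "continuous_on {0<..} f"
    unfolding f_def
    by (rule continuous_on_compose2[OF holomorphic_on_imp_continuous_on[OF Fhol]])
       (auto intro!: continuous_intros simp: upper_half_plane_def)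
  have f_rapid: "rapidly_decaying f"
    unfolding rapidly_decaying_def
  proof (intro conjI allI impI)
    show "continuous_on {1..} f" by (rule continuous_on_subset[OF f_cont]) auto
    fix \<kappa> :: real assume \<kappa>: "\<kappa> \<ge> 0"
    obtain C where C: "C \<ge> 0" "\<And>z. Im z \<ge> 1 \<Longrightarrow> norm (F z) \<le> C * exp (- \<gamma> * Im z)"
      using fourier_decay[OF lam(1) four zero_less_one] unfolding \<gamma>_def by blast
    obtain M where M: "\<And>y. y > 0 \<Longrightarrow> exp (- \<gamma> * y) \<le> M * y powr (- \<kappa>)"
      using exp_neg_le_powr[OF \<gamma> \<kappa>] by blast
    have "norm (f y) \<le> C * M * y powr (- \<kappa>)" if "y \<ge> 1" for y
      using C(2)[of "\<i> * of_real y"] mult_left_mono[OF M[of y] C(1)] that by (simp add: f_def mult.assoc)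
    then show "\<exists>C. \<forall>y\<ge>1. norm (f y) \<le> C * y powr (- \<kappa>)" by blast
  qed
  note f_int = rapidly_decaying_integrable[OF f_rapid]
  note D_facts = D_integrand_rapidly_decaying[OF f_rapid[unfolded f_def], folded f_def]
  have tail_hol: "tail_mellin f holomorphic_on UNIV" by (rule rapidly_decaying_holomorphic[OF f_rapid])
  have "(\<lambda>s. 2 * of_nat k - s :: complex) holomorphic_on UNIV" by (intro holomorphic_intros)
  from holomorphic_on_compose_gen[OF this tail_hol]
  have "(\<lambda>s. tail_mellin f (2 * of_nat k - s)) holomorphic_on UNIV" by (simp add: o_def)
  then have D_hol: "D_int k F holomorphic_on UNIV"
    unfolding D_facts(2)[abs_def] by (intro holomorphic_intros tail_hol)

  \<comment> \<open>Expansions of the two parts of the period function\<close>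
  define gs where "gs y = qs (\<i> * complex_of_real y)" for y
  define g0 where "g0 y = c\<^sub>0 * q\<^sub>0 (\<i> * complex_of_real y)" for y
  have gs_q: "gs = (\<lambda>y. q_star p k L \<A> d (\<i> * complex_of_real y))" by (simp add: gs_def[abs_def] assms(7))
  have gs_tame: "tame_expansion (2 * k) gs"
    unfolding gs_q by (rule q_star_tame[OF p k cl neg disc])
  have qs_bound: "\<exists>K\<ge>0. \<forall>z. Im z > 0 \<longrightarrow> norm (qs z) \<le> K * Im z powr (- real k)"
    unfolding assms(7) by (rule q_star_bound[OF p k cl neg disc])
  obtain cs where cs: "asymptotic_expansion gs cs" using gs_tame unfolding tame_expansion_def by blast
  define e where "e n = c\<^sub>0 * q_zero_coeff k \<nu> \<eta> n" for n
  have e0: "e n = 0" if "n > 2 * k" for n using q_zero_coeff_simps(2)[OF kpos that] by (simp add: e_def)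
  have g0_eq: "g0 = (\<lambda>y. \<Sum>n\<le>2 * k. e n / of_real y ^ n)"
    unfolding g0_def assms(8) q_zero_imag_axis[OF k] e_def sum_distrib_left by simp
  have ce: "asymptotic_expansion g0 e" unfolding g0_eq by (rule asymptotic_expansion_poly[OF e0])
  have M0: "mellin_cont g0 e w = (\<Sum>n\<le>2 * k. e n / (of_nat n - w))" for w
    unfolding g0_eq by (rule mellin_cont_poly[OF e0])
  have cq: "asymptotic_expansion (\<lambda>y. gs y + g0 y) (\<lambda>n. cs n + e n)" by (rule asymptotic_expansion_add[OF cs ce])
  define M where "M = mellin_cont (\<lambda>y. gs y + g0 y) (\<lambda>n. cs n + e n)"
  have M_split: "M w = mellin_cont gs cs w + mellin_cont g0 e w" for w
    unfolding M_def by (rule mellin_cont_add[OF cs ce])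

  have dom_s: "s \<in> E_domain k qs \<longleftrightarrow> set_integrable lborel {1..} (\<lambda>y. gs y * of_real y powr (2 * of_nat k - s) / of_real y)" for s
    by (simp add: E_domain_def mellin_integrand_def[abs_def] gs_def)
  have dom_0: "s \<in> E_domain k (\<lambda>z. c\<^sub>0 * q\<^sub>0 z) \<longleftrightarrow> set_integrable lborel {1..} (\<lambda>y. g0 y * of_real y powr (2 * of_nat k - s) / of_real y)" for s
    by (simp add: E_domain_def mellin_integrand_def[abs_def] g0_def)
  have Es_eq: "E_int k qs s = - tail_mellin gs (2 * of_nat k - s)" for s
    by (simp add: E_int_def tail_mellin_def mellin_integrand_def[abs_def] gs_def)
  have E0_eq: "E_int k (\<lambda>z. c\<^sub>0 * q\<^sub>0 z) s = - tail_mellin g0 (2 * of_nat k - s)" for s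
    by (simp add: E_int_def tail_mellin_def mellin_integrand_def[abs_def] g0_def)

  \<comment> \<open>Decomposition of \<Phi> where its integral converges\<close>
  have main: "s \<in> E_domain k (\<lambda>z. c\<^sub>0 * q\<^sub>0 z) \<and> s \<in> E_domain k qs \<and>
          \<Phi> s = D_int k F s + E_int k (\<lambda>z. c\<^sub>0 * q\<^sub>0 z) s + E_int k qs s" if s: "Re s > \<beta>" for s
  proof -
    define h where "h = mellin_integrand F s"
    have hI: "set_integrable lborel {0<..} h" unfolding h_def by (rule assms(15)[OF s])
    note sp = set_lborel_split_at_1[OF hI]
    have h_eq: "h y = f y * of_real y powr s / of_real y" for y by (simp add: h_def mellin_integrand_def f_def)
    have h_cont: "continuous_on {0<..1} h"
      unfolding h_eq[abs_def] by (intro continuous_intros continuous_on_subset[OF f_cont]) auto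
    have hinv: "h (1 / y) / of_real y ^ 2 = - (f y * of_real y powr (2 * of_nat k - s) / of_real y)
        - (gs y * of_real y powr (2 * of_nat k - s) / of_real y) - g0 y * of_real y powr (2 * of_nat k - s) / of_real y"
      if "y \<in> {1..}" for y
    proof -
      have y: "y > 0" using that by simp
      \<comment> \<open>The source of the minus signs in \<open>D_int\<close> and
        \<open>E_int\<close>.\<close>
      have pw: "(\<i> * complex_of_real y) ^ (2 * k) = - (of_real y ^ (2 * k))"
        using k by (simp add: power_mult_distrib power_mult)
      have "- 1 / (\<i> * complex_of_real y) = \<i> * of_real (1 / y)" using y by (simp add: field_simps)
      then have "f (1 / y) / (- (of_real y ^ (2 * k))) = f y + (gs y + g0 y)"
        using feq[of "\<i> * of_real y"] y pw by (simp add: f_def gs_def g0_def assms(9))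
      moreover have "- (complex_of_real y ^ (2 * k)) \<noteq> 0" using y by simp
      ultimately have "f (1 / y) = (f y + (gs y + g0 y)) * (- (of_real y ^ (2 * k)))"
        by (metis nonzero_divide_eq_eq)
      then have fi: "f (1 / y) = of_real y ^ (2 * k) * (- (f y + gs y + g0 y))"
        by (simp add: algebra_simps)
      have "h (1 / y) / of_real y ^ 2 = - (f y + gs y + g0 y) * of_real y powr (2 * of_nat k - s) / of_real y"
        unfolding h_eq fi by (rule mellin_kernel_inversion[OF y])
      then show ?thesis by (simp add: left_diff_distrib diff_divide_distrib)
    qed
    define w where "w = 2 * of_nat k - s"
    define G where "G u y = u y * complex_of_real y powr w / of_real y" for u y
    have "set_integrable lborel {1..} (\<lambda>y. h (1 / y) / of_real y ^ 2)" using lborel_inversion(1)[OF h_cont] sp(1) by simp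
    then have I1: "set_integrable lborel {1..} (\<lambda>y. - G f y - G gs y - G g0 y)"
      by (rule set_integrable_cong[THEN iffD1, OF refl refl, rotated]) (simp add: hinv G_def w_def)
    have If: "set_integrable lborel {1..} (G f)" unfolding G_def by (rule f_int)
    have Is: "set_integrable lborel {1..} (G gs)"
      unfolding G_def by (rule tame_expansion_integrable[OF gs_tame]) (use s assms(14) in \<open>simp add: w_def\<close>)
    \<comment> \<open>Convergence of the \<open>g0\<close> part is not estimated but deduced: the
      whole and the other two parts converge.\<close>
    have "set_integrable lborel {1..} (\<lambda>y. (- G f y - G gs y) - (- G f y - G gs y - G g0 y))"
      by (intro set_integral_diff(1) I1 Is) (use If in \<open>simp add: set_integrable_def\<close>)
    then have I0: "set_integrable lborel {1..} (G g0)" by simp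
    have "(LINT y:{0<..1}|lborel. h y) = (LINT y:{1..}|lborel. h (1 / y) / of_real y ^ 2)"
      by (rule lborel_inversion(2)[OF h_cont, symmetric])
    also have "\<dots> = (LINT y:{1..}|lborel. - G f y - G gs y - G g0 y)"
      by (rule set_lebesgue_integral_cong) (use hinv in \<open>auto simp: G_def w_def\<close>)
    also have "\<dots> = - tail_mellin f w - tail_mellin gs w - tail_mellin g0 w"
      using If Is I0 unfolding tail_mellin_def G_def[symmetric] set_lebesgue_integral_def set_integrable_def
      by (simp add: scaleR_diff_right)
    finally have "(LINT y:{0<..1}|lborel. h y) = - tail_mellin f w - tail_mellin gs w - tail_mellin g0 w" .
    moreover have "(LINT y:{1..}|lborel. h y) = tail_mellin f s" by (simp add: tail_mellin_def h_eq[abs_def])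
    ultimately have "\<Phi> s = - tail_mellin f w - tail_mellin gs w - tail_mellin g0 w + tail_mellin f s"
      using sp(3) assms(16)[OF s, folded h_def] by simp
    then show ?thesis
      using Is I0 unfolding dom_s dom_0 Es_eq E0_eq D_facts(2) w_def[symmetric] G_def[abs_def] by simp
  qed

  \<comment> \<open>If \<beta> < 2k, the integral of the \<open>g0\<close> part would converge at s
    = 2k, where the constant term of its expansion contributes a multiple of 1/y.\<close>
  have \<beta>2k: "\<beta> \<ge> 2 * real k" if "c\<^sub>0 * \<nu> \<noteq> 0"
  proof (rule ccontr)
    assume "\<not> \<beta> \<ge> 2 * real k"
    define s where "s = complex_of_real (2 * real k)"
    have "s \<in> E_domain k (\<lambda>z. c\<^sub>0 * q\<^sub>0 z)" using main[of s] \<open>\<not> \<beta> \<ge> 2 * real k\<close> by (simp add: s_def)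
    then have "e 0 = 0"
      unfolding dom_0 using expansion_coeff_eq_0[OF ce, of "2 * of_nat k - s" 0] by (simp add: s_def)
    then show False using that q_zero_coeff_simps(1)[OF kpos] by (simp add: e_def)
  qed

  \<comment> \<open>Growth of the coefficients and the Dirichlet series\<close>
  have dirichlet: "summable (\<lambda>n. norm (a (Suc n)) * real (Suc n) powr (- Re s))"
    if s: "Re s > \<beta> + 1" and alt: "Re s > real k + 1 \<or> (\<lambda>n. norm (a n)) \<in> O(\<lambda>n. real n powr \<beta>)" for s
  proof -
    have "\<exists>\<kappa> B. \<kappa> < Re s - 1 \<and> (\<forall>\<^sub>F n in sequentially. norm (a (Suc n)) \<le> B * real (Suc n) powr \<kappa>)"
      using alt
    proof
      assume "(\<lambda>n. norm (a n)) \<in> O(\<lambda>n. real n powr \<beta>)"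
      then obtain B where "\<forall>\<^sub>F n in sequentially. norm (norm (a n)) \<le> B * norm (real n powr \<beta>)" by (elim landau_o.bigE)
      then have "\<forall>\<^sub>F n in sequentially. norm (norm (a (Suc n))) \<le> B * norm (real (Suc n) powr \<beta>)"
        by (rule eventually_compose_filterlim[OF _ filterlim_Suc])
      then show ?thesis using s by (intro exI[of _ \<beta>] exI[of _ B]) auto
    next
      assume sk: "Re s > real k + 1"
      \<comment> \<open>Halfway between max(k, \<beta>) and Re s - 1: growth n^\<kappa> can be
        proved and is still summable against n^(-Re s).\<close>
      define \<kappa> where "\<kappa> = (max (real k) \<beta> + (Re s - 1)) / 2"
      have \<kappa>: "\<kappa> > real k" "\<kappa> > \<beta>" "\<kappa> < Re s - 1" using s sk by (auto simp: \<kappa>_def)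
      \<comment> \<open>Chosen so that \<lambda>^2/4 + y0^2 lies halfway between \<lambda>^2/4 and
        1; here \<lambda> < 2 enters.\<close>
      define y0 where "y0 = sqrt ((1 - (hecke_lambda p)\<^sup>2 / 4) / 2)"
      have l4: "(hecke_lambda p)\<^sup>2 < 2\<^sup>2" using lam by (intro power_strict_mono) auto
      have y0sq: "y0\<^sup>2 = (1 - (hecke_lambda p)\<^sup>2 / 4) / 2" using l4 by (simp add: y0_def)
      have "0 < (1 - (hecke_lambda p)\<^sup>2 / 4) / 2" using l4 by simp
      moreover have "(1 - (hecke_lambda p)\<^sup>2 / 4) / 2 \<le> 1"
      proof -
        have "- 4 \<le> (hecke_lambda p)\<^sup>2" by (rule order_trans[of _ 0]) auto
        then show ?thesis by (simp add: field_simps)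
      qed
      moreover have "(hecke_lambda p)\<^sup>2 / 4 + y0\<^sup>2 < 1" using l4 unfolding y0sq by (simp add: field_simps)
      ultimately have y0: "0 < y0" "(hecke_lambda p)\<^sup>2 / 4 + y0\<^sup>2 < 1" "y0 \<le> 1"
        unfolding y0_def real_sqrt_le_1_iff real_sqrt_gt_0_iff by auto
      \<comment> \<open>The constant cancels \<open>c\<^sub>0 * \<nu>\<close> times 1 - z^(-2k) in
        the period function. What is left, \<open>hh\<close>, is O(y^(-k)) with y = Im z, which
        z^(-2k) itself is not.\<close>
      define F1 where "F1 z = F z + c\<^sub>0 * \<nu>" for z
      define hh where "hh z = qs z + (if k = 1 then c\<^sub>0 * \<eta> / z else 0)" for z
      obtain K0 where K0: "K0 \<ge> 0" "\<And>z. Im z > 0 \<Longrightarrow> norm (qs z) \<le> K0 * Im z powr (- real k)"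
        using qs_bound by blast
      define K where "K = K0 + norm (c\<^sub>0 * \<eta>)"
      have hh_bd: "norm (hh z) \<le> K * Im z powr (- real k)" if z: "Im z > 0" for z
      proof -
        have "norm (if k = 1 then c\<^sub>0 * \<eta> / z else 0) \<le> norm (c\<^sub>0 * \<eta>) * Im z powr (- real k)"
        proof (cases "k = 1")
          case True
          have "Im z \<le> norm z" using abs_Im_le_cmod[of z] by simp
          then have "norm (c\<^sub>0 * \<eta>) / norm z \<le> norm (c\<^sub>0 * \<eta>) / Im z" using z by (intro divide_left_mono) (auto intro!: mult_pos_pos)
          then show ?thesis using True z by (simp add: norm_divide powr_minus divide_inverse norm_mult norm_inverse)
        qed simp
        then have "norm (hh z) \<le> K0 * Im z powr (- real k) + norm (c\<^sub>0 * \<eta>) * Im z powr (- real k)"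
          unfolding hh_def by (rule norm_triangle_mono[OF K0(2)[OF z]])
        then show ?thesis by (simp add: K_def distrib_right)
      qed
      have T1: "F1 (- 1 / z) / z ^ (2 * k) = F1 z + hh z" if z: "Im z > 0" for z
      proof -
        have "z \<noteq> 0" using z by auto
        have "F1 (- 1 / z) / z ^ (2 * k) = (F z + q z) + c\<^sub>0 * \<nu> / z ^ (2 * k)"
          using feq[OF z] by (simp add: F1_def add_divide_distrib)
        also have "\<dots> = F1 z + hh z"
          by (cases "k = 1") (auto simp: F1_def hh_def assms(9) assms(8) q_zero_def power2_eq_square algebra_simps)
        finally show ?thesis .
      qed
      obtain C0 where C0: "C0 \<ge> 0" "\<And>z. Im z \<ge> y0 \<Longrightarrow> norm (F z) \<le> C0 * exp (- \<gamma> * Im z)"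
        using fourier_decay[OF lam(1) four y0(1)] unfolding \<gamma>_def by blast
      have C0': "norm (F z) \<le> C0" if "Im z \<ge> y0" for z
      proof -
        have "exp (- \<gamma> * Im z) \<le> 1" using that y0 \<gamma> by simp
        then have "C0 * exp (- \<gamma> * Im z) \<le> C0 * 1" using C0(1) by (intro mult_left_mono)
        then show ?thesis using C0(2)[OF that] by simp
      qed
      obtain M1 where M1: "M1 \<ge> 0" "\<And>y. y > 0 \<Longrightarrow> exp (- \<gamma> * y) \<le> M1 * y powr (- \<kappa>)"
        using exp_neg_le_powr[OF \<gamma>, of \<kappa>] \<kappa>(1) by auto
      define C1 where "C1 = C0 * M1 + C0 + norm (c\<^sub>0 * \<nu>)"
      have C1: "C1 \<ge> 0" using C0 M1 by (simp add: C1_def)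
      have top: "norm (F1 (- 1 / z)) / norm z ^ (2 * k) \<le> C1 * Im z powr (- \<kappa>)"
        if z: "Im z > 0" "norm z \<le> 1" "Im (- 1 / z) \<ge> y0" for z
      proof -
        define y where "y = Im z"
        have nz: "norm z > 0" using z by auto
        have yn: "y \<le> norm z" using abs_Im_le_cmod[of z] z by (simp add: y_def)
        have Imw: "Im (- 1 / z) = y / (norm z)\<^sup>2" by (simp add: Im_divide y_def cmod_power2)
        show ?thesis
        \<comment> \<open>If the constant is 0, \<open>F1\<close> equals \<open>F\<close>, and its
          exponential decay at infinity pays for the factor |z|^(-2k). Otherwise \<open>F1\<close>
          is only bounded there, but then \<kappa> > \<beta> \<ge> 2k, and y \<le> |z| \<le> 1 gives
          the bound.\<close>
        proof (cases "c\<^sub>0 * \<nu> = 0")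
          case True
          have "norm (F1 (- 1 / z)) \<le> C0 * (M1 * (y / (norm z)\<^sup>2) powr (- \<kappa>))"
          proof -
            have "norm (F (- 1 / z)) \<le> C0 * exp (- \<gamma> * Im (- 1 / z))" by (rule C0(2)[OF z(3)])
            also have "\<dots> \<le> C0 * (M1 * (Im (- 1 / z)) powr (- \<kappa>))"
              using z(3) y0(1) by (intro mult_left_mono M1 C0) auto
            finally show ?thesis unfolding Imw F1_def True by simp
          qed
          then have "norm (F1 (- 1 / z)) / norm z ^ (2 * k) \<le> C0 * (M1 * (y / (norm z)\<^sup>2) powr (- \<kappa>)) / norm z ^ (2 * k)"
            by (intro divide_right_mono) auto
          also have "\<dots> = C0 * M1 * y powr (- \<kappa>) * norm z powr (2 * (\<kappa> - real k))"
          proof -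
            have "(y / (norm z)\<^sup>2) powr (- \<kappa>) = y powr (- \<kappa>) * norm z powr (2 * \<kappa>)"
            proof -
              have "(norm z)\<^sup>2 = norm z powr 2" using nz by (simp add: powr_numeral)
              then have "(norm z)\<^sup>2 powr (- \<kappa>) = norm z powr (- (2 * \<kappa>))" by (simp only: powr_powr) simp
              also have "\<dots> = 1 / norm z powr (2 * \<kappa>)" by (rule powr_minus_divide)
              finally show ?thesis using z(1) by (simp add: powr_divide y_def)
            qed
            moreover have "norm z ^ (2 * k) = norm z powr (2 * real k)" using nz powr_realpow[of "norm z" "2 * k"] by simp
            ultimately show ?thesis using nz by (simp add: powr_diff right_diff_distrib)
          qed
          also have "\<dots> \<le> C0 * M1 * y powr (- \<kappa>) * 1"
            using nz z(2) \<kappa>(1) C0 M1 by (intro mult_left_mono powr_le1) auto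
          also have "\<dots> \<le> C1 * y powr (- \<kappa>)" using C0 M1 by (auto intro!: mult_right_mono simp: C1_def)
          finally show ?thesis by (simp add: y_def)
        next
          case False
          then have k2: "\<kappa> \<ge> 2 * real k" using \<beta>2k \<kappa>(2) by linarith
          have y1: "0 < y" "y \<le> 1" using z yn by (auto simp: y_def)
          have "norm (F1 (- 1 / z)) \<le> C0 + norm (c\<^sub>0 * \<nu>)"
            unfolding F1_def by (rule norm_triangle_mono[OF C0'[OF z(3)] order_refl])
          also have "\<dots> \<le> C1" using C0 M1 by (simp add: C1_def)
          finally have "norm (F1 (- 1 / z)) / norm z ^ (2 * k) \<le> C1 / y ^ (2 * k)"
            using yn y1 C1 by (intro frac_le power_mono) auto
          also have "\<dots> = C1 * y powr (- (2 * real k))" using y1 powr_realpow[of y "2 * k"] by (simp add: powr_minus divide_inverse)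
          also have "\<dots> \<le> C1 * y powr (- \<kappa>)" using y1 k2 C1 by (intro mult_left_mono powr_mono') auto
          finally show ?thesis by (simp add: y_def)
        qed
      qed
      have per: "F1 (z + of_int m * of_real (hecke_lambda p)) = F1 z" if "Im z > 0" for z m
        unfolding F1_def using fourier_periodic[OF lam(1) four that] by simp
      have top2: "norm (F1 z) \<le> C0 + norm (c\<^sub>0 * \<nu>)" if "Im z = y0" for z
        unfolding F1_def by (rule norm_triangle_mono[OF C0' order_refl]) (use that in simp)
      have K: "K \<ge> 0" using K0 by (simp add: K_def)
      obtain C where C: "C \<ge> 0" "\<And>z. 0 < Im z \<Longrightarrow> Im z \<le> y0 \<Longrightarrow> norm (F1 z) \<le> C * Im z powr (- \<kappa>)"
        using automorphic_growth[OF lam \<kappa>(1) per T1 hh_bd K y0(1,2) top C1 top2] by blast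
      define C' where "C' = C + norm (c\<^sub>0 * \<nu>)"
      have FC: "norm (F z) \<le> C' * Im z powr (- \<kappa>)" if z: "0 < Im z" "Im z \<le> y0" for z
      proof -
        have "1 \<le> Im z powr (- \<kappa>)"
          using z y0(3) \<kappa>(1) powr_mono'[of "- \<kappa>" 0 "Im z"] by simp
        then have "norm (c\<^sub>0 * \<nu>) * 1 \<le> norm (c\<^sub>0 * \<nu>) * Im z powr (- \<kappa>)" by (intro mult_left_mono) auto
        moreover have "norm (F z) \<le> norm (F1 z) + norm (c\<^sub>0 * \<nu>)"
          unfolding F1_def using norm_triangle_ineq4[of "F z + c\<^sub>0 * \<nu>" "c\<^sub>0 * \<nu>"] by simp
        ultimately show ?thesis using C(2)[OF z] by (simp add: C'_def distrib_right)
      qed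
      have "norm (a (Suc n)) \<le> (C' * y0 powr (- \<kappa>) * exp (\<gamma> * y0)) * real (Suc n) powr \<kappa>" for n
      proof -
        \<comment> \<open>At this height the exponential factor of
          \<open>fourier_coeff_bound\<close> does not depend on n, and y^(-\<kappa>) is a multiple
          of (n + 1)^\<kappa>.\<close>
        define y where "y = y0 / real (Suc n)"
        have y: "0 < y" "y \<le> y0" using y0 by (auto simp: y_def divide_le_eq mult_le_cancel_left1)
        have "norm (a (Suc n)) \<le> C' * y powr (- \<kappa>) * exp (\<gamma> * y * real (Suc n))"
          unfolding \<gamma>_def by (rule fourier_coeff_bound[OF lam(1) four y(1)]) (use FC y in auto)
        also have "\<gamma> * y * real (Suc n) = \<gamma> * y0" by (simp add: y_def del: of_nat_Suc)
        also have "y powr (- \<kappa>) = y0 powr (- \<kappa>) * real (Suc n) powr \<kappa>"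
          using y0 by (simp add: y_def powr_divide powr_minus field_simps del: of_nat_Suc)
        finally show ?thesis by (simp only: mult_ac)
      qed
      then have "\<forall>\<^sub>F n in sequentially. norm (a (Suc n)) \<le> (C' * y0 powr (- \<kappa>) * exp (\<gamma> * y0)) * real (Suc n) powr \<kappa>"
        by (intro always_eventually allI)
      then show ?thesis using \<kappa>(3) by blast
    qed
    then obtain \<kappa> B where \<kappa>: "\<kappa> < Re s - 1" and B: "\<forall>\<^sub>F n in sequentially. norm (a (Suc n)) \<le> B * real (Suc n) powr \<kappa>"
      by blast
    have "summable (\<lambda>n. real n powr (\<kappa> - Re s))" using \<kappa> by (subst summable_real_powr_iff) simp
    then have "summable (\<lambda>n. real (Suc n) powr (\<kappa> - Re s))" by (subst summable_Suc_iff)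
    then have "summable (\<lambda>n. B * real (Suc n) powr (\<kappa> - Re s))" by (rule summable_mult)
    then show ?thesis
    proof (rule summable_comparison_test_ev[rotated])
      show "\<forall>\<^sub>F n in sequentially. norm (norm (a (Suc n)) * real (Suc n) powr (- Re s)) \<le> B * real (Suc n) powr (\<kappa> - Re s)"
        using B
      proof eventually_elim
        case (elim n)
        then have "norm (a (Suc n)) * real (Suc n) powr (- Re s) \<le> B * real (Suc n) powr \<kappa> * real (Suc n) powr (- Re s)"
          by (intro mult_right_mono) auto
        also have "\<dots> = B * real (Suc n) powr (\<kappa> - Re s)" by (simp add: powr_add[symmetric] mult.assoc del: of_nat_Suc)
        finally show ?case by simp
      qed
    qed
  qed
  have part1: "summable (\<lambda>n. a (Suc n) * of_nat (Suc n) powr (- s)) \<and>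
        \<Phi> s = of_real (2 * pi / hecke_lambda p) powr (- s) * Gamma s * (\<Sum>n. a (Suc n) * of_nat (Suc n) powr (- s))"
    if "Re s > \<beta> + 1" "Re s > real k + 1 \<or> (\<lambda>n. norm (a n)) \<in> O(\<lambda>n. real n powr \<beta>)" for s
  proof -
    have s: "Re s > 0" "Re s > \<beta>" using that(1) assms(14) by auto
    show ?thesis
      using fourier_mellin[OF lam(1) four s(1) dirichlet[OF that]] assms(16)[OF s(2)] by simp
  qed

  \<comment> \<open>The continuation of \<Phi>\<close>
  define raw where "raw s = D_int k F s - M (2 * of_nat k - s)" for s
  define \<Phi>c where "\<Phi>c = remove_sings raw"
  have M_an: "M analytic_on {w}" if "w \<notin> \<nat>" for w
    unfolding M_def using that by (intro mellin_cont_analytic[OF cq]) auto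
  have D_an: "D_int k F analytic_on X" for X
    using D_hol analytic_on_open[OF open_UNIV] analytic_on_subset by blast
  have raw_an: "raw analytic_on {s}" if "M analytic_on {2 * of_nat k - s}" for s
  proof -
    have "(M \<circ> (\<lambda>s. 2 * of_nat k - s)) analytic_on {s}"
      by (rule analytic_on_compose) (use that in \<open>auto intro!: analytic_intros\<close>)
    then show ?thesis unfolding raw_def[abs_def] by (intro analytic_intros D_an) (simp add: o_def)
  qed
  have raw_mero: "raw meromorphic_on UNIV"
    unfolding raw_def[abs_def] M_def
    by (intro meromorphic_intros analytic_on_imp_meromorphic_on[OF D_an] meromorphic_on_compose[OF mellin_cont_meromorphic[OF cq]])
       (auto intro!: analytic_intros)
  have \<Phi>c_raw: "\<Phi>c s = raw s" if "M analytic_on {2 * of_nat k - s}" for s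
    unfolding \<Phi>c_def using raw_an[OF that] by simp
  have shift_Z: "2 * of_nat k - s \<notin> \<nat>" "2 * of_nat k - s \<notin> \<int>" if "s \<notin> \<int>" for s :: complex
  proof -
    show "2 * of_nat k - s \<notin> \<int>"
    proof
      assume "2 * of_nat k - s \<in> \<int>"
      then show False using that Ints_diff[of "2 * of_nat k" "2 * of_nat k - s"] by (simp add: Ints_mult)
    qed
    then show "2 * of_nat k - s \<notin> \<nat>" using Nats_subset_Ints by blast
  qed

  have contin: "meromorphic_continuation \<Phi> {s. Re s > \<beta>} \<Phi>c"
    unfolding meromorphic_continuation_def
  proof (intro conjI ballI)
    show "\<Phi>c nicely_meromorphic_on UNIV"
      unfolding \<Phi>c_def by (rule remove_sings_nicely_meromorphic[OF raw_mero])
    fix s assume "s \<in> {s. Re s > \<beta>}"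
    then have s: "Re s > \<beta>" by simp
    note ms = main[OF s]
    have I: "set_integrable lborel {1..} (\<lambda>y. gs y * of_real y powr (2 * of_nat k - s) / of_real y)"
            "set_integrable lborel {1..} (\<lambda>y. g0 y * of_real y powr (2 * of_nat k - s) / of_real y)"
      using ms dom_s dom_0 by auto
    have "set_integrable lborel {1..} (\<lambda>y. (gs y + g0 y) * of_real y powr (2 * of_nat k - s) / of_real y)"
      using set_integral_add(1)[OF I] by (simp add: distrib_right add_divide_distrib)
    from mellin_cont_eq_tail_mellin(2)[OF cq this] have "M analytic_on {2 * of_nat k - s}" unfolding M_def .
    then have "\<Phi>c s = D_int k F s - M (2 * of_nat k - s)" using \<Phi>c_raw by (simp add: raw_def)
    also have "M (2 * of_nat k - s) = tail_mellin gs (2 * of_nat k - s) + tail_mellin g0 (2 * of_nat k - s)"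
      unfolding M_split using mellin_cont_eq_tail_mellin(1)[OF cs I(1)] mellin_cont_eq_tail_mellin(1)[OF ce I(2)] by simp
    finally show "\<Phi>c s = \<Phi> s" using ms unfolding Es_eq E0_eq by simp
  qed

  \<comment> \<open>Location and order of the poles\<close>
  have poles: "(\<exists>m::int. z = of_int m \<and> m \<le> 2 * int k) \<and> zorder \<Phi>c z = -1" if pole: "is_pole \<Phi>c z" for z
  proof -
    have "2 * of_nat k - z \<in> \<nat>"
    proof (rule ccontr)
      assume "2 * of_nat k - z \<notin> \<nat>"
      then have an: "raw analytic_on {z}" using raw_an M_an by blast
      then have "\<Phi>c analytic_on {z}" unfolding \<Phi>c_def by (rule remove_sings_analytic_on)
      then show False using pole analytic_at_imp_no_pole by blast
    qed
    then obtain n where n: "2 * of_nat k - z = of_nat n" by (elim Nats_cases)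
    then have z: "z = of_int (2 * int k - int n)" by (simp add: algebra_simps)
    obtain H where H: "H analytic_on {of_nat n}" "\<forall>\<^sub>F w in at (of_nat n). M w = H w / (w - of_nat n)"
      using mellin_cont_simple[OF cq, of n] unfolding M_def by blast
    \<comment> \<open>At w = 2k - s the denominator w - n is -(s - z), which turns the minus sign in
      front of \<open>M\<close> into a plus.\<close>
    define G where "G s = (s - z) * D_int k F s + H (2 * of_nat k - s)" for s
    have "(H \<circ> (\<lambda>s. 2 * of_nat k - s)) analytic_on {z}"
      by (rule analytic_on_compose) (use H(1) n in \<open>auto intro!: analytic_intros\<close>)
    then have G: "G analytic_on {z}" unfolding G_def[abs_def] by (intro analytic_intros D_an) (simp add: o_def)
    have "filterlim (\<lambda>s. 2 * of_nat k - s) (at (of_nat n)) (at z)"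
    proof (rule filterlim_atI)
      have "((\<lambda>s. 2 * of_nat k - s) \<longlongrightarrow> 2 * of_nat k - z) (at z)" by (intro tendsto_intros)
      then show "((\<lambda>s. 2 * of_nat k - s) \<longlongrightarrow> of_nat n) (at z)" using n by simp
      show "\<forall>\<^sub>F s in at z. 2 * of_nat k - s \<noteq> of_nat n"
        using eventually_neq_at_within[of z z UNIV] by eventually_elim (use n in \<open>auto simp: algebra_simps\<close>)
    qed
    from eventually_compose_filterlim[OF H(2) this]
    have ev1: "\<forall>\<^sub>F s in at z. M (2 * of_nat k - s) = H (2 * of_nat k - s) / (2 * of_nat k - s - of_nat n)" .
    have ev2: "\<forall>\<^sub>F s in at z. \<Phi>c s = raw s"
      unfolding \<Phi>c_def by (rule eventually_remove_sings_eq_at, rule meromorphic_on_isolated_singularity)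
        (rule meromorphic_on_subset[OF raw_mero], simp)
    have "\<forall>\<^sub>F s in at z. \<Phi>c s = G s / (s - z)"
      using ev1 ev2 eventually_neq_at_within[of z z UNIV]
    proof eventually_elim
      case (elim s)
      have eq: "2 * of_nat k - s - of_nat n = - (s - z)" using n by (simp add: algebra_simps)
      have "M (2 * of_nat k - s) = - (H (2 * of_nat k - s) / (s - z))"
        unfolding elim(1) eq by (rule divide_minus_right)
      then show ?case using elim by (simp add: raw_def G_def add_divide_distrib)
    qed
    from simple_pole_zorder[OF G this pole] have "zorder \<Phi>c z = - 1" .
    moreover have "\<exists>m::int. z = of_int m \<and> m \<le> 2 * int k"
      using z by (intro exI[of _ "2 * int k - int n"]) simp
    ultimately show ?thesis by simp
  qed

  \<comment> \<open>Boundedness in lacunary strips\<close>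
  have bdd: "bounded (\<Phi>c ` lacunary_strip \<sigma>1 \<sigma>2 t0)" if t0: "t0 > 0" for \<sigma>1 \<sigma>2 t0
  proof -
    obtain B1 where B1: "\<And>w. Re w \<le> \<sigma>2 \<Longrightarrow> norm (tail_mellin f w) \<le> B1"
      using rapidly_decaying_bounded[OF f_rapid] by blast
    obtain B2 where B2: "\<And>w. Re w \<le> 2 * real k - \<sigma>1 \<Longrightarrow> norm (tail_mellin f w) \<le> B2"
      using rapidly_decaying_bounded[OF f_rapid] by blast
    have "bounded (M ` lacunary_strip (2 * real k - \<sigma>2) (2 * real k - \<sigma>1) t0)"
      unfolding M_def by (rule mellin_cont_bounded[OF cq t0])
    then obtain B3 where B3: "\<And>w. w \<in> lacunary_strip (2 * real k - \<sigma>2) (2 * real k - \<sigma>1) t0 \<Longrightarrow> norm (M w) \<le> B3"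
      unfolding bounded_iff by blast
    have "norm (\<Phi>c s) \<le> B1 + B2 + B3" if s: "s \<in> lacunary_strip \<sigma>1 \<sigma>2 t0" for s
    proof -
      have sr: "\<sigma>1 \<le> Re s" "Re s \<le> \<sigma>2" "t0 \<le> \<bar>Im s\<bar>" using s by (auto simp: lacunary_strip_def)
      then have "s \<notin> \<int>" using t0 by (auto elim!: Ints_cases)
      then have "\<Phi>c s = tail_mellin f s - tail_mellin f (2 * of_nat k - s) - M (2 * of_nat k - s)"
        using \<Phi>c_raw[OF M_an[OF shift_Z(1)]] by (simp add: raw_def D_facts(2))
      also have "norm \<dots> \<le> norm (tail_mellin f s) + norm (tail_mellin f (2 * of_nat k - s)) + norm (M (2 * of_nat k - s))"
        by (meson norm_triangle_ineq4 add_mono order_trans order_refl)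
      also have "\<dots> \<le> B1 + B2 + B3"
        using sr by (intro add_mono B1 B2 B3) (auto simp: lacunary_strip_def)
      finally show ?thesis .
    qed
    then show ?thesis unfolding bounded_iff by blast
  qed

  \<comment> \<open>The functional equation off the integers\<close>
  have fe: "\<Phi>c (2 * of_nat k - s) + \<Phi>c s = R_fun p k L \<A> D d s" if s: "s \<notin> \<int>" for s
  proof -
    have s': "2 * of_nat k - (2 * of_nat k - s) = s" by simp
    have sN: "s \<notin> \<nat>" using s Nats_subset_Ints by blast
    have 1: "\<Phi>c s = D_int k F s - M (2 * of_nat k - s)" using \<Phi>c_raw[OF M_an[OF shift_Z(1)[OF s]]] by (simp add: raw_def)
    have 2: "\<Phi>c (2 * of_nat k - s) = D_int k F (2 * of_nat k - s) - M s"
      using \<Phi>c_raw[of "2 * of_nat k - s"] M_an[OF sN] by (simp add: raw_def)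
    have 3: "D_int k F (2 * of_nat k - s) = - D_int k F s" unfolding D_facts(2) s' by simp
    \<comment> \<open>By the symmetry of the coefficients, the term n of one sum cancels the term 2k
      - n of the other.\<close>
    have 4: "mellin_cont g0 e (2 * of_nat k - s) + mellin_cont g0 e s = 0"
    proof -
      have "mellin_cont g0 e s = (\<Sum>n\<le>2 * k. e n / (of_nat n - s))" by (rule M0)
      also have "\<dots> = (\<Sum>n\<le>2 * k. e (2 * k - n) / (of_nat (2 * k - n) - s))"
        by (rule sum.reindex_bij_witness[of _ "\<lambda>n. 2 * k - n" "\<lambda>n. 2 * k - n"]) auto
      also have "\<dots> = (\<Sum>n\<le>2 * k. - (e n / (of_nat n - (2 * of_nat k - s))))"
      proof (rule sum.cong[OF refl])
        fix n assume "n \<in> {..2 * k}"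
        then have n: "n \<le> 2 * k" by simp
        have "e (2 * k - n) = e n" using q_zero_coeff_simps(3)[OF kpos n] by (simp add: e_def)
        moreover have "of_nat (2 * k - n) - s = - (of_nat n - (2 * of_nat k - s))" using n by (simp add: of_nat_diff)
        ultimately show "e (2 * k - n) / (of_nat (2 * k - n) - s) = - (e n / (of_nat n - (2 * of_nat k - s)))"
          by (simp only: divide_minus_right)
      qed
      also have "\<dots> = - mellin_cont g0 e (2 * of_nat k - s)" unfolding M0 by (rule sum_negf)
      finally show ?thesis by simp
    qed
    have 5: "mellin_cont gs cs (2 * of_nat k - s) + mellin_cont gs cs s = - R_fun p k L \<A> D d s"
      unfolding gs_q by (rule q_star_functional_equation[OF p k cl neg disc cs[unfolded gs_q] s])
    have "M (2 * of_nat k - s) + M s = - R_fun p k L \<A> D d s"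
      using 4 5 unfolding M_split by (metis (no_types, lifting) add.assoc add.commute add_0)
    then have R: "R_fun p k L \<A> D d s = - (M (2 * of_nat k - s) + M s)" by simp
    show ?thesis unfolding 1 2 3 R by simp
  qed

  have E0: "\<exists>E0. meromorphic_continuation (E_int k (\<lambda>z. c\<^sub>0 * q\<^sub>0 z)) (E_domain k (\<lambda>z. c\<^sub>0 * q\<^sub>0 z)) E0"
    using E_continuation[of "\<lambda>z. c\<^sub>0 * q\<^sub>0 z" e k] ce unfolding g0_def[abs_def] by blast
  have Es: "\<exists>Es. meromorphic_continuation (E_int k qs) (E_domain k qs) Es"
    using E_continuation[of qs cs k] cs unfolding gs_def[abs_def] by blast
  show ?thesis
    apply (intro conjI E0 Es D_hol)
       apply (intro allI impI, elim conjE, rule part1; assumption)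
      apply (intro allI D_facts(1))
     apply (intro allI impI, rule main, assumption)
    apply (rule exI[of _ \<Phi>c])
    apply (intro conjI contin)
      apply (intro allI impI, rule poles, assumption)
     apply (intro allI impI, rule bdd, assumption)
    apply (intro allI impI, rule fe, assumption)
    done
qed

end
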